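(* Let $M$ be the rank one Heisenberg (one free boson) vertex operator algebra. Then $$Z_{M}^{(2)}(\tau_1,\tau_2,\epsilon)=\frac{Z_{M}^{(1)}(\tau_1)Z_{M}^{(1)}(\tau_2)}{\prod_{N\in\mathcal{R}}(1-\omega(N))^{1/2}},$$ where $\mathcal R$ is the set of isomorphism classes of rotationless chequered cycles and $\omega$ is the weight function determined by the matrices $A_1,A_2$.
   Context: Notation. $\tau,\tau_1,\tau_2\in\mathbb{H}_1$, $q=e^{2\pi i\tau}$. $E_k(\tau)=0$ for $k$ odd; for $k\ge2$ even $E_k(\tau)=-\frac{B_k}{k!}+\frac{2}{(k-1)!}\sum_{n\ge1}\sigma_{k-1}(n)q^n$. $C(k,l,\tau)=(-1)^{k+1}\frac{(k+l-1)!}{(k-1)!(l-1)!}E_{k+l}(\tau)$ and $A_a(k,l)=\frac{\epsilon^{(k+l)/2}}{\sqrt{kl}}C(k,l,\tau_a)$ for $k,l\ge1$, $a=1,2$. Chequered cycles. A chequered cycle is a (clockwise) oriented polygon with $2n$ nodes ($n\geq 1$), each node labelled by an arbitrary positive integer, whose edges are labelled $1$ or $2$, alternating around the polygon. Isomorphisms preserve orientation, node labels and edge labels. A chequered cycle is rotationless if it has no non-trivial rotation (orientation-preserving automorphism preserving labels). The weight of an edge $E$ with label $a$ going from a node labelled $k$ to a node labelled $l$ is $\omega(E)=A_a(k,l)$, and the weight of a cycle is the product of the weights of its edges. The infinite product is understood as a power series in $\epsilon$. VOA definitions. For a vertex operator algebra $(V,Y,\mathbf 1,\omega)$ of central charge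 $c$ with $Y(v,z)=\sum_n v(n)z^{-n-1}$, the zero mode is $o(v)=v(wt(v)-1)$ for homogeneous $v$ (extended linearly), $Z_V^{(1)}(\tau)=Tr_V(q^{L(0)})$, $Z_V^{(1)}(v,\tau)=Tr_V(o(v)q^{L(0)})$ (no factor $q^{-c/24}$). The square bracket VOA has $Y[v,z]=Y(e^{zL(0)}v,e^z-1)$ and conformal vector $\tilde\omega=\omega-\frac{c}{24}\mathbf 1$; $Y[\tilde\omega,z]=\sum_n L[n]z^{-n-2}$ and $V_{[n]}=\{v: L[0]v=nv\}$. The Li-Zamolodchikov (LiZ) metric of a VOA is the unique bilinear form with $\langle\mathbf 1,\mathbf 1\rangle=1$ and $\langle Y(a,z)b,c\rangle=\langle b,Y(e^{zL(1)}(-z^{-2})^{L(0)}a,z^{-1})c\rangle$; $\langle\,,\rangle_{\mathrm{sq}}$ is that of the square bracket VOA. The genus two partition function in the $\epsilon$-formalism is $Z_V^{(2)}(\tau_1,\tau_2,\epsilon)=\sum_{n\ge0}\epsilon^n\sum_{u\in V_{[n]}}Z_V^{(1)}(u,\tau_1)Z_V^{(1)}(\bar u,\tau_2)$, the inner sum being over any basis of $V_{[n]}$, with $\{\bar u\}$ the dual basis for $\langle\,,\rangle_{\mathrm{sq}}$. The rank one Heisenberg VOA $M$ is generated by a weight one state $a$ with $[a(m),a(n)]=m\delta_{m,-n}$, with Fock basis $a(-1)^{e_1}\cdots a(-p)^{e_p}\mathbf 1$ and conformal vector $\frac12a(-1)^2\mathbf 1$; $Z_M^{(1)}(\tau)=q^{1/24}/\eta(\tau)$.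 *)

theory Defs
  imports "HOL-Analysis.Analysis" "HOL-Computational_Algebra.Computational_Algebra"
    "HOL-Library.Groups_Big_Fun"
begin

section \<open>Vertex operator algebras\<close>

text \<open>
  The locale \<open>voa_data\<close> only fixes the underlying data, so that notions such as gradings and
  Li-Zamolodchikov metrics can be applied both to a VOA and to its square bracket version. Vertex
  operators are given by their modes: \<open>Y v n\<close> is the coefficient of \<open>z powi (- n - 1)\<close>
  in the vertex operator of \<open>v\<close>. All uses of \<open>Sum_any\<close> below are sums with
  finitely many non-zero terms in a VOA.
\<close>

locale voa_data = vector_space scale
  for scale :: "complex \<Rightarrow> 'v \<Rightarrow> 'v::ab_group_add" (infixr "*s" 75) +
  fixes Y :: "'v \<Rightarrow> int \<Rightarrow> 'v \<Rightarrow> 'v"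
    and vac :: 'v
    and conf :: 'v
    and c :: complex
begin

definition L :: "int \<Rightarrow> 'v \<Rightarrow> 'v" where
  "L n = Y conf (n + 1)"

definition grade :: "int \<Rightarrow> 'v set" where
  "grade n = {v. L 0 v = of_int n *s v}"

definition is_basis_of :: "'v set \<Rightarrow> 'v set \<Rightarrow> bool" where
  "is_basis_of U W \<longleftrightarrow> independent U \<and> span U = W"

definition hom_part :: "'v \<Rightarrow> int \<Rightarrow> 'v" where
  "hom_part v = (THE f. (\<forall>n. f n \<in> grade n) \<and> finite {n. f n \<noteq> 0} \<and> v = Sum_any f)"

definition zero_mode :: "'v \<Rightarrow> 'v \<Rightarrow> 'v" where
  "zero_mode v w = Sum_any (\<lambda>n. Y (hom_part v n) (n - 1) w)"

definition trace_on :: "'v set \<Rightarrow> ('v \<Rightarrow> 'v) \<Rightarrow> complex" where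
  "trace_on W f = (let U = (SOME U. is_basis_of U W) in \<Sum>u\<in>U. representation U (f u) u)"

definition one_point :: "'v \<Rightarrow> complex \<Rightarrow> complex" where
  "one_point v \<tau> =
     (\<Sum>\<^sub>\<infinity>n\<in>UNIV. trace_on (grade n) (zero_mode v) * exp (2 * of_real pi * \<i> * \<tau>) powi n)"

definition partition_fun :: "complex \<Rightarrow> complex" where
  "partition_fun \<tau> =
     (\<Sum>\<^sub>\<infinity>n\<in>UNIV. trace_on (grade n) (\<lambda>w. w) * exp (2 * of_real pi * \<i> * \<tau>) powi n)"

text \<open>
  The invariance condition for \<open>u\<close> of weight \<open>k\<close> is the coefficient of
  \<open>z powi (- n - 1)\<close> in the identity between \<open>B (Y(u,z)b) b'\<close> and
  \<open>B b (Y(exp (z L(1)) (- z powi (-2))^L(0) u, 1/z) b')\<close>.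
\<close>

definition is_LiZ_metric :: "('v \<Rightarrow> 'v \<Rightarrow> complex) \<Rightarrow> bool" where
  "is_LiZ_metric B \<longleftrightarrow>
     (\<forall>x. Vector_Spaces.linear scale (*) (B x)) \<and>
     (\<forall>y. Vector_Spaces.linear scale (*) (\<lambda>x. B x y)) \<and>
     B vac vac = 1 \<and>
     (\<forall>k n b b'. \<forall>u\<in>grade k.
        B (Y u n b) b' =
          (- 1) powi k *
            Sum_any (\<lambda>i::nat. B b (Y ((L 1 ^^ i) u) (2 * k - n - 2 - int i) b') / fact i))"

text \<open>
  Square bracket modes: for \<open>v\<close> of weight \<open>k\<close>, the series
  \<open>Y(exp (z L(0)) v, exp z - 1)\<close> is the sum over \<open>m\<close> of
  \<open>exp (k z) * (exp z - 1) powi (- m - 1)\<close> times the mode \<open>Y v m\<close>; the mode with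
  index \<open>n\<close> is the coefficient of \<open>z powi (- n - 1)\<close>.
\<close>

definition sq_coeff :: "int \<Rightarrow> int \<Rightarrow> int \<Rightarrow> complex" where
  "sq_coeff k m n =
     fls_nth (fps_to_fls (fps_exp (of_int k)) * fps_to_fls (fps_exp 1 - 1) powi (- m - 1)) (- n - 1)"

definition sq_mode :: "'v \<Rightarrow> int \<Rightarrow> 'v \<Rightarrow> 'v" where
  "sq_mode v n w =
     Sum_any (\<lambda>k::int. Sum_any (\<lambda>m::int. sq_coeff k m n *s Y (hom_part v k) m w))"

definition sq_conf :: 'v where
  "sq_conf = conf - (c / 24) *s vac"

interpretation sq: voa_data scale sq_mode vac sq_conf c ..

definition sq_grade :: "int \<Rightarrow> 'v set" where
  "sq_grade n = sq.grade n"

definition is_sq_LiZ_metric :: "('v \<Rightarrow> 'v \<Rightarrow> complex) \<Rightarrow> bool" where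
  "is_sq_LiZ_metric B \<longleftrightarrow> sq.is_LiZ_metric B"

definition dual_vec :: "('v \<Rightarrow> 'v \<Rightarrow> complex) \<Rightarrow> 'v set \<Rightarrow> 'v \<Rightarrow> 'v" where
  "dual_vec B U u = (THE w. w \<in> span U \<and> (\<forall>u'\<in>U. B u' w = (if u' = u then 1 else 0)))"

text \<open>
  The genus two partition function as a power series in \<open>\<epsilon>\<close>, computed with the metric
  \<open>B\<close> and with the basis \<open>U n\<close> of the \<open>n\<close>-th graded piece of the square bracket VOA.
\<close>

definition genus_two_partition_fun ::
    "('v \<Rightarrow> 'v \<Rightarrow> complex) \<Rightarrow> (nat \<Rightarrow> 'v set) \<Rightarrow> complex \<Rightarrow> complex \<Rightarrow> complex fps" where
  "genus_two_partition_fun B U \<tau>1 \<tau>2 =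
     Abs_fps (\<lambda>n. \<Sum>u\<in>U n. one_point u \<tau>1 * one_point (dual_vec B (U n) u) \<tau>2)"

end

text \<open>
  The axiom \<open>Borcherds\<close> is the component form of the Jacobi identity.
\<close>

locale voa = voa_data scale Y vac conf c
  for scale :: "complex \<Rightarrow> 'v \<Rightarrow> 'v::ab_group_add" (infixr "*s" 75)
    and Y vac conf c +
  assumes linear_state: "Vector_Spaces.linear scale scale (\<lambda>v. Y v n w)"
    and linear_mode: "Vector_Spaces.linear scale scale (Y v n)"
    and truncation: "\<exists>N. \<forall>n\<ge>N. Y u n v = 0"
    and vacuum: "Y vac n v = (if n = - 1 then v else 0)"
    and creation: "Y v (- 1) vac = v" "n \<ge> 0 \<Longrightarrow> Y v n vac = 0"
    and Borcherds:
      "Sum_any (\<lambda>i::nat. ((of_int m :: complex) gchoose i) *s Y (Y u (r + int i) v) (m + n - int i) w) =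
       Sum_any (\<lambda>i::nat. ((- 1) ^ i * ((of_int r :: complex) gchoose i)) *s
         (Y u (m + r - int i) (Y v (n + int i) w)
          - (- 1) powi r *s Y v (n + r - int i) (Y u (m + int i) w)))"
    and Virasoro:
      "L m (L n v) - L n (L m v) =
         of_int (m - n) *s L (m + n) v +
         (if m + n = 0 then c * (of_int (m ^ 3 - m) / 12) else 0) *s v"
    and translation: "Y (L (- 1) v) n w = (- of_int n) *s Y v (n - 1) w"
    and graded: "span (\<Union>n. grade n) = UNIV"
    and finite_dim: "\<exists>S. finite S \<and> span S = grade n"
    and bounded_below: "\<exists>N. \<forall>n<N. grade n = {0}"
    and vac_weight: "vac \<in> grade 0"
    and conf_weight: "conf \<in> grade 2"

text \<open>
  The Fock basis is indexed by sorted lists of positive integers, the vector with exponents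
  \<open>e\<^sub>1, \<dots>, e\<^sub>p\<close> corresponding to the list containing each \<open>i\<close> exactly
  \<open>e\<^sub>i\<close> times.
\<close>

locale heisenberg_voa = voa scale Y vac conf 1
  for scale :: "complex \<Rightarrow> 'v \<Rightarrow> 'v::ab_group_add" (infixr "*s" 75)
    and Y vac conf +
  fixes a :: 'v
  assumes a_weight: "a \<in> grade 1"
    and a_commutator:
      "Y a m (Y a n v) - Y a n (Y a m v) = (if m = - n then of_int m else 0) *s v"
    and Fock_inj:
      "inj_on (\<lambda>ks. foldr (\<lambda>k. Y a (- int k)) ks vac) {ks. sorted ks \<and> (\<forall>k\<in>set ks. k > 0)}"
    and Fock_basis:
      "is_basis_of
         ((\<lambda>ks. foldr (\<lambda>k. Y a (- int k)) ks vac) ` {ks. sorted ks \<and> (\<forall>k\<in>set ks. k > 0)}) UNIV"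
    and conf_eq: "conf = (1 / 2) *s Y a (- 1) (Y a (- 1) vac)"


section \<open>Eisenstein series and the matrices \<open>A\<^sub>a\<close>\<close>

text \<open>The Bernoulli number \<open>B\<^sub>k\<close> divided by \<open>k!\<close> is the coefficient of
  \<open>x^k\<close> in \<open>x / (exp x - 1)\<close>.\<close>

definition bernoulli :: "nat \<Rightarrow> complex" where
  "bernoulli k = fact k * fps_nth (fps_X / (fps_exp 1 - 1)) k"

definition divisor_sum :: "nat \<Rightarrow> nat \<Rightarrow> nat" where
  "divisor_sum s n = (\<Sum>d | d dvd n. d ^ s)"

definition Eis :: "nat \<Rightarrow> complex \<Rightarrow> complex" where
  "Eis k \<tau> = (if odd k then 0
     else - bernoulli k / fact k +
       2 / fact (k - 1) *
         suminf (\<lambda>n. of_nat (divisor_sum (k - 1) (Suc n)) * exp (2 * of_real pi * \<i> * \<tau>) ^ Suc n))"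

definition C_fun :: "nat \<Rightarrow> nat \<Rightarrow> complex \<Rightarrow> complex" where
  "C_fun k l \<tau> =
     (- 1) ^ (k + 1) * (fact (k + l - 1) / (fact (k - 1) * fact (l - 1))) * Eis (k + l) \<tau>"

text \<open>
  Because of the half-integral powers of \<open>\<epsilon>\<close>, weights are power series in a variable
  \<open>fps_X\<close> standing for \<open>\<epsilon>^(1/2)\<close>.
\<close>

definition A_mat :: "complex \<Rightarrow> nat \<Rightarrow> nat \<Rightarrow> complex fps" where
  "A_mat \<tau> k l = fps_const (C_fun k l \<tau> / of_real (sqrt (real (k * l)))) * fps_X ^ (k + l)"


section \<open>Chequered cycles\<close>

text \<open>
  A chequered cycle with nodes numbered clockwise from an arbitrary starting node is given by the
  list of pairs consisting of the label of a node and the label of the edge leaving that node.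
  Isomorphisms are then rotations of lists.
\<close>

definition chequered_cycle :: "(nat \<times> nat) list \<Rightarrow> bool" where
  "chequered_cycle xs \<longleftrightarrow>
     (\<exists>n\<ge>1. length xs = 2 * n) \<and>
     (\<forall>(k, e)\<in>set xs. k > 0 \<and> e \<in> {1, 2}) \<and>
     (\<forall>i<length xs. snd (xs ! i) \<noteq> snd (xs ! (Suc i mod length xs)))"

definition rotationless :: "(nat \<times> nat) list \<Rightarrow> bool" where
  "rotationless xs \<longleftrightarrow> (\<forall>r. 0 < r \<and> r < length xs \<longrightarrow> rotate r xs \<noteq> xs)"

definition cycle_iso :: "((nat \<times> nat) list \<times> (nat \<times> nat) list) set" where
  "cycle_iso = {(xs, ys). chequered_cycle xs \<and> chequered_cycle ys \<and> (\<exists>r. ys = rotate r xs)}"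

definition rotationless_classes :: "(nat \<times> nat) list set set" where
  "rotationless_classes = {xs. chequered_cycle xs \<and> rotationless xs} // cycle_iso"

definition cycle_weight :: "complex \<Rightarrow> complex \<Rightarrow> (nat \<times> nat) list \<Rightarrow> complex fps" where
  "cycle_weight \<tau>1 \<tau>2 xs =
     (\<Prod>i<length xs. A_mat (if snd (xs ! i) = 1 then \<tau>1 else \<tau>2)
        (fst (xs ! i)) (fst (xs ! (Suc i mod length xs))))"

text \<open>The weight is constant on isomorphism classes.\<close>

definition class_weight :: "complex \<Rightarrow> complex \<Rightarrow> (nat \<times> nat) list set \<Rightarrow> complex fps" where
  "class_weight \<tau>1 \<tau>2 N = the_elem (cycle_weight \<tau>1 \<tau>2 ` N)"


section \<open>Powers and infinite products of formal power series\<close>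

text \<open>\<open>(1 - w)\<close> to the power \<open>s\<close>, for \<open>w\<close> without constant term.\<close>

definition one_minus_power :: "complex fps \<Rightarrow> complex \<Rightarrow> complex fps" where
  "one_minus_power w s = fps_compose (fps_binomial s) (- w)"

text \<open>Unconditional convergence with respect to the usual topology on power series.\<close>

definition has_fps_prod :: "('i \<Rightarrow> complex fps) \<Rightarrow> 'i set \<Rightarrow> complex fps \<Rightarrow> bool" where
  "has_fps_prod f I P \<longleftrightarrow> ((\<lambda>F. \<Prod>i\<in>F. f i) \<longlongrightarrow> P) (finite_subsets_at_top I)"

end

theory Submission
  imports Defs
begin

text \<open>
  The modes \<open>a[n]\<close> of the weight one state in the square bracket VOA again satisfy the Heisenberg
  relations, and \<open>V\<^bsub>[n]\<^esub>\<close> is spanned by their Fock vectors; the invariance of the metric says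
  that \<open>a[-n]\<close> is minus the adjoint of \<open>a[n]\<close>. Zhu's recursion, obtained from the cyclicity of
  traces, shows that the one-point functions satisfy
  \<open>Z(a[-k] v, \<tau>) = \<Sum>l\<ge>1. C(k, l, \<tau>) / l * Z(a[l] v, \<tau>)\<close>. Since
  \<open>L[0] = \<Sum>k\<ge>1. a[-k] a[k]\<close>, inserting \<open>L[0]\<close> into the genus two sum and moving annihilation
  operators from one torus to the other repeatedly gives
  \<open>\<epsilon> dZ/d\<epsilon> = W Z\<close>, where \<open>W\<close> is a sum over closed walks with alternating edge labels.
  Every chequered cycle is a power of a rotationless one in a unique way, and so the logarithmic
  derivative of the product over rotationless cycles is a multiple of the same sum; hence \<open>Z\<close>
  times the square root of the product is constant.
\<close>

text \<open>The square bracket modes arise from the substitution of exp z - 1 for the formal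
  variable, so facts about them reduce to residues and expansions of Laurent series in that
  variable. The basis in the genus two sum is arbitrary; to remove it, the sum is read as one
  functional evaluated at the vector that represents the other functional through the metric. No
  determinant of an infinite matrix appears: both sides are compared through logarithmic
  derivatives, which are finite sums in every degree. The exponent 1/2 answers to the two possible
  labels of the first edge of a cycle: the walks produced by the recursion start with label 1, and
  reversing a cycle matches them with those that start with label 2. Since \<epsilon> is the square
  of the series variable, logarithmic derivatives in that variable are twice those in \<epsilon>.
  Zhu's recursion is proved for formal q-series; convergence is deduced from it afterwards, starting
  with a recursion for the coefficients of the vacuum trace.\<close>

unbundle fps_syntax
unbundle no vec_syntax
no_notation vector_scalar_mult (infixl "*s" 70)


section \<open>Laurent series in \<open>exp z - 1\<close>\<close>

text \<open>The coordinate exp z - 1 of the square bracket formalism. Its derivative is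
  \<open>fls_ex\<close>, so the factor \<open>fls_ex\<close> plays the role of the differential in a
  residue computed in this coordinate.\<close>

definition em1 :: "complex fls" where
  "em1 = fps_to_fls (fps_exp 1 - 1)"

definition fls_ex :: "complex fls" where
  "fls_ex = fps_to_fls (fps_exp 1)"

lemma subdegree_exp_minus_one: "subdegree (fps_exp 1 - 1 :: complex fps) = 1"
  by (rule subdegreeI) auto

lemma fls_ex_conv_em1: "fls_ex = em1 + 1"
  by (simp add: fls_ex_def em1_def)

lemma em1_nonzero [simp]: "em1 \<noteq> 0"
  using subdegree_exp_minus_one by (auto simp: em1_def simp del: fps_to_fls_minus)

lemma fls_subdegree_em1 [simp]: "fls_subdegree em1 = 1"
  unfolding em1_def by (simp only: fls_subdegree_fls_to_fps subdegree_exp_minus_one)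

lemma fls_subdegree_fls_ex [simp]: "fls_subdegree fls_ex = 0"
  unfolding fls_ex_def by (simp add: fls_subdegree_fls_to_fps)

lemma fls_ex_nonzero [simp]: "fls_ex \<noteq> 0"
  unfolding fls_ex_def by simp

lemma em1_powi_mult: "em1 powi p * em1 powi q = em1 powi (p + q)"
  by (simp add: power_int_add)

lemma fls_deriv_em1 [simp]: "fls_deriv em1 = fls_ex"
  by (simp only: em1_def fls_ex_def fls_deriv_fps_to_fls) simp

lemma fls_deriv_ex [simp]: "fls_deriv fls_ex = fls_ex"
  by (simp only: em1_def fls_ex_def fls_deriv_fps_to_fls) simp

lemma fls_deriv_em1_powi:
  "fls_deriv (em1 powi p) = of_int p * (fls_ex * em1 powi (p - 1))"
proof (cases "p \<ge> 0")
  case True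
  then obtain n where n: "p = int n" by (metis nonneg_int_cases)
  show ?thesis
  proof (cases n)
    case (Suc k)
    then have "em1 powi (p - 1) = em1 ^ k" using n by simp
    have "fls_deriv (em1 powi p) = of_nat (Suc k) * em1 ^ k * fls_ex"
      using n Suc by (simp only: power_int_of_nat fls_deriv_power) simp
    then show ?thesis using n Suc \<open>em1 powi (p - 1) = em1 ^ k\<close> by (simp add: mult_ac)
  qed (use n in simp)
next
  case False
  define n where "n = nat (- p)"
  have p: "p = - int n" "n > 0" using False by (auto simp: n_def)
  have "fls_deriv (em1 powi p) = fls_deriv (inverse (em1 ^ n))"
    by (simp add: p power_int_minus)
  also have "\<dots> = - fls_deriv (em1 ^ n) * (inverse (em1 ^ n))\<^sup>2"
    by (simp add: fls_inverse_deriv power2_eq_square)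
  also have "\<dots> = - (of_nat n * em1 ^ (n - 1) * fls_ex) * (inverse (em1 ^ n))\<^sup>2"
    by (simp add: fls_deriv_power mult_ac)
  also have "em1 ^ (n - 1) * (inverse (em1 ^ n))\<^sup>2 = em1 powi (p - 1)"
  proof -
    have "em1 powi (p - 1) = inverse (em1 ^ Suc n)"
      unfolding p(1) power_int_minus[of em1 "int (Suc n)", symmetric, unfolded power_int_of_nat]
      by (rule arg_cong[where f = "\<lambda>n. em1 powi n"]) simp
    then show ?thesis using p(2) by (cases n) (auto simp: field_simps power2_eq_square)
  qed
  then have "- (of_nat n * em1 ^ (n - 1) * fls_ex) * (inverse (em1 ^ n))\<^sup>2
     = of_int p * (fls_ex * em1 powi (p - 1))"
    using p by (simp add: mult_ac)
  finally show ?thesis .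
qed

lemma inverse_em1_residue: "inverse em1 $$ (-1) = 1"
proof -
  have "(1::complex) = (em1 * inverse em1) $$ (1 + (-1))" by simp
  also have "\<dots> = em1 $$ 1 * inverse em1 $$ (-1)"
  proof -
    have "fls_subdegree (inverse em1) = -1"
      using fls_subdegree_power_int[of em1 "-1"] by simp
    then show ?thesis using fls_times_base[of em1 "inverse em1"] by simp
  qed
  also have "em1 $$ 1 = 1" by (simp add: em1_def)
  finally show ?thesis by simp
qed

text \<open>Invariance of the residue under the change of coordinate. Up to the factor p + 1 the
  series is the derivative of a power of \<open>em1\<close>, and derivatives have no residue; for p
  = -1 it is 1 + 1 / (exp z - 1).\<close>

lemma residue_ex_em1_powi: "(fls_ex * em1 powi p) $$ (-1) = (if p = -1 then 1 else 0)"
proof (cases "p = -1")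
  case True
  have "fls_ex * em1 powi p = 1 + inverse em1"
    using True by (simp add: fls_ex_conv_em1 field_simps power_int_minus)
  then show ?thesis using True inverse_em1_residue by simp
next
  case False
  have "0 = fls_deriv (em1 powi (p + 1)) $$ (-1)" by simp
  also have "\<dots> = of_int (p + 1) * (fls_ex * em1 powi p) $$ (-1)"
    by (simp only: fls_deriv_em1_powi) (simp only: fls_mult_of_int_nth(1), simp)
  finally show ?thesis using False by (simp add: add_eq_0_iff del: of_int_add)
qed

lemma fps_to_fls_sum_poly: "fps_to_fls (\<Sum>j\<in>A. f j) = (\<Sum>j\<in>A. fps_to_fls (f j))"
  by (induction A rule: infinite_finite_induct) auto

lemma fls_nth_mult_below:
  assumes "\<And>i. i < a \<Longrightarrow> f $$ i = 0" "\<And>i. i < b \<Longrightarrow> g $$ i = 0" "n < a + b"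
  shows "(f * g) $$ n = (0::complex)"
proof (cases "f = 0 \<or> g = 0")
  case False
  then have "fls_subdegree f \<ge> a" "fls_subdegree g \<ge> b"
    using assms by (auto intro!: fls_subdegree_geI)
  then show ?thesis using assms(3) False by (intro fls_eq0_below_subdegree) auto
qed auto

lemma em1_powi_nth_below: "n < p \<Longrightarrow> (em1 powi p) $$ n = 0"
  by (intro fls_eq0_below_subdegree) simp

lemma ex_em1_powi_nth_below: "n < p \<Longrightarrow> (fls_ex * em1 powi p) $$ n = 0"
  by (intro fls_eq0_below_subdegree) simp

text \<open>The residues on the right are the coefficients of \<open>f\<close> as a Laurent series in the variable
  \<open>exp z - 1\<close>.\<close>

lemma fls_expand_em1:
  assumes "\<And>i. i < d \<Longrightarrow> f $$ i = (0::complex)"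
  shows "f $$ n = (\<Sum>i\<in>{d..n}. (fls_ex * em1 powi (- i - 1) * f) $$ (-1) * (em1 powi i) $$ n)"
proof (cases "d \<le> n")
  case False
  then show ?thesis using assms by simp
next
  case True
  define y where "y = (fps_exp 1 - 1 :: complex fps)"
  define N where "N = nat (n - d)"
  have n: "n = d + int N" using True by (simp add: N_def)
  define F where "F = fls_regpart (f * em1 powi (- d))"
  have "\<And>i. i < 0 \<Longrightarrow> (f * em1 powi (- d)) $$ i = 0"
    by (rule fls_nth_mult_below[where a = d and b = "-d"])
       (auto intro: assms em1_powi_nth_below)
  then have F: "fps_to_fls F = f * em1 powi (- d)"
    unfolding F_def by (intro fls_eqI) auto
  have y0: "y $ 0 = 0" "y $ 1 \<noteq> 0" by (auto simp: y_def)
  \<comment> \<open>Composition with the inverse series re-expands \<open>F\<close> in the variable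
    exp z - 1, so the coefficients of \<open>S\<close> are the ones to be identified with
    residues.\<close>
  define S where "S = F oo fps_inv y"
  have "F = F oo (fps_inv y oo y)"
    using fps_inv[of y] y0 by simp
  also have "\<dots> = S oo y"
    unfolding S_def using y0 by (subst fps_compose_assoc) (auto simp: fps_inv_def)
  finally have FS: "F = S oo y" .
  \<comment> \<open>The tail vanishes up to order \<open>N\<close>, hence contributes neither to the
    coefficient at \<open>n\<close> nor to any of the residues with index at most
    \<open>n\<close>.\<close>
  define R where "R = F - (\<Sum>j\<le>N. fps_const (S $ j) * y ^ j)"
  have R: "R $ k = 0" if "k \<le> N" for k
  proof -
    have "F $ k = (\<Sum>j\<le>k. S $ j * (y ^ j) $ k)"
      unfolding FS by (simp add: fps_compose_nth atLeast0AtMost)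
    also have "\<dots> = (\<Sum>j\<le>N. S $ j * (y ^ j) $ k)"
      using that y0 by (intro sum.mono_neutral_left) (auto intro: startsby_zero_power_prefix[rule_format])
    finally show ?thesis by (simp add: R_def fps_sum_nth)
  qed
  have "fps_to_fls F = (\<Sum>j\<le>N. fls_const (S $ j) * em1 ^ j) + fps_to_fls R"
  proof -
    have "F = (\<Sum>j\<le>N. fps_const (S $ j) * y ^ j) + R" by (simp add: R_def)
    then have "fps_to_fls F = fps_to_fls \<dots>" by simp
    also have "\<dots> = (\<Sum>j\<le>N. fls_const (S $ j) * em1 ^ j) + fps_to_fls R"
      by (simp add: fps_to_fls_sum_poly fps_to_fls_power fls_times_fps_to_fls em1_def y_def)
    finally show ?thesis .
  qed
  moreover have "f = fps_to_fls F * em1 powi d"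
    unfolding F by (simp add: mult.assoc em1_powi_mult)
  ultimately have f: "f = (\<Sum>j\<le>N. fls_const (S $ j) * em1 powi (d + int j)) + fps_to_fls R * em1 powi d"
    by (simp add: distrib_right sum_distrib_right mult.assoc em1_powi_mult[of "int _", unfolded power_int_of_nat] add.commute)
  have coef: "(fls_ex * em1 powi (- i - 1) * f) $$ (-1) = S $ nat (i - d)" if i: "i \<in> {d..n}" for i
  proof -
    have "fls_ex * em1 powi (- i - 1) * f =
       (\<Sum>j\<le>N. fls_const (S $ j) * (fls_ex * em1 powi (d + int j - i - 1)))
        + fps_to_fls R * (fls_ex * em1 powi (d - i - 1))"
    proof -
      have 1: "fls_ex * em1 powi (- i - 1) * (c * em1 powi q) = c * (fls_ex * em1 powi (q - i - 1))" for c q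
        using em1_powi_mult[of "- i - 1" q] by (simp add: algebra_simps)
      show ?thesis
        by (subst f, simp only: distrib_left sum_distrib_left 1)
    qed
    moreover have "(fps_to_fls R * (fls_ex * em1 powi (d - i - 1))) $$ (-1) = 0"
      by (rule fls_nth_mult_below[where a = "int N + 1" and b = "d - i - 1"])
         (use i n in \<open>auto intro!: ex_em1_powi_nth_below R\<close>)
    ultimately have "(fls_ex * em1 powi (- i - 1) * f) $$ (-1) =
       (\<Sum>j\<le>N. S $ j * (if j = nat (i - d) then 1 else 0))"
      using i by (simp add: fls_nth_sum residue_ex_em1_powi, intro sum.cong) auto
    also have "\<dots> = S $ nat (i - d)"
    proof -
      have "nat (i - d) \<le> N" using i n by auto
      then show ?thesis by (simp add: if_distrib[of "\<lambda>x. _ * x"] sum.delta cong: if_cong)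
    qed
    finally show ?thesis .
  qed
  have "(fps_to_fls R * em1 powi d) $$ n = 0"
    by (rule fls_nth_mult_below[where a = "int N + 1" and b = d])
       (use n in \<open>auto intro!: em1_powi_nth_below R\<close>)
  then have "f $$ n = (\<Sum>j\<le>N. S $ j * (em1 powi (d + int j)) $$ n)"
    by (subst f) (simp add: fls_nth_sum)
  also have "\<dots> = (\<Sum>i\<in>{d..n}. S $ nat (i - d) * (em1 powi i) $$ n)"
    by (rule sum.reindex_bij_witness[where i = "\<lambda>i. nat (i - d)" and j = "\<lambda>j. d + int j"])
       (use n in auto)
  finally show ?thesis using coef by simp
qed

text \<open>This is (1 + (exp z - 1))^c = exp (c z): both sides have constant term 1 and solve the
  same linear differential equation of first order.\<close>

lemma fps_binomial_exp: "fps_binomial c oo (fps_exp 1 - 1) = fps_exp (c::complex)"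
proof -
  define y where "y = (fps_exp 1 - 1 :: complex fps)"
  have y0: "y $ 0 = 0" by (simp add: y_def)
  have "fps_deriv (fps_binomial c oo y) = (fps_deriv (fps_binomial c) oo y) * fps_exp 1"
    by (simp add: fps_compose_deriv y0) (simp add: y_def)
  also have "fps_exp 1 = (1 + fps_X) oo y"
    by (simp add: fps_compose_add_distrib y0) (simp add: y_def)
  also have "(fps_deriv (fps_binomial c) oo y) * ((1 + fps_X) oo y) =
     (fps_deriv (fps_binomial c) * (1 + fps_X)) oo y"
    by (simp add: fps_compose_mult_distrib y0)
  also have "fps_deriv (fps_binomial c) * (1 + fps_X) = fps_const c * fps_binomial c"
  proof -
    have "fps_deriv (fps_binomial c) = fps_const c * fps_binomial c / (1 + fps_X)"
      by (rule fps_binomial_deriv)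
    then show ?thesis by (simp add: fps_divide_unit mult.assoc inverse_mult_eq_1)
  qed
  also have "(fps_const c * fps_binomial c) oo y = fps_const c * (fps_binomial c oo y)"
    by (simp add: fps_compose_mult_distrib y0)
  finally have "fps_binomial c oo y = fps_const ((fps_binomial c oo y) $ 0) * fps_exp c"
    by (rule fps_exp_unique_ODE[THEN iffD1])
  then show ?thesis unfolding y_def by simp
qed

text \<open>The coefficient of z^n in the binomial series of (1 + (exp z - 1))^j = exp (j z). Powers
  of \<open>em1\<close> beyond n do not reach this coefficient, so any cut-off from n on is
  allowed.\<close>

lemma sum_gchoose_em1:
  assumes "n \<le> N"
  shows "(\<Sum>i\<le>N. (of_int j gchoose i) * (em1 ^ i) $$ int n) = (of_int j ^ n / fact n :: complex)"
proof -
  define y where "y = (fps_exp 1 - 1 :: complex fps)"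
  have y0: "y $ 0 = 0" by (simp add: y_def)
  have e: "em1 ^ i = fps_to_fls (y ^ i)" for i by (simp add: em1_def y_def fps_to_fls_power)
  have "of_int j ^ n / fact n = (fps_binomial (of_int j) oo y) $ n"
    by (simp add: y_def fps_binomial_exp)
  also have "\<dots> = (\<Sum>i\<le>n. (of_int j gchoose i) * (y ^ i) $ n)"
    by (simp add: fps_compose_nth atLeast0AtMost)
  also have "\<dots> = (\<Sum>i\<le>N. (of_int j gchoose i) * (y ^ i) $ n)"
    using assms y0 by (intro sum.mono_neutral_left) (auto intro: startsby_zero_power_prefix[rule_format])
  finally show ?thesis by (simp add: e)
qed

text \<open>The additional factor exp z turns exp (j z) into exp ((j + 1) z).\<close>

lemma sum_gchoose_ex_em1:
  assumes "n \<le> N"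
  shows "(\<Sum>i\<le>N. (of_int j gchoose i) * (fls_ex * em1 ^ i) $$ int n) =
    (of_int (j + 1) ^ n / fact n :: complex)"
proof -
  define y where "y = (fps_exp 1 - 1 :: complex fps)"
  have y0: "y $ 0 = 0" by (simp add: y_def)
  have e: "fls_ex * em1 ^ i = fps_to_fls (fps_exp 1 * y ^ i)" for i
    by (simp add: em1_def fls_ex_def y_def fps_to_fls_power fls_times_fps_to_fls)
  have "of_int (j + 1) ^ n / fact n = (fps_exp 1 * (fps_binomial (of_int j) oo y)) $ n"
    by (simp only: y_def fps_binomial_exp flip: fps_exp_add_mult) (simp add: add.commute)
  also have "\<dots> = (\<Sum>k\<le>n. (1 / fact k) * (\<Sum>i\<le>n-k. (of_int j gchoose i) * (y ^ i) $ (n - k)))"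
    by (simp add: fps_mult_nth fps_compose_nth atLeast0AtMost)
  also have "\<dots> = (\<Sum>k\<le>n. (1 / fact k) * (\<Sum>i\<le>N. (of_int j gchoose i) * (y ^ i) $ (n - k)))"
    using assms y0
    by (intro sum.cong arg_cong2[of _ _ _ _ "(*)"] sum.mono_neutral_left)
       (auto intro: startsby_zero_power_prefix[rule_format])
  also have "\<dots> = (\<Sum>i\<le>N. (of_int j gchoose i) * (\<Sum>k\<le>n. (1 / fact k) * (y ^ i) $ (n - k)))"
    unfolding sum_distrib_left by (subst sum.swap) (simp add: mult_ac)
  also have "\<dots> = (\<Sum>i\<le>N. (of_int j gchoose i) * (fps_exp 1 * y ^ i) $ n)"
    by (simp add: fps_mult_nth atLeast0AtMost)
  finally show ?thesis by (simp add: e)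
qed

section \<open>Bernoulli numbers as coefficients of 1 / (exp z - 1)\<close>

lemma bernoulli_conv_em1: "k \<ge> 1 \<Longrightarrow> bernoulli k / fact k = inverse em1 $$ (int k - 1)"
proof -
  assume "k \<ge> 1"
  define y where "y = (fps_exp 1 - 1 :: complex fps)"
  have "y dvd fps_X"
    unfolding y_def using subdegree_exp_minus_one
    by (subst fps_dvd_iff) auto
  then have "fps_X / y * y = fps_X" by simp
  then have "fps_to_fls (fps_X / y) * em1 = fls_X"
    by (metis em1_def fls_times_fps_to_fls fps_X_to_fls y_def)
  then have "fps_to_fls (fps_X / y) = fls_X * inverse em1"
    by (simp add: field_simps)
  then have "(fps_X / y) $ k = (fls_X * inverse em1) $$ int k"
    by (metis fps_to_fls_nth nat_int of_nat_0_le_iff less_le_not_le)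
  also have "\<dots> = inverse em1 $$ (int k - 1)"
    by (simp add: fls_X_times_conv_shift)
  finally show ?thesis by (simp add: bernoulli_def y_def)
qed

text \<open>From 1 / (exp (-z) - 1) = - 1 - 1 / (exp z - 1) it follows that 1 / (exp z - 1) + 1/2 is
  an odd series; only the constant coefficient escapes.\<close>

lemma inverse_em1_even_nth:
  assumes "even n" "n \<noteq> 0"
  shows "inverse em1 $$ n = 0"
proof -
  define X where "X = (fps_const (-1) * fps_X :: complex fps)"
  have X: "X \<noteq> 0" "X $ 0 = 0" by (auto simp: X_def fps_eq_iff)
  have 1: "fls_compose_fps em1 X = fps_to_fls (fps_exp (-1) - 1)"
    unfolding em1_def X_def
    by (simp add: fps_compose_sub_distrib del: fps_to_fls_minus)
  have 2: "fps_to_fls (fps_exp (-1)) * fls_ex = 1"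
    unfolding fls_ex_def by (simp flip: fls_times_fps_to_fls fps_exp_add_mult)
  have 3: "fps_to_fls (fps_exp (-1) - 1) * fls_ex = - em1"
    using 2 by (simp add: left_diff_distrib fls_ex_conv_em1)
  have "fls_compose_fps (inverse em1) X = inverse (fps_to_fls (fps_exp (-1) - 1))"
    using X by (simp add: fls_compose_fps_inverse 1)
  also have "\<dots> = - fls_ex * inverse em1"
  proof -
    have "fps_to_fls (fps_exp (-1) - 1) = - em1 * inverse fls_ex"
      using 3 by (metis fls_ex_nonzero mult.assoc mult.right_neutral right_inverse)
    then show ?thesis by (simp add: field_simps)
  qed
  also have "\<dots> = - 1 - inverse em1" by (simp add: fls_ex_conv_em1 field_simps)
  finally have "fls_compose_fps (inverse em1) X $$ n = (- 1 - inverse em1) $$ n" by simp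
  moreover have "fls_compose_fps (inverse em1) X $$ n = inverse em1 $$ n * (-1) powi n"
    unfolding X_def by (rule fls_nth_fls_compose_fps_linear) simp
  ultimately have "inverse em1 $$ n = - inverse em1 $$ n"
    using assms by simp
  then show ?thesis by simp
qed

text \<open>The sum over m is the coefficient of w^l in exp z / (exp z - exp w), expanded as a
  geometric series in (exp w - 1) / (exp z - 1). This function depends on z - w only, so its
  derivative in w is minus its derivative in z.\<close>

lemma sum_em1_nth_deriv:
  "of_nat (Suc l) * (\<Sum>m\<le>Suc l. fls_const ((em1 ^ m) $$ int (Suc l)) * (fls_ex * em1 powi (- int m - 1))) =
   - fls_deriv (\<Sum>m\<le>l. fls_const ((em1 ^ m) $$ int l) * (fls_ex * em1 powi (- int m - 1)))"
proof -
  define c where "c m = (em1 ^ m) $$ int l" for m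
  define g where "g m = fls_ex * em1 powi (- int m - 1)" for m :: nat
  \<comment> \<open>Both \<open>d\<close> and \<open>s\<close> rewrite exp z as (exp z - 1) + 1,
    which expresses derivatives through neighbouring indices; a shift of the index then matches the
    two sums.\<close>
  have d: "fls_deriv (g m) = - of_nat m * g m - of_nat (Suc m) * g (Suc m)" for m
  proof -
    have e: "fls_ex * (em1 powi (- int m - 1 - 1)) = em1 powi (- int m - 1) + em1 powi (- int m - 1 - 1)"
    proof -
      have "em1 powi (- int m - 1) = em1 powi (- int m - 1 - 1 + 1)"
        by (rule arg_cong[where f = "\<lambda>n. em1 powi n"]) simp
      also have "\<dots> = em1 powi (- int m - 1 - 1) * em1" by (subst power_int_add) auto
      finally show ?thesis unfolding fls_ex_conv_em1 by (simp only: distrib_right mult_1 mult.commute)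
    qed
    have "fls_deriv (g m) = fls_ex * em1 powi (- int m - 1) +
        fls_ex * (of_int (- int m - 1) * (fls_ex * em1 powi (- int m - 1 - 1)))"
      unfolding g_def by (simp add: fls_deriv_em1_powi del: of_int_diff)
    also have "\<dots> = - of_nat m * g m - of_nat (Suc m) * g (Suc m)"
      unfolding e g_def by (simp add: algebra_simps)
    finally show ?thesis .
  qed
  have c0: "c m = 0" if "m > l" for m
    using that em1_powi_nth_below[of "int l" "int m"] by (simp add: c_def)
  have s: "of_nat (Suc l) * (em1 ^ m) $$ int (Suc l) = of_nat m * (c m + (if m = 0 then 0 else c (m - 1)))" for m
  proof (cases m)
    case (Suc k)
    have "of_nat (Suc l) * (em1 ^ m) $$ int (Suc l) = fls_deriv (em1 ^ m) $$ int l"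
      by (simp add: add.commute)
    also have "fls_deriv (em1 ^ m) = of_nat m * (em1 ^ m + em1 ^ k)"
      unfolding Suc fls_deriv_power by (simp add: fls_ex_conv_em1 algebra_simps)
    also have "\<dots> $$ int l = of_nat m * (c m + c k)"
      by (simp add: c_def)
    finally show ?thesis by (simp add: Suc)
  qed simp
  have "of_nat (Suc l) * (\<Sum>m\<le>Suc l. fls_const ((em1 ^ m) $$ int (Suc l)) * g m)
     = (\<Sum>m\<le>Suc l. fls_const (of_nat (Suc l) * (em1 ^ m) $$ int (Suc l)) * g m)"
    by (simp only: sum_distrib_left mult.assoc fls_of_nat flip: fls_const_mult_const)
  also have "\<dots> = (\<Sum>m\<le>Suc l. fls_const (of_nat m * c m) * g m)
     + (\<Sum>m\<le>Suc l. fls_const (of_nat m * (if m = 0 then 0 else c (m - 1))) * g m)"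
    unfolding s by (simp add: distrib_left distrib_right sum.distrib flip: fls_plus_const)
  also have "(\<Sum>m\<le>Suc l. fls_const (of_nat m * c m) * g m) = (\<Sum>m\<le>l. fls_const (of_nat m * c m) * g m)"
    using c0[of "Suc l"] by simp
  also have "(\<Sum>m\<le>Suc l. fls_const (of_nat m * (if m = 0 then 0 else c (m - 1))) * g m)
     = (\<Sum>m\<le>l. fls_const (of_nat (Suc m) * c m) * g (Suc m))"
    by (subst sum.atMost_Suc_shift) simp
  finally have "of_nat (Suc l) * (\<Sum>m\<le>Suc l. fls_const ((em1 ^ m) $$ int (Suc l)) * g m) =
     (\<Sum>m\<le>l. fls_const (of_nat m * c m) * g m) + (\<Sum>m\<le>l. fls_const (of_nat (Suc m) * c m) * g (Suc m))" .
  also have "\<dots> = - (\<Sum>m\<le>l. fls_const (c m) * fls_deriv (g m))"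
    unfolding d
    by (simp add: sum_negf sum_subtractf algebra_simps sum.distrib fls_of_nat flip: fls_const_mult_const fls_plus_const)
  also have "\<dots> = - fls_deriv (\<Sum>m\<le>l. fls_const (c m) * g m)"
    by (simp add: fls_deriv_sum)
  finally show ?thesis by (simp add: c_def g_def)
qed

text \<open>At l = 0 the series is exp z / (exp z - 1) = 1 + 1 / (exp z - 1), and l applications of
  the derivative relation express the coefficient at k - 1 through the one at k + l - 1. The result
  is the constant term of C(k, l, \<tau>) / l.\<close>

lemma sum_em1_bernoulli:
  assumes "k \<ge> 1" "l \<ge> 1"
  shows "(\<Sum>m\<le>l. (fls_ex * em1 powi (- int m - 1)) $$ (int k - 1) * (em1 ^ m) $$ int l) =
    (if odd (k + l) then 0
     else (- 1) ^ l * (fact (k + l - 1) / (fact (k - 1) * fact l)) * (bernoulli (k + l) / fact (k + l)))"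
proof -
  define H where "H l = (\<Sum>m\<le>l. fls_const ((em1 ^ m) $$ int l) * (fls_ex * em1 powi (- int m - 1)))" for l
  have H0: "H 0 = 1 + inverse em1"
    by (simp add: H_def power_int_minus) (simp add: fls_ex_conv_em1 field_simps)
  have step: "H (Suc l) $$ n = - (of_int (n + 1) * H l $$ (n + 1)) / of_nat (Suc l)" for l n
  proof -
    have "(of_nat (Suc l) * H (Suc l)) $$ n = (- fls_deriv (H l)) $$ n"
      unfolding H_def sum_em1_nth_deriv ..
    then have "of_nat (Suc l) * H (Suc l) $$ n = - (of_int (n + 1) * H l $$ (n + 1))"
      by (simp only: fls_mult_of_nat_nth fls_uminus_nth fls_deriv_nth)
    then show ?thesis
      using nonzero_eq_divide_eq[of "of_nat (Suc l) :: complex" "H (Suc l) $$ n"] of_nat_neq_0[of l, where 'a = complex]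
      by (metis mult.commute)
  qed
  have H: "H l $$ int n = (- 1) ^ l * fact (n + l) / (fact n * fact l) * H 0 $$ int (n + l)" for l n
  proof (induction l arbitrary: n)
    case (Suc l)
    have "H (Suc l) $$ int n = - (of_nat (Suc n) * H l $$ int (Suc n)) / of_nat (Suc l)"
      unfolding step by (simp add: add.commute)
    then show ?case by (simp add: Suc field_simps del: of_nat_Suc)
  qed simp
  have "(\<Sum>m\<le>l. (fls_ex * em1 powi (- int m - 1)) $$ (int k - 1) * (em1 ^ m) $$ int l)
     = H l $$ int (k - 1)"
    using assms by (simp add: H_def fls_nth_sum mult.commute of_nat_diff)
  also have "\<dots> = (- 1) ^ l * fact (k - 1 + l) / (fact (k - 1) * fact l) * H 0 $$ int (k - 1 + l)"
    by (rule H)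
  also have "k - 1 + l = k + l - 1" using assms by simp
  also have "H 0 $$ int (k + l - 1) = inverse em1 $$ (int (k + l) - 1)"
    using assms by (simp add: H0 of_nat_diff)
  finally have *: "(\<Sum>m\<le>l. (fls_ex * em1 powi (- int m - 1)) $$ (int k - 1) * (em1 ^ m) $$ int l) =
     (- 1) ^ l * (fact (k + l - 1) / (fact (k - 1) * fact l)) * inverse em1 $$ (int (k + l) - 1)"
    by simp
  show ?thesis
  proof (cases "odd (k + l)")
    case True
    then have "inverse em1 $$ (int (k + l) - 1) = 0"
      using assms by (intro inverse_em1_even_nth) auto
    then show ?thesis using True * by simp
  next
    case False
    then show ?thesis using * bernoulli_conv_em1[of "k + l"] assms by simp
  qed
qed


section \<open>Modes, gradings and traces\<close>

context voa_data
begin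

text \<open>The operator is left abstract because this group of lemmas serves both gradings, by L(0)
  and by L[0]. Applying \<open>T\<close> minus one of the eigenvalues removes one summand and
  rescales the others by non-zero factors.\<close>

lemma eigen_sum_zero:
  assumes "Vector_Spaces.linear scale scale T" "finite F"
    and "\<And>n::int. n \<in> F \<Longrightarrow> T (f n) = of_int n *s f n" "(\<Sum>n\<in>F. f n) = 0"
  shows "\<forall>n\<in>F. f n = 0"
  using assms(2-)
proof (induction F arbitrary: f rule: finite_induct)
  case (insert m F)
  interpret T: Vector_Spaces.linear scale scale T by fact
  have "(\<Sum>n\<in>F. of_int (n - m) *s f n) = 0"
  proof -
    have "(\<Sum>n\<in>insert m F. of_int n *s f n) = T (\<Sum>n\<in>insert m F. f n)"
      using insert.prems(1) by (simp add: T.sum)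
    also have "\<dots> = 0" using insert.prems(2) by (simp add: T.zero)
    finally have "(\<Sum>n\<in>insert m F. of_int n *s f n) - of_int m *s (\<Sum>n\<in>insert m F. f n) = 0"
      by (simp only: insert.prems(2)) simp
    then have "(\<Sum>n\<in>insert m F. of_int (n - m) *s f n) = 0"
      by (simp only: scale_sum_right of_int_diff scale_left_diff_distrib sum_subtractf)
    then show ?thesis using insert.hyps by simp
  qed
  moreover have "T (of_int (n - m) *s f n) = of_int n *s (of_int (n - m) *s f n)" if "n \<in> F" for n
    using insert.prems(1)[of n] that by (simp only: T.scale) (simp add: mult.commute)
  ultimately have "\<forall>n\<in>F. of_int (n - m) *s f n = 0"
    by (intro insert.IH) auto
  then have *: "\<forall>n\<in>F. f n = 0" using insert.hyps by auto
  then show ?case using insert.prems(2) insert.hyps by simp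
qed simp

lemma span_UN_decompose:
  assumes "x \<in> span (\<Union>n. S n)"
  shows "\<exists>f. (\<forall>n. f n \<in> span (S n)) \<and> finite {n. f n \<noteq> 0} \<and> x = Sum_any f"
  using assms
proof (induction x rule: span_induct_alt)
  case base
  show ?case by (intro exI[of _ "\<lambda>_. 0"]) (auto simp: span_zero)
next
  case (step c x y)
  then obtain m f where m: "x \<in> S m" and f: "\<forall>n. f n \<in> span (S n)" "finite {n. f n \<noteq> 0}" "y = Sum_any f"
    by auto
  define g where "g n = (if n = m then c *s x else 0) + f n" for n
  have fin: "finite {n. (if n = m then c *s x else 0) \<noteq> 0}"
    by (rule finite_subset[of _ "{m}"]) auto
  have "Sum_any g = c *s x + y"
    unfolding g_def f(3) using Sum_any.distrib[OF fin f(2)] by simp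
  moreover have "g n \<in> span (S n)" for n
    unfolding g_def using f(1) m by (auto intro: span_add span_scale span_base span_zero)
  moreover have "finite {n. g n \<noteq> 0}"
    by (rule finite_subset[OF _ finite_UnI[OF fin f(2)]]) (auto simp: g_def)
  ultimately show ?case by (intro exI[of _ g]) auto
qed

lemma Sum_any_unique_eigen:
  assumes "Vector_Spaces.linear scale scale T"
    and "\<And>n::int. T (f n) = of_int n *s f n" "finite {n. f n \<noteq> 0}"
    and "\<And>n. T (g n) = of_int n *s g n" "finite {n. g n \<noteq> 0}"
    and "Sum_any f = Sum_any g"
  shows "f = g"
proof -
  interpret T: Vector_Spaces.linear scale scale T by fact
  let ?F = "{n. f n \<noteq> 0} \<union> {n. g n \<noteq> 0}"
  have "sum f ?F = sum g ?F"
    using assms(3,5,6) by (simp flip: Sum_any.expand_superset[of ?F f] Sum_any.expand_superset[of ?F g])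
  then have *: "\<forall>n\<in>?F. f n - g n = 0"
  proof (intro eigen_sum_zero[OF assms(1)])
    show "finite ?F" using assms(3,5) by simp
    show "T (f n - g n) = of_int n *s (f n - g n)" for n
      by (simp only: T.diff assms(2,4) scale_right_diff_distrib)
  qed (simp only: sum_subtractf diff_self)
  have "f n = g n" for n
  proof (cases "n \<in> ?F")
    case True
    with * have "f n - g n = 0" by (rule bspec)
    then show ?thesis by simp
  qed auto
  then show ?thesis by (rule ext)
qed

text \<open>Decompose the eigenvector along the spanning family; uniqueness of eigencomponents
  leaves only the component of index \<open>n\<close>. This is how graded pieces are identified with
  spans of Fock vectors.\<close>

lemma eigenvector_in_span:
  assumes T: "Vector_Spaces.linear scale scale T"
    and S: "\<And>n x. x \<in> S n \<Longrightarrow> T x = of_int n *s x" "span (\<Union>n. S n) = UNIV"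
    and v: "T v = of_int n *s v"
  shows "v \<in> span (S n)"
proof -
  interpret T: Vector_Spaces.linear scale scale T by fact
  have sp: "T x = of_int n *s x" if "x \<in> span (S n)" for n x
    using that by (induction rule: span_induct_alt)
      (auto simp: T.zero T.add T.scale S scale_right_distrib mult.commute)
  obtain f where f: "\<forall>n. f n \<in> span (S n)" "finite {n. f n \<noteq> 0}" "v = Sum_any f"
    using span_UN_decompose[of v S] S(2) by auto
  have "f = (\<lambda>m. if m = n then v else 0)"
    by (rule Sum_any_unique_eigen[OF T]) (use f sp v T.zero in \<open>auto intro: finite_subset[of _ "{n}"]\<close>)
  then show ?thesis using f(1) by (metis (full_types))
qed

end

lemma (in vector_space) Sum_any_scale:
  "finite {i. f i \<noteq> 0} \<Longrightarrow> scale c (Sum_any f) = Sum_any (\<lambda>i. scale c (f i))"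
  by (subst (2) Sum_any.expand_superset[of "{i. f i \<noteq> 0}"]) (auto simp: Sum_any.expand_set scale_sum_right)

lemma Sum_any_atMost:
  assumes "\<And>i. i > N \<Longrightarrow> f i = 0"
  shows "Sum_any f = (\<Sum>i\<le>N::nat. f i)"
  by (rule Sum_any.expand_superset) (use assms in \<open>auto simp: not_le[symmetric]\<close>)

lemma Sum_any_interval:
  assumes "\<And>i. i < a \<or> i > b \<Longrightarrow> f i = 0"
  shows "Sum_any f = (\<Sum>i\<in>{a..b::int}. f i)"
  by (rule Sum_any.expand_superset) (use assms in \<open>force+\<close>)

lemma gbinomial_of_nat_eq_0: "i > m \<Longrightarrow> (of_nat m gchoose i :: complex) = 0"
  by (simp add: binomial_gbinomial[symmetric])

section \<open>Consequences of the Borcherds identity and homogeneous components\<close>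

context voa
begin

lemma Y_add_left: "Y (u + v) n w = Y u n w + Y v n w"
  using module_hom.add[OF linear_state[of n w, unfolded linear_iff_module_hom]] .
lemma Y_scale_left: "Y (x *s u) n w = x *s Y u n w"
  using module_hom.scale[OF linear_state[of n w, unfolded linear_iff_module_hom]] .
lemma Y_add_right: "Y v n (w + w') = Y v n w + Y v n w'"
  using module_hom.add[OF linear_mode[of v n, unfolded linear_iff_module_hom]] .
lemma Y_scale_right: "Y v n (x *s w) = x *s Y v n w"
  using module_hom.scale[OF linear_mode[of v n, unfolded linear_iff_module_hom]] .
lemma Y_zero_left [simp]: "Y 0 n w = 0"
  using Y_scale_left[of 0 0 n w] by simp
lemma Y_zero_right [simp]: "Y v n 0 = 0"
  using Y_scale_right[of v n 0 0] by simp
lemma Y_minus_left: "Y (- u) n w = - Y u n w"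
  using Y_scale_left[of "-1" u n w] by simp
lemma Y_minus_right: "Y u n (- w) = - Y u n w"
  using Y_scale_right[of u n "-1" w] by simp
lemma Y_diff_left: "Y (u - v) n w = Y u n w - Y v n w"
  using Y_add_left[of u "-v" n w] by (simp add: Y_minus_left)
lemma Y_diff_right: "Y v n (w - w') = Y v n w - Y v n w'"
  using Y_add_right[of v n w "-w'"] by (simp add: Y_minus_right)
lemma Y_sum_left: "Y (\<Sum>i\<in>A. f i) n w = (\<Sum>i\<in>A. Y (f i) n w)"
  by (induction A rule: infinite_finite_induct) (auto simp: Y_add_left)
lemma Y_sum_right: "Y v n (\<Sum>i\<in>A. f i) = (\<Sum>i\<in>A. Y v n (f i))"
  by (induction A rule: infinite_finite_induct) (auto simp: Y_add_right)

lemmas Y_linear = Y_add_left Y_scale_left Y_add_right Y_scale_right Y_minus_left Y_minus_right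
  Y_diff_left Y_diff_right Y_sum_left Y_sum_right

lemma linear_L: "Vector_Spaces.linear scale scale (L n)"
  unfolding L_def by (rule linear_mode)

lemma subspace_grade: "subspace (grade n)"
  unfolding grade_def L_def
  by (rule subspaceI) (auto simp: Y_linear scale_right_distrib mult.commute)

lemma zero_in_grade [simp]: "0 \<in> grade n"
  by (rule subspace_0[OF subspace_grade])

text \<open>The Borcherds identity at r = 0, where the binomial coefficients on its right-hand side
  leave only the term i = 0.\<close>

lemma mode_commutator:
  "Y u m (Y v n w) - Y v n (Y u m w) =
     Sum_any (\<lambda>i::nat. ((of_int m :: complex) gchoose i) *s Y (Y u (int i) v) (m + n - int i) w)"
proof -
  have "Sum_any (\<lambda>i::nat. ((- 1) ^ i * ((of_int 0 :: complex) gchoose i)) *s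
         (Y u (m + 0 - int i) (Y v (n + int i) w)
          - (- 1) powi 0 *s Y v (n + 0 - int i) (Y u (m + int i) w))) =
     (\<Sum>i\<le>0. ((- 1) ^ i * ((of_int 0 :: complex) gchoose i)) *s
         (Y u (m + 0 - int i) (Y v (n + int i) w)
          - (- 1) powi 0 *s Y v (n + 0 - int i) (Y u (m + int i) w)))"
    by (rule Sum_any_atMost) (auto simp: gbinomial_0_left)
  also have "\<dots> = Y u m (Y v n w) - Y v n (Y u m w)" by simp
  finally show ?thesis unfolding Borcherds[of m u 0 v n w, symmetric] by simp
qed

text \<open>The Borcherds identity at m = 0, where the left-hand side reduces to the term i =
  0.\<close>

lemma mode_iterate:
  "Y (Y u r v) n w = Sum_any (\<lambda>i::nat. ((- 1) ^ i * ((of_int r :: complex) gchoose i)) *s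
         (Y u (r - int i) (Y v (n + int i) w)
          - (- 1) powi r *s Y v (n + r - int i) (Y u (int i) w)))"
proof -
  have "Sum_any (\<lambda>i::nat. ((of_int 0 :: complex) gchoose i) *s Y (Y u (r + int i) v) (0 + n - int i) w)
     = (\<Sum>i\<le>0. ((of_int 0 :: complex) gchoose i) *s Y (Y u (r + int i) v) (0 + n - int i) w)"
    by (rule Sum_any_atMost) (auto simp: gbinomial_0_left)
  then show ?thesis using Borcherds[of 0 u r v n w] by simp
qed

lemma mode_commutator_nat:
  "Y u (int m) (Y v n w) - Y v n (Y u (int m) w) =
     (\<Sum>i\<le>m. of_nat (m choose i) *s Y (Y u (int i) v) (int m + n - int i) w)"
  unfolding mode_commutator
  by (subst Sum_any_atMost[of m]) (auto simp: gbinomial_of_nat_eq_0 binomial_gbinomial)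

text \<open>The commutator of L(0) with a mode has two terms, from L(-1) u and L(0) u; the
  translation axiom turns the first one into - (n + 1) times the mode.\<close>

lemma grade_mode:
  assumes "u \<in> grade k" "w \<in> grade l"
  shows "Y u n w \<in> grade (k + l - n - 1)"
proof -
  have "L 0 (Y u n w) - Y u n (L 0 w) =
     Y (L (-1) u) (n + 1) w + Y (L 0 u) n w"
    using mode_commutator_nat[of conf 1 u n w] by (simp add: L_def add.commute)
  then have "L 0 (Y u n w) = Y u n (L 0 w) + Y (L (-1) u) (n + 1) w + Y (L 0 u) n w"
    by (simp add: algebra_simps)
  also have "\<dots> = of_int (k + l - n - 1) *s Y u n w"
    using assms by (simp add: translation grade_def Y_linear scale_left_distrib scale_left_diff_distrib)
  finally show ?thesis by (simp add: grade_def)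
qed

lemma grade_Sum_any_ex:
  "\<exists>f. (\<forall>n. f n \<in> grade n) \<and> finite {n. f n \<noteq> 0} \<and> v = Sum_any f"
proof -
  have sp: "span (grade n) = grade n" for n using subspace_grade by simp
  show ?thesis using span_UN_decompose[of v grade] unfolding sp graded by simp
qed

text \<open>The description in \<open>hom_part\<close> determines a single function because
  components in distinct eigenspaces of L(0) are unique.\<close>

lemma hom_part_unique:
  assumes "\<And>n. f n \<in> grade n" "finite {n. f n \<noteq> 0}" "v = Sum_any f"
  shows "hom_part v = f"
  unfolding hom_part_def
proof (rule the_equality)
  show "(\<forall>n. f n \<in> grade n) \<and> finite {n. f n \<noteq> 0} \<and> v = Sum_any f" using assms by auto
  fix g assume "(\<forall>n. g n \<in> grade n) \<and> finite {n. g n \<noteq> 0} \<and> v = Sum_any g"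
  then show "g = f"
    using assms by (intro Sum_any_unique_eigen[OF linear_L[of 0]]) (auto simp: grade_def)
qed

lemma hom_part_props:
  "hom_part v n \<in> grade n" "finite {n. hom_part v n \<noteq> 0}" "Sum_any (hom_part v) = v"
  using grade_Sum_any_ex[of v] hom_part_unique[of _ v] by metis+

lemma hom_part_homogeneous:
  "v \<in> grade k \<Longrightarrow> hom_part v = (\<lambda>n. if n = k then v else 0)"
  by (rule hom_part_unique) (auto intro: finite_subset[of _ "{k}"])

lemma hom_part_add: "hom_part (u + v) = (\<lambda>n. hom_part u n + hom_part v n)"
  by (rule hom_part_unique)
     (auto simp: Sum_any.distrib hom_part_props intro: subspace_add[OF subspace_grade] 
       intro!: finite_subset[OF _ finite_UnI[OF hom_part_props(2)[of u] hom_part_props(2)[of v]]])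

lemma hom_part_scale: "hom_part (x *s v) = (\<lambda>n. x *s hom_part v n)"
  by (rule hom_part_unique)
     (auto simp: hom_part_props Sum_any_scale[symmetric] intro: subspace_scale[OF subspace_grade] 
       intro!: finite_subset[OF _ hom_part_props(2)[of v]])

lemma zero_mode_homogeneous: "v \<in> grade k \<Longrightarrow> zero_mode v w = Y v (k - 1) w"
  unfolding zero_mode_def hom_part_homogeneous
  by (subst Sum_any.expand_superset[of "{k}"]) auto

lemma finite_hom_part_mode: "finite {n. Y (hom_part v n) (f n) w \<noteq> 0}"
  by (rule finite_subset[OF _ hom_part_props(2)[of v]]) auto

lemma zero_mode_add_left: "zero_mode (u + v) w = zero_mode u w + zero_mode v w"
  unfolding zero_mode_def hom_part_add
  by (simp add: Y_linear Sum_any.distrib finite_hom_part_mode)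

lemma zero_mode_scale_left: "zero_mode (x *s v) w = x *s zero_mode v w"
  unfolding zero_mode_def hom_part_scale
  by (simp add: Y_linear Sum_any_scale finite_hom_part_mode)

lemma zero_mode_zero_left [simp]: "zero_mode 0 w = 0"
  using zero_mode_scale_left[of 0 0 w] by simp

lemma zero_mode_sum_left: "zero_mode (\<Sum>i\<in>A. f i) w = (\<Sum>i\<in>A. zero_mode (f i) w)"
  by (induction A rule: infinite_finite_induct) (auto simp: zero_mode_add_left)

lemma grade_zero_mode:
  assumes "w \<in> grade n"
  shows "zero_mode v w \<in> grade n"
proof -
  have "Y (hom_part v k) (k - 1) w \<in> grade n" for k
    using grade_mode[OF hom_part_props(1) assms, of v k "k - 1"] by simp
  then show ?thesis unfolding zero_mode_def Sum_any.expand_set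
    by (intro subspace_sum[OF subspace_grade]) auto
qed

section \<open>Traces on graded pieces\<close>

definition grade_basis :: "int \<Rightarrow> 'v set" where
  "grade_basis n = (SOME U. is_basis_of U (grade n))"

lemma grade_basis: "independent (grade_basis n)" "span (grade_basis n) = grade n" "finite (grade_basis n)"
proof -
  obtain U where "U \<subseteq> grade n" "independent U" "grade n \<subseteq> span U"
    using maximal_independent_subset[of "grade n"] by auto
  then have "is_basis_of U (grade n)"
    unfolding is_basis_of_def using span_minimal[OF _ subspace_grade, of U n] by auto
  then have "is_basis_of (grade_basis n) (grade n)"
    unfolding grade_basis_def by (rule someI)
  then show *: "independent (grade_basis n)" "span (grade_basis n) = grade n"
    by (auto simp: is_basis_of_def)
  obtain S where "finite S" "span S = grade n" using finite_dim by auto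
  then show "finite (grade_basis n)"
    using independent_span_bound[of S "grade_basis n"] * span_superset[of "grade_basis n"] by auto
qed

lemma trace_on_grade: "trace_on (grade n) f = (\<Sum>u\<in>grade_basis n. representation (grade_basis n) (f u) u)"
  by (simp add: trace_on_def grade_basis_def Let_def)

lemma grade_basis_in_grade: "u \<in> grade_basis n \<Longrightarrow> u \<in> grade n"
  using grade_basis(2) span_base by blast

lemma trace_cong: "(\<And>w. w \<in> grade n \<Longrightarrow> f w = g w) \<Longrightarrow> trace_on (grade n) f = trace_on (grade n) g"
  unfolding trace_on_grade by (intro sum.cong) (auto simp: grade_basis_in_grade)

lemma trace_add:
  assumes "\<And>w. w \<in> grade n \<Longrightarrow> f w \<in> grade n" "\<And>w. w \<in> grade n \<Longrightarrow> g w \<in> grade n"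
  shows "trace_on (grade n) (\<lambda>w. f w + g w) = trace_on (grade n) f + trace_on (grade n) g"
  unfolding trace_on_grade sum.distrib[symmetric]
  by (intro sum.cong) (auto simp: grade_basis_in_grade grade_basis assms representation_add)

lemma trace_scale:
  assumes "\<And>w. w \<in> grade n \<Longrightarrow> f w \<in> grade n"
  shows "trace_on (grade n) (\<lambda>w. x *s f w) = x * trace_on (grade n) f"
  unfolding trace_on_grade sum_distrib_left
  by (intro sum.cong) (auto simp: grade_basis_in_grade grade_basis assms representation_scale)

lemma trace_zero [simp]: "trace_on (grade n) (\<lambda>w. 0) = 0"
  unfolding trace_on_grade by (simp add: representation_zero)

lemma trace_sum:
  assumes "\<And>i w. i \<in> A \<Longrightarrow> w \<in> grade n \<Longrightarrow> f i w \<in> grade n"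
  shows "trace_on (grade n) (\<lambda>w. \<Sum>i\<in>A. f i w) = (\<Sum>i\<in>A. trace_on (grade n) (f i))"
  using assms by (induction A rule: infinite_finite_induct)
    (auto simp: trace_add subspace_sum[OF subspace_grade])

lemma trace_diff:
  assumes "\<And>w. w \<in> grade n \<Longrightarrow> f w \<in> grade n" "\<And>w. w \<in> grade n \<Longrightarrow> g w \<in> grade n"
  shows "trace_on (grade n) (\<lambda>w. f w - g w) = trace_on (grade n) f - trace_on (grade n) g"
  unfolding trace_on_grade sum_subtractf[symmetric]
  by (intro sum.cong) (auto simp: grade_basis_in_grade grade_basis assms representation_diff)

text \<open>The two maps go between different graded pieces, so cyclicity shifts the degree in which
  the trace is taken. In generating series this shift becomes a power of q.\<close>

lemma trace_cyclic:
  assumes f: "Vector_Spaces.linear scale scale f" "\<And>w. w \<in> grade m \<Longrightarrow> f w \<in> grade n"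
    and g: "Vector_Spaces.linear scale scale g" "\<And>w. w \<in> grade n \<Longrightarrow> g w \<in> grade m"
  shows "trace_on (grade n) (\<lambda>w. f (g w)) = trace_on (grade m) (\<lambda>w. g (f w))"
proof -
  interpret f: Vector_Spaces.linear scale scale f by fact
  interpret g: Vector_Spaces.linear scale scale g by fact
  let ?U = "grade_basis n" and ?V = "grade_basis m"
  let ?r = "\<lambda>n. representation (grade_basis n)"
  have exp: "x = (\<Sum>v\<in>grade_basis k. ?r k x v *s v)" if "x \<in> grade k" for k x
    using sum_representation_eq[of "grade_basis k" x "grade_basis k"] that grade_basis by auto
  have comp: "?r k (h x) u = (\<Sum>v\<in>grade_basis l. ?r l x v * ?r k (h v) u)"
    if h: "Vector_Spaces.linear scale scale h" "\<And>w. w \<in> grade l \<Longrightarrow> h w \<in> grade k" and x: "x \<in> grade l"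
    for k l h x u
  proof -
    interpret h: Vector_Spaces.linear scale scale h by fact
    have "h x = (\<Sum>v\<in>grade_basis l. ?r l x v *s h v)"
      by (subst exp[OF x]) (simp add: h.sum h.scale)
    moreover have "?r k (\<Sum>v\<in>grade_basis l. ?r l x v *s h v) = (\<lambda>u. \<Sum>v\<in>grade_basis l. ?r k (?r l x v *s h v) u)"
      by (rule representation_sum)
         (simp_all only: grade_basis subspace_scale[OF subspace_grade] h(2) grade_basis_in_grade not_False_eq_True)
    moreover have "?r k (?r l x v *s h v) u = ?r l x v * ?r k (h v) u" if "v \<in> grade_basis l" for v
    proof -
      have "h v \<in> span (grade_basis k)"
        unfolding grade_basis(2) by (rule h(2)[OF grade_basis_in_grade[OF that]])
      then show ?thesis by (simp only: representation_scale[OF grade_basis(1)])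
    qed
    ultimately show ?thesis by (simp only: cong: sum.cong)
  qed
  have "trace_on (grade n) (\<lambda>w. f (g w)) = (\<Sum>u\<in>?U. \<Sum>v\<in>?V. ?r m (g u) v * ?r n (f v) u)"
    unfolding trace_on_grade
    by (intro sum.cong refl comp) (use f g grade_basis_in_grade in auto)
  also have "\<dots> = (\<Sum>v\<in>?V. \<Sum>u\<in>?U. ?r n (f v) u * ?r m (g u) v)"
    by (subst sum.swap) (simp add: mult.commute)
  also have "\<dots> = trace_on (grade m) (\<lambda>w. g (f w))"
    unfolding trace_on_grade
    by (intro sum.cong refl comp[symmetric]) (use f g grade_basis_in_grade in auto)
  finally show ?thesis .
qed

end

section \<open>The Heisenberg modes and the original grading\<close>

context heisenberg_voa
begin

text \<open>The modes \<open>a(n)\<close> are written \<open>am n\<close>, and the square bracket modes \<open>a[n]\<close> are written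
  \<open>bm n\<close> below.\<close>

abbreviation am :: "int \<Rightarrow> 'v \<Rightarrow> 'v" where "am \<equiv> Y a"

lemma am_commute: "am m (am n v) = am n (am m v) + (if m = - n then of_int m else 0) *s v"
  using a_commutator[of m n v] by (simp add: algebra_simps)

text \<open>Lists need neither be sorted nor be free of zeros; prepending an index is always
  allowed, so the family is visibly stable under creation modes.\<close>

definition fock :: "nat list \<Rightarrow> 'v" where
  "fock ks = foldr (\<lambda>k. am (- int k)) ks vac"

lemma fock_simps [simp]: "fock [] = vac" "fock (k # ks) = am (- int k) (fock ks)"
  by (simp_all add: fock_def)

lemma grade_am: "v \<in> grade n \<Longrightarrow> am m v \<in> grade (n - m)"
  using grade_mode[OF a_weight, of v n m] by simp

lemma fock_grade: "fock ks \<in> grade (int (sum_list ks))"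
  by (induction ks) (use vac_weight grade_am[of _ _ "- int _"] in \<open>force simp: add.commute\<close>)+

lemma span_fock: "span (range fock) = UNIV"
proof -
  have "(\<lambda>ks. foldr (\<lambda>k. Y a (- int k)) ks vac) ` {ks. sorted ks \<and> (\<forall>k\<in>set ks. k > 0)} \<subseteq> range fock"
    by (auto simp: fock_def)
  then show ?thesis using Fock_basis span_mono unfolding is_basis_of_def by blast
qed

lemma grade_eq_span_fock: "grade n = span (fock ` {ks. int (sum_list ks) = n})"
proof
  have 1: "(\<Union>n. fock ` {ks. int (sum_list ks) = n}) = range fock" by auto
  show "grade n \<subseteq> span (fock ` {ks. int (sum_list ks) = n})"
  proof
    fix v assume "v \<in> grade n"
    then show "v \<in> span (fock ` {ks. int (sum_list ks) = n})"
      using 1 span_fock fock_grade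
      by (intro eigenvector_in_span[OF linear_L[of 0]]) (auto simp: grade_def)
  qed
  show "span (fock ` {ks. int (sum_list ks) = n}) \<subseteq> grade n"
    using fock_grade by (intro span_minimal subspace_grade) auto
qed

lemma grade_negative: "n < 0 \<Longrightarrow> grade n = {0}"
proof -
  assume "n < 0"
  then have "{ks. int (sum_list ks) = n} = {}" by auto
  then show ?thesis by (simp add: grade_eq_span_fock)
qed

text \<open>The mode a(0) commutes with all modes of \<open>a\<close> and annihilates the vacuum,
  hence it annihilates the Fock vectors, which span.\<close>

lemma am_0 [simp]: "am 0 v = 0"
proof -
  have f: "am 0 (fock ks) = 0" for ks
  proof (induction ks)
    case Nil then show ?case by (simp add: creation)
  next
    case (Cons k ks)
    then show ?case using am_commute[of 0 "- int k" "fock ks"] by (cases "k = 0") auto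
  qed
  have "v \<in> span (range fock)" using span_fock by simp
  then show ?thesis by (induction rule: span_induct_alt) (auto simp: Y_linear f)
qed

lemma am_conf: "am 0 conf = 0" "am 1 conf = a" "m \<ge> 2 \<Longrightarrow> am m conf = 0"
proof -
  have v: "am m vac = 0" if "m \<ge> 0" for m using that by (simp add: creation)
  show "am 0 conf = 0" by simp
  have "am 1 (am (-1) (am (-1) vac)) = 2 *s a"
    using am_commute[of 1 "-1" "am (-1) vac"] am_commute[of 1 "-1" vac]
    by (simp add: v creation Y_linear flip: scale_left_distrib[of 1 1, simplified])
  then show "am 1 conf = a" by (simp add: conf_eq Y_linear)
  assume m: "m \<ge> 2"
  then have "am m (am (-1) (am (-1) vac)) = 0"
    using am_commute[of m "-1" "am (-1) vac"] am_commute[of m "-1" vac] by (simp add: v)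
  then show "am m conf = 0" by (simp add: conf_eq Y_linear)
qed

text \<open>Taking the commutator with the mode of \<open>a\<close> on the left makes the commutator
  formula run over the states a(i) conf, of which only a(1) conf = a is non-zero.\<close>

lemma L_am: "L n (am m v) = am m (L n v) - of_int m *s am (m + n) v"
proof -
  have "am m (Y conf (n + 1) v) - Y conf (n + 1) (am m v) =
     Sum_any (\<lambda>i::nat. ((of_int m :: complex) gchoose i) *s Y (am (int i) conf) (m + (n + 1) - int i) v)"
    by (rule mode_commutator)
  also have "\<dots> = (\<Sum>i\<le>1. ((of_int m :: complex) gchoose i) *s Y (am (int i) conf) (m + (n + 1) - int i) v)"
    by (rule Sum_any_atMost) (simp add: am_conf)
  also have "\<dots> = of_int m *s am (m + n) v" by (simp add: am_conf)
  finally show ?thesis by (simp add: L_def algebra_simps)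
qed

lemma L_vac: "n \<ge> -1 \<Longrightarrow> L n vac = 0"
  by (simp add: L_def creation)

lemma L_a: "L 0 a = a" "n \<ge> 1 \<Longrightarrow> L n a = 0"
proof -
  show "L 0 a = a" using a_weight by (simp add: grade_def)
  assume n: "n \<ge> 1"
  have "L n (am (-1) vac) = am (n - 1) vac"
    using L_am[of n "-1" vac] n by (simp add: L_vac)
  then show "L n a = 0" using n by (simp add: creation)
qed

end


section \<open>The square bracket modes\<close>

lemma fls_X_intpow_times_nth: "(fls_X_intpow n * f) $$ k = f $$ (k - n)" "(f * fls_X_intpow n) $$ k = f $$ (k - n)"
  for f :: "complex fls"
  by (simp_all add: fls_X_intpow_times_conv_shift)

lemma finite_lists_sum:
  "finite {ks. 0 \<notin> set ks \<and> sum_list ks = (n::nat)}"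
proof (rule finite_subset)
  show "finite {ks. set ks \<subseteq> {..n} \<and> length ks \<le> n}"
    by (rule finite_lists_length_le) simp
  have "length ks \<le> sum_list ks" if "0 \<notin> set ks" for ks :: "nat list"
    using that by (induction ks) auto
  then show "{ks. 0 \<notin> set ks \<and> sum_list ks = n} \<subseteq> {ks. set ks \<subseteq> {..n} \<and> length ks \<le> n}"
    using member_le_sum_list by fastforce
qed

context voa
begin

lemma sq_coeff_em1: "sq_coeff k m n = (fps_to_fls (fps_exp (of_int k)) * em1 powi (- m - 1)) $$ (- n - 1)"
  by (simp add: sq_coeff_def em1_def)

lemma sq_coeff_1: "sq_coeff 1 m n = (fls_ex * em1 powi (- m - 1)) $$ (- n - 1)"
  by (simp add: sq_coeff_em1 fls_ex_def)

lemma sq_coeff_below: "m < n \<Longrightarrow> sq_coeff k m n = 0"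
  unfolding sq_coeff_em1 by (intro fls_eq0_below_subdegree) (simp add: fls_subdegree_fls_to_fps)

text \<open>Two computations of one coefficient of the derivative of \<open>em1 powi (- m)\<close>.
  The identity trades a factor m for a factor n, which is what makes the square bracket modes
  satisfy Heisenberg relations again.\<close>

lemma of_int_times_sq_coeff_1: "of_int m * sq_coeff 1 m n = of_int n * (em1 powi (- m)) $$ (- n)"
proof -
  have "fls_deriv (em1 powi (- m)) $$ (- n - 1) = of_int (- m) * (fls_ex * em1 powi (- m - 1)) $$ (- n - 1)"
    unfolding fls_deriv_em1_powi by (rule fls_mult_of_int_nth)
  then show ?thesis by (simp add: sq_coeff_1)
qed

lemma sq_mode_homogeneous:
  assumes "v \<in> grade k" and N: "\<And>m. m > N \<Longrightarrow> Y v m w = 0"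
  shows "sq_mode v n w = (\<Sum>m\<in>{n..N}. sq_coeff k m n *s Y v m w)"
proof -
  have "sq_mode v n w = (\<Sum>k'\<in>{k}. Sum_any (\<lambda>m. sq_coeff k' m n *s Y (hom_part v k') m w))"
    unfolding sq_mode_def hom_part_homogeneous[OF assms(1)]
    by (rule Sum_any.expand_superset) auto
  also have "\<dots> = Sum_any (\<lambda>m. sq_coeff k m n *s Y v m w)"
    by (simp add: hom_part_homogeneous[OF assms(1)])
  also have "\<dots> = (\<Sum>m\<in>{n..N}. sq_coeff k m n *s Y v m w)"
    by (rule Sum_any_interval) (auto simp: N sq_coeff_below)
  finally show ?thesis .
qed

lemma sq_mode_zero [simp]: "sq_mode 0 n w = 0"
  using sq_mode_homogeneous[of 0 0 0 w n] by simp

lemma mode_truncation: "\<exists>N. \<forall>m>N. Y v m w = 0"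
  using truncation[of v w] by (meson less_imp_le)

text \<open>The vacuum component of the shifted conformal vector acts only through its mode of index
  -1, that is, it affects only L[-2]; elsewhere the modes are computed from \<open>conf\<close>
  alone.\<close>

lemma sq_mode_sq_conf:
  assumes "n \<noteq> -1" and N: "\<And>m. m > N \<Longrightarrow> Y conf m w = 0"
  shows "sq_mode sq_conf n w = (\<Sum>m\<in>{n..N}. sq_coeff 2 m n *s Y conf m w)"
proof -
  define h where "h = (\<lambda>k::int. if k = 2 then conf else if k = 0 then - ((c / 24) *s vac) else 0)"
  have h: "hom_part sq_conf = h"
  proof (rule hom_part_unique)
    have "Sum_any h = (\<Sum>k\<in>{0,2}. h k)"
      by (rule Sum_any.expand_superset) (auto simp: h_def)
    then show "sq_conf = Sum_any h" by (simp add: h_def sq_conf_def)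
    show "h n \<in> grade n" for n
      using conf_weight vac_weight by (auto simp: h_def intro!: subspace_neg subspace_grade subspace_scale)
  qed (auto simp: h_def intro: finite_subset[of _ "{0,2}"])
  have "sq_coeff 0 (-1) n = 0" using assms(1) by (simp add: sq_coeff_em1)
  then have z: "sq_coeff 0 m n *s Y (h 0) m w = 0" for m
    by (simp add: h_def Y_linear vacuum)
  have "sq_mode sq_conf n w = (\<Sum>k\<in>{0,2}. Sum_any (\<lambda>m. sq_coeff k m n *s Y (h k) m w))"
    unfolding sq_mode_def h by (rule Sum_any.expand_superset) (auto simp: h_def)
  also have "\<dots> = Sum_any (\<lambda>m. sq_coeff 2 m n *s Y conf m w)"
    by (simp add: z) (simp add: h_def)
  also have "\<dots> = (\<Sum>m\<in>{n..N}. sq_coeff 2 m n *s Y conf m w)"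
    by (rule Sum_any_interval) (auto simp: N sq_coeff_below)
  finally show ?thesis .
qed

end

context heisenberg_voa
begin

abbreviation bm :: "int \<Rightarrow> 'v \<Rightarrow> 'v" where "bm n \<equiv> sq_mode a n"

abbreviation tc :: "int \<Rightarrow> int \<Rightarrow> complex" where "tc \<equiv> sq_coeff 1"

lemma bm_eq:
  "(\<And>m. m > N \<Longrightarrow> am m w = 0) \<Longrightarrow> bm n w = (\<Sum>m\<in>{n..N}. tc m n *s am m w)"
  by (rule sq_mode_homogeneous[OF a_weight])

text \<open>A common truncation bound lets the mode expansions on several vectors run over the same
  finite range, so that they can be compared term by term.\<close>

lemma am_bounds: "\<exists>N. \<forall>m>N. \<forall>v\<in>set vs. am m v = 0"
proof (induction vs)
  case (Cons v vs)
  then obtain N where N: "\<forall>m>N. \<forall>v\<in>set vs. am m v = 0" by auto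
  obtain N' where "\<forall>m>N'. am m v = 0" using mode_truncation[of a v] by blast
  then show ?case using N by (intro exI[of _ "max N N'"]) auto
qed auto

lemma bm_add: "bm n (v + w) = bm n v + bm n w"
proof -
  obtain N where "\<forall>m>N. \<forall>u\<in>set [v, w, v + w]. am m u = 0" using am_bounds by metis
  then show ?thesis by (simp add: bm_eq[of N] Y_linear scale_right_distrib sum.distrib)
qed

lemma bm_scale: "bm n (x *s v) = x *s bm n v"
proof -
  obtain N where "\<forall>m>N. \<forall>u\<in>set [v, x *s v]. am m u = 0" using am_bounds by metis
  then show ?thesis by (simp add: bm_eq[of N] Y_linear scale_sum_right mult.commute)
qed

lemma bm_zero [simp]: "bm n 0 = 0"
  using bm_scale[of n 0 0] by simp
lemma bm_minus: "bm n (- v) = - bm n v"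
  using bm_scale[of n "-1" v] by simp
lemma bm_diff: "bm n (v - w) = bm n v - bm n w"
  using bm_add[of n v "-w"] by (simp add: bm_minus)
lemma bm_sum: "bm n (\<Sum>i\<in>A. f i) = (\<Sum>i\<in>A. bm n (f i))"
  by (induction A rule: infinite_finite_induct) (auto simp: bm_add)

lemmas bm_linear = bm_add bm_scale bm_minus bm_diff bm_sum

text \<open>The triangular matrix \<open>tc\<close> and the matrix of coefficients of the powers of
  \<open>em1\<close> are inverse to each other: an entry of their product is the residue of
  \<open>fls_ex * em1 powi (m - m' - 1)\<close>.\<close>

lemma am_eq_bm:
  assumes N: "\<And>m. m > N \<Longrightarrow> am m w = 0"
  shows "am m w = (\<Sum>l\<in>{m..N}. ((em1 powi m) $$ l) *s bm l w)"
proof -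
  have res: "(\<Sum>l\<in>{m..m'}. (em1 powi m) $$ l * tc m' l) = (if m' = m then 1 else 0)" for m'
  proof -
    have "(if m' = m then 1 else 0) = (fls_ex * em1 powi (m - m' - 1)) $$ (-1)"
      by (simp add: residue_ex_em1_powi)
    also have "fls_ex * em1 powi (m - m' - 1) = em1 powi m * (fls_ex * em1 powi (- m' - 1))"
      using em1_powi_mult[of m "- m' - 1"] by (simp add: algebra_simps)
    also have "\<dots> $$ (-1) = (\<Sum>l\<in>{m..m'}. (em1 powi m) $$ l * tc m' l)"
      by (subst fls_times_nth(2)) (simp add: sq_coeff_1 minus_diff_commute[of 1])
    finally show ?thesis by simp
  qed
  have "(\<Sum>l\<in>{m..N}. ((em1 powi m) $$ l) *s bm l w) =
     (\<Sum>l\<in>{m..N}. \<Sum>m'\<in>{l..N}. ((em1 powi m) $$ l * tc m' l) *s am m' w)"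
    by (simp add: bm_eq[OF N] scale_sum_right)
  also have "\<dots> = (\<Sum>m'\<in>{m..N}. \<Sum>l\<in>{m..m'}. ((em1 powi m) $$ l * tc m' l) *s am m' w)"
    by (subst sum.Sigma, simp, simp, subst sum.Sigma, simp, simp)
       (rule sum.reindex_bij_witness[where i = "\<lambda>(x, y). (y, x)" and j = "\<lambda>(x, y). (y, x)"], auto)
  also have "\<dots> = (\<Sum>m'\<in>{m..N}. (if m' = m then 1 else 0) *s am m' w)"
    by (simp flip: scale_sum_left add: res)
  also have "\<dots> = (\<Sum>m'\<in>{m..N}. if m' = m then am m' w else 0)"
    by (intro sum.cong) auto
  also have "\<dots> = am m w" using N by (cases "m \<le> N") (auto simp: sum.delta)
  finally show ?thesis ..
qed

text \<open>Expand z^n in powers of exp z - 1 and read off the coefficient of z^(- m). The factor i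
  under the sum is first exchanged for the constant factor m.\<close>

lemma sum_tc_commutator:
  "(\<Sum>i\<in>{m..-n}. of_int i * tc i m * tc (- i) n) = (if m = - n then of_int m else 0)"
proof -
  have "(fls_X_intpow n :: complex fls) $$ (- m) = (\<Sum>i\<in>{n..- m}. (fls_ex * em1 powi (- i - 1) * fls_X_intpow n) $$ (-1) * (em1 powi i) $$ (- m))"
    by (rule fls_expand_em1) auto
  also have "\<dots> = (\<Sum>i\<in>{n..-m}. (fls_ex * em1 powi (- i - 1)) $$ (-n-1) * (em1 powi i) $$ (-m))"
    by (simp only: fls_X_intpow_times_nth minus_diff_commute[of 1 n])
  also have "\<dots> = (\<Sum>i\<in>{m..-n}. (em1 powi (- i)) $$ (- m) * tc (- i) n)"
    by (rule sum.reindex_bij_witness[where i = uminus and j = uminus]) (auto simp: sq_coeff_1)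
  finally have *: "(\<Sum>i\<in>{m..-n}. (em1 powi (- i)) $$ (- m) * tc (- i) n) = (if m = - n then 1 else 0)"
    by auto
  have "(\<Sum>i\<in>{m..-n}. of_int i * tc i m * tc (- i) n) = of_int m * (\<Sum>i\<in>{m..-n}. (em1 powi (- i)) $$ (- m) * tc (- i) n)"
    by (simp add: of_int_times_sq_coeff_1 sum_distrib_left mult.assoc)
  then show ?thesis by (simp add: *)
qed

lemma bm_commute: "bm m (bm n v) = bm n (bm m v) + (if m = - n then of_int m else 0) *s v"
proof -
  obtain N0 where N0: "\<forall>i>N0. \<forall>u\<in>set [v, bm n v, bm m v]. am i u = 0" using am_bounds by metis
  \<comment> \<open>The range must also reach - n and - m, so that every pair i + j = 0 with i at
    least m and j at least n lies inside the double sum.\<close>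
  define N where "N = max N0 (max (- n) (- m))"
  have N: "am i v = 0" "am i (bm n v) = 0" "am i (bm m v) = 0" if "i > N" for i
    using that N0 by (auto simp: N_def)
  have Nn: "N \<ge> - n" "N \<ge> - m" by (auto simp: N_def)
  have "bm m (bm n v) = (\<Sum>i\<in>{m..N}. \<Sum>j\<in>{n..N}. (tc i m * tc j n) *s am i (am j v))"
    by (simp only: bm_eq[OF N(2)]) (simp add: bm_eq[OF N(1)] Y_linear scale_sum_right)
  also have "\<dots> = (\<Sum>i\<in>{m..N}. \<Sum>j\<in>{n..N}. (tc i m * tc j n) *s am j (am i v)) +
      (\<Sum>i\<in>{m..N}. \<Sum>j\<in>{n..N}. (if j = - i then tc i m * tc j n * of_int i else 0) *s v)"
    by (subst am_commute)
       (auto simp: scale_right_distrib sum.distrib intro!: arg_cong2[of _ _ _ _ "(+)"] sum.cong)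
  also have "(\<Sum>i\<in>{m..N}. \<Sum>j\<in>{n..N}. (tc i m * tc j n) *s am j (am i v)) = bm n (bm m v)"
    by (subst sum.swap, simp only: bm_eq[OF N(3)]) (simp add: bm_eq[OF N(1)] Y_linear scale_sum_right mult.commute)
  also have "(\<Sum>i\<in>{m..N}. \<Sum>j\<in>{n..N}. (if j = - i then tc i m * tc j n * of_int i else 0) *s v)
     = (\<Sum>i\<in>{m..N}. if - i \<in> {n..N} then of_int i * tc i m * tc (- i) n else 0) *s v"
    by (simp only: scale_sum_left[symmetric]) (simp add: sum.delta mult_ac cong: if_cong)
  also have "(\<Sum>i\<in>{m..N}. if - i \<in> {n..N} then of_int i * tc i m * tc (- i) n else 0)
     = (\<Sum>i\<in>{m..-n}. of_int i * tc i m * tc (- i) n)"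
    using Nn by (intro sum.mono_neutral_cong_right) auto
  finally show ?thesis by (simp add: sum_tc_commutator)
qed

lemma am_vac: "n \<ge> 0 \<Longrightarrow> am n vac = 0"
  by (simp add: creation)

lemma bm_vac: "n \<ge> 0 \<Longrightarrow> bm n vac = 0"
  by (subst bm_eq[of "-1"]) (auto simp: am_vac)

text \<open>The coefficients \<open>tc m 0\<close> are residues that vanish for m different from 0,
  so a[0] is a multiple of a(0) = 0.\<close>

lemma bm_0 [simp]: "bm 0 v = 0"
proof -
  obtain N where N: "\<forall>m>N. am m v = 0" using mode_truncation[of a v] by blast
  have "bm 0 v = (\<Sum>m\<in>{0..N}. tc m 0 *s am m v)" using N by (intro bm_eq) auto
  also have "\<dots> = 0" 
  proof (rule sum.neutral, safe)
    fix m :: int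
    show "tc m 0 *s am m v = 0" by (cases "m = 0") (auto simp: sq_coeff_1 residue_ex_em1_powi)
  qed
  finally show ?thesis .
qed

section \<open>The operator L[0] and its commutators with the square bracket modes\<close>

definition sqL0 :: "'v \<Rightarrow> 'v" where "sqL0 = sq_mode sq_conf 1"

lemma sqL0_eq:
  assumes "\<And>m. m > N \<Longrightarrow> Y conf m w = 0"
  shows "sqL0 w = (\<Sum>i\<in>{1..N}. sq_coeff 2 i 1 *s L (i - 1) w)"
  unfolding sqL0_def by (subst sq_mode_sq_conf[OF _ assms]) (auto simp: L_def)

lemma conf_bounds: "\<exists>N. \<forall>m>N. \<forall>v\<in>set vs. Y conf m v = 0"
proof (induction vs)
  case (Cons v vs)
  then obtain N where N: "\<forall>m>N. \<forall>v\<in>set vs. Y conf m v = 0" by auto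
  obtain N' where "\<forall>m>N'. Y conf m v = 0" using mode_truncation[of conf v] by blast
  then show ?case using N by (intro exI[of _ "max N N'"]) auto
qed auto

lemma L_linear: "L n (v + w) = L n v + L n w" "L n (x *s v) = x *s L n v"
  "L n (\<Sum>i\<in>A. f i) = (\<Sum>i\<in>A. L n (f i))"
  by (simp_all add: L_def Y_linear)

lemma linear_sqL0: "Vector_Spaces.linear scale scale sqL0"
proof unfold_locales
  fix v w
  obtain N where "\<forall>m>N. \<forall>u\<in>set [v, w, v + w]. Y conf m u = 0" using conf_bounds by metis
  then show "sqL0 (v + w) = sqL0 v + sqL0 w"
    by (simp add: sqL0_eq[of N] L_linear scale_right_distrib sum.distrib)
next
  fix x v
  obtain N where "\<forall>m>N. \<forall>u\<in>set [v, x *s v]. Y conf m u = 0" using conf_bounds by metis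
  then show "sqL0 (x *s v) = x *s sqL0 v"
    by (simp add: sqL0_eq[of N] L_linear scale_sum_right mult.commute)
qed

text \<open>The comparison of coefficients of a(M) in [L[0], a[n]] = - n a[n]. It comes from
  expanding z times \<open>fls_ex * em1 powi (- M - 1)\<close> in powers of \<open>em1\<close>; the
  factor z moves the residue to the coefficient at -2, which is the one belonging to the mode
  L[0].\<close>

lemma sum_sq_coeff_2:
  "(\<Sum>i\<in>{1..M-n+1}. sq_coeff 2 i 1 * (of_int (M - i + 1) * tc (M - i + 1) n)) = of_int n * tc M n"
proof -
  define f where "f = fls_X * (fls_ex * em1 powi (- M - 1))"
  have f: "f $$ k = (fls_ex * em1 powi (- M - 1)) $$ (k - 1)" for k
    unfolding f_def by (simp add: fls_X_times_conv_shift)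
  have ex2: "fps_to_fls (fps_exp 2) = fls_ex * fls_ex"
    unfolding fls_ex_def by (simp flip: fls_times_fps_to_fls fps_exp_add_mult)
  have r: "(fls_ex * em1 powi (- i - 1) * f) $$ (-1) = sq_coeff 2 (i + M + 1) 1" for i
  proof -
    have "fls_ex * em1 powi (- i - 1) * f = fls_X * (fls_ex * fls_ex * (em1 powi (- i - 1) * em1 powi (- M - 1)))"
      by (simp add: f_def mult_ac)
    also have "em1 powi (- i - 1) * em1 powi (- M - 1) = em1 powi (- (i + M + 1) - 1)"
      by (simp add: em1_powi_mult algebra_simps)
    finally show ?thesis by (simp add: sq_coeff_em1 ex2 fls_X_times_conv_shift)
  qed
  have "tc M n = f $$ (- n)" by (simp add: f sq_coeff_1)
  also have "\<dots> = (\<Sum>i\<in>{-M..-n}. (fls_ex * em1 powi (- i - 1) * f) $$ (-1) * (em1 powi i) $$ (- n))"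
    by (rule fls_expand_em1) (auto simp: f intro!: ex_em1_powi_nth_below)
  also have "\<dots> = (\<Sum>i\<in>{1..M-n+1}. sq_coeff 2 i 1 * (em1 powi (- (M - i + 1))) $$ (- n))"
    unfolding r
    by (rule sum.reindex_bij_witness[where i = "\<lambda>i. i - M - 1" and j = "\<lambda>i. i + M + 1"]) auto
  finally show ?thesis
    by (simp add: of_int_times_sq_coeff_1 sum_distrib_left mult.left_commute del: of_int_add of_int_diff)
qed

lemma sqL0_bm: "sqL0 (bm n v) = bm n (sqL0 v) - of_int n *s bm n v"
proof -
  obtain N1 where N1: "\<forall>i>N1. \<forall>u\<in>set [v, sqL0 v]. am i u = 0" using am_bounds by metis
  obtain N2 where N2: "\<forall>i>N2. \<forall>u\<in>set [v, bm n v]. Y conf i u = 0" using conf_bounds by metis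
  define N where "N = max N1 N2"
  have N: "am i v = 0" "am i (sqL0 v) = 0" "Y conf i v = 0" "Y conf i (bm n v) = 0" if "i > N" for i
    using that N1 N2 by (auto simp: N_def)
  let ?s = "\<lambda>i. sq_coeff 2 i 1"
  \<comment> \<open>When the terms are regrouped by the resulting mode M = m + i - 1, the index i
    runs up to M - n + 1, hence up to N - n + 1; the range of conformal modes is enlarged to contain
    this.\<close>
  define N' where "N' = max N (N - n + 1)"
  have Nn: "N - n + 1 \<le> N'" by (simp add: N'_def)
  have N': "Y conf i v = 0" "Y conf i (bm n v) = 0" if "i > N'" for i
    using that N by (auto simp: N'_def)
  have "sqL0 (bm n v) = (\<Sum>i\<in>{1..N'}. \<Sum>m\<in>{n..N}. (?s i * tc m n) *s L (i - 1) (am m v))"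
    by (simp only: sqL0_eq[OF N'(2)]) (simp add: bm_eq[OF N(1)] L_linear scale_sum_right)
  also have "\<dots> = (\<Sum>i\<in>{1..N'}. \<Sum>m\<in>{n..N}. (?s i * tc m n) *s am m (L (i - 1) v)) -
      (\<Sum>i\<in>{1..N'}. \<Sum>m\<in>{n..N}. (?s i * (of_int m * tc m n)) *s am (m + i - 1) v)"
    by (simp add: L_am scale_right_diff_distrib sum_subtractf mult_ac add_diff_eq)
  also have "(\<Sum>i\<in>{1..N'}. \<Sum>m\<in>{n..N}. (?s i * tc m n) *s am m (L (i - 1) v)) = bm n (sqL0 v)"
    by (subst sum.swap, simp only: bm_eq[OF N(2)]) (simp add: sqL0_eq[OF N'(1)] Y_linear scale_sum_right mult.commute)
  also have "(\<Sum>i\<in>{1..N'}. \<Sum>m\<in>{n..N}. (?s i * (of_int m * tc m n)) *s am (m + i - 1) v)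
     = (\<Sum>M\<in>{n..N}. \<Sum>i\<in>{1..M-n+1}. (?s i * (of_int (M - i + 1) * tc (M - i + 1) n)) *s am M v)"
  proof -
    have nz: "am M v \<noteq> 0 \<Longrightarrow> M \<le> N" for M using N(1) not_le by blast
    let ?f = "\<lambda>(i, m). (?s i * (of_int m * tc m n)) *s am (m + i - 1) v"
    have "(\<Sum>i\<in>{1..N'}. \<Sum>m\<in>{n..N}. (?s i * (of_int m * tc m n)) *s am (m + i - 1) v)
       = sum ?f ({1..N'} \<times> {n..N})" by (simp add: sum.cartesian_product)
    also have "\<dots> = sum ?f (SIGMA i:{1..N-n+1}. {n..N-i+1})"
      using Nn by (intro sum.mono_neutral_right) (auto simp: N dest!: nz)
    also have "\<dots> = (\<Sum>M\<in>{n..N}. \<Sum>i\<in>{1..M-n+1}. (?s i * (of_int (M - i + 1) * tc (M - i + 1) n)) *s am M v)"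
      by (subst sum.Sigma, simp, simp)
         (rule sum.reindex_bij_witness[where i = "\<lambda>(M, i). (i, M - i + 1)" and j = "\<lambda>(i, m). (m + i - 1, i)"], auto simp: algebra_simps)
    finally show ?thesis .
  qed
  also have "\<dots> = of_int n *s bm n v"
    by (simp flip: scale_sum_left add: sum_sq_coeff_2 bm_eq[of N] N scale_sum_right del: of_int_add of_int_diff)
  finally show ?thesis .
qed

section \<open>Square bracket Fock vectors span the graded pieces of L[0]\<close>

definition sqfock :: "nat list \<Rightarrow> 'v" where
  "sqfock ks = foldr (\<lambda>k. bm (- int k)) ks vac"

lemma sqfock_simps [simp]: "sqfock [] = vac" "sqfock (k # ks) = bm (- int k) (sqfock ks)"
  by (simp_all add: sqfock_def)

lemma sqL0_vac: "sqL0 vac = 0"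
  by (subst sqL0_eq[of 0]) (auto simp: creation)

lemma sqL0_sqfock: "sqL0 (sqfock ks) = of_int (int (sum_list ks)) *s sqfock ks"
  by (induction ks) (auto simp: sqL0_vac sqL0_bm bm_linear scale_left_distrib)

text \<open>A creation mode prepends an index. An annihilation mode is moved to the right by the
  commutation relation until it meets the vacuum.\<close>

lemma bm_in_span_sqfock: "w \<in> span (range sqfock) \<Longrightarrow> bm n w \<in> span (range sqfock)"
proof (induction w rule: span_induct_alt)
  case (step c x y)
  then obtain ks where x: "x = sqfock ks" by auto
  have "bm n (sqfock ks) \<in> span (range sqfock)"
  proof (cases "n \<ge> 0")
    case False
    then have "bm n (sqfock ks) = sqfock (nat (- n) # ks)" by simp
    then show ?thesis by (metis rangeI span_base)
  next
    case True
    show ?thesis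
    proof (induction ks)
      case Nil
      then show ?case using True by (simp add: bm_vac span_zero)
    next
      case (Cons k ks)
      have cr: "w \<in> span (range sqfock) \<Longrightarrow> bm (- int k) w \<in> span (range sqfock)" for w
      proof (induction w rule: span_induct_alt)
        case (step c x y)
        then obtain js where x: "x = sqfock js" by auto
        have "bm (- int k) x = sqfock (k # js)" by (simp add: x)
        then show ?case using step by (metis bm_add bm_scale rangeI span_add span_base span_scale)
      qed (simp add: span_zero)
      show ?case
        unfolding sqfock_simps(2) bm_commute[of n "- int k"]
        by (intro span_add span_scale cr Cons) (auto intro: span_base)
    qed
  qed
  then show ?case using step by (simp add: bm_linear x span_add span_scale)
qed (simp add: span_zero)

text \<open>The modes a(m) are combinations of the a[l], so the span is stable under them; it
  contains the vacuum and therefore all ordinary Fock vectors.\<close>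

lemma span_sqfock: "span (range sqfock) = UNIV"
proof -
  have am: "am m w \<in> span (range sqfock)" if "w \<in> span (range sqfock)" for m w
  proof -
    obtain N where "\<forall>m>N. am m w = 0" using mode_truncation[of a w] by blast
    then have "am m w = (\<Sum>l\<in>{m..N}. ((em1 powi m) $$ l) *s bm l w)" by (intro am_eq_bm) auto
    also have "\<dots> \<in> span (range sqfock)"
      by (intro span_sum span_scale bm_in_span_sqfock that)
    finally show ?thesis .
  qed
  have "fock ks \<in> span (range sqfock)" for ks
  proof (induction ks)
    case Nil
    have "vac = sqfock []" by simp
    then show ?case unfolding fock_simps by (metis rangeI span_base)
  qed (simp add: am)
  then have "span (range fock) \<subseteq> span (range sqfock)" by (intro span_minimal) auto
  then show ?thesis using span_fock by auto
qed

lemma sq_grade_eq: "sq_grade n = {v. sqL0 v = of_int n *s v}"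
proof -
  interpret sq: voa_data scale sq_mode vac sq_conf 1 ..
  show ?thesis unfolding sq_grade_def sq.grade_def sq.L_def sqL0_def by simp
qed

lemma subspace_sq_grade: "subspace (sq_grade n)"
proof -
  interpret l: Vector_Spaces.linear scale scale sqL0 by (rule linear_sqL0)
  show ?thesis unfolding sq_grade_eq
    by (rule subspaceI) (auto simp: l.zero l.add l.scale scale_right_distrib mult.commute)
qed

lemma sq_grade_bm: "v \<in> sq_grade n \<Longrightarrow> bm m v \<in> sq_grade (n - m)"
  by (simp add: sq_grade_eq sqL0_bm bm_linear scale_left_diff_distrib)

lemma sq_grade_eq_span: "sq_grade n = span (sqfock ` {ks. 0 \<notin> set ks \<and> int (sum_list ks) = n})"
proof
  have 0: "sqfock ks = 0" if "0 \<in> set ks" for ks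
    using that by (induction ks) auto
  have "range sqfock \<subseteq> insert 0 (\<Union>n. sqfock ` {ks. 0 \<notin> set ks \<and> int (sum_list ks) = n})"
    using 0 by auto
  then have 1: "span (\<Union>n. sqfock ` {ks. 0 \<notin> set ks \<and> int (sum_list ks) = n}) = UNIV"
    using span_mono[of "range sqfock" "insert 0 _"] unfolding span_sqfock span_insert_0 by blast
  show "sq_grade n \<subseteq> span (sqfock ` {ks. 0 \<notin> set ks \<and> int (sum_list ks) = n})"
  proof
    fix v assume "v \<in> sq_grade n"
    then show "v \<in> span (sqfock ` {ks. 0 \<notin> set ks \<and> int (sum_list ks) = n})"
      by (intro eigenvector_in_span[OF linear_sqL0 _ 1]) (auto simp: sq_grade_eq sqL0_sqfock)
  qed
  show "span (sqfock ` {ks. 0 \<notin> set ks \<and> int (sum_list ks) = n}) \<subseteq> sq_grade n"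
    by (intro span_minimal subspace_sq_grade) (auto simp: sq_grade_eq sqL0_sqfock)
qed

lemma sq_grade_negative: "n < 0 \<Longrightarrow> sq_grade n = {0}"
proof -
  assume "n < 0"
  then have "{ks. 0 \<notin> set ks \<and> int (sum_list ks) = n} = {}" by auto
  then show ?thesis by (simp only: sq_grade_eq_span image_empty span_empty)
qed

lemma sq_grade_0: "sq_grade 0 = span {vac}"
proof -
  have "ks = []" if "0 \<notin> set ks" "sum_list ks = 0" for ks :: "nat list"
    using that by (cases ks) auto
  then have "{ks. 0 \<notin> set ks \<and> int (sum_list ks) = 0} = {[]}" by auto
  then show ?thesis by (simp add: sq_grade_eq_span)
qed

lemma finite_sq_basis:
  assumes "is_basis_of U (sq_grade (int n))"
  shows "finite U"
proof -
  have "finite (sqfock ` {ks. 0 \<notin> set ks \<and> sum_list ks = n})"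
    using finite_lists_sum by simp
  moreover have "U \<subseteq> span (sqfock ` {ks. 0 \<notin> set ks \<and> sum_list ks = n})"
    using assms span_superset[of U] by (simp add: is_basis_of_def sq_grade_eq_span)
  ultimately show ?thesis
    using independent_span_bound assms unfolding is_basis_of_def by blast
qed

text \<open>The sum is the degree operator: its commutator with a[-j] is j a[-j], and it annihilates
  the vacuum. The bound on \<open>N\<close> guarantees that every index occurring in the list is
  covered by the sum.\<close>

lemma sum_bm_bm_sqfock:
  "sum_list ks \<le> N \<Longrightarrow> (\<Sum>k=1..N. bm (- int k) (bm (int k) (sqfock ks))) = of_nat (sum_list ks) *s sqfock ks"
proof (induction ks)
  case Nil
  then show ?case by (simp add: bm_vac)
next
  case (Cons j ks)
  have 1: "bm (- int k) (bm (int k) (bm (- int j) w)) =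
     bm (- int j) (bm (- int k) (bm (int k) w)) + (if k = j then of_nat j *s bm (- int j) w else 0)" if "k \<ge> 1" for k w
    using that bm_commute[of "int k" "- int j" w] bm_commute[of "- int k" "- int j" "bm (int k) w"]
    by (auto simp: bm_linear)
  have "(\<Sum>k=1..N. bm (- int k) (bm (int k) (sqfock (j # ks)))) =
     (\<Sum>k=1..N. bm (- int j) (bm (- int k) (bm (int k) (sqfock ks))) +
       (if k = j then of_nat j *s bm (- int j) (sqfock ks) else 0))"
    by (intro sum.cong) (auto simp: 1)
  also have "\<dots> = bm (- int j) (\<Sum>k=1..N. bm (- int k) (bm (int k) (sqfock ks))) + of_nat j *s bm (- int j) (sqfock ks)"
    using Cons.prems by (cases "j = 0") (auto simp: sum.distrib bm_sum sum.delta)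
  also have "\<dots> = of_nat (sum_list (j # ks)) *s sqfock (j # ks)"
    using Cons by (simp add: bm_linear scale_left_distrib add.commute)
  finally show ?case .
qed

text \<open>An Euler identity. It writes a vector of degree n > 0 through creation modes applied to
  vectors of lower degree, and it drives the inductions on the square bracket degree.\<close>

lemma sum_bm_bm:
  assumes "v \<in> sq_grade (int n)"
  shows "(\<Sum>k=1..n. bm (- int k) (bm (int k) v)) = of_nat n *s v"
proof -
  have "v \<in> span (sqfock ` {ks. 0 \<notin> set ks \<and> sum_list ks = n})"
    using assms by (simp add: sq_grade_eq_span)
  then show ?thesis
  proof (induction v rule: span_induct_alt)
    case (step c x y)
    then obtain ks where x: "x = sqfock ks" "sum_list ks = n" by auto
    have "(\<Sum>k=1..n. bm (- int k) (bm (int k) x)) = of_nat n *s x"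
      using sum_bm_bm_sqfock[of ks n] x by simp
    then show ?case using step.IH
      by (simp add: bm_linear sum.distrib scale_sum_right[symmetric] scale_right_distrib mult.commute)
  qed simp
qed

lemma span_sq_grade: "span (\<Union>n. sq_grade (int n)) = UNIV"
proof -
  have "range sqfock \<subseteq> (\<Union>n. sq_grade (int n))"
    by (auto simp: sq_grade_eq sqL0_sqfock)
  then show ?thesis using span_mono unfolding span_sqfock[symmetric] by (metis span_sqfock subset_antisym subset_UNIV)
qed

lemma vac_sq_grade: "vac \<in> sq_grade 0"
  by (simp add: sq_grade_eq sqL0_vac)

text \<open>In the square bracket structure \<open>a\<close> has weight 1 and is annihilated by
  L[1]. The exponential in the invariance condition therefore contributes only its term i = 0, with
  sign (-1)^1 and mode index 2 - n - 2 = - n.\<close>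

lemma LiZ_bm:
  assumes "is_sq_LiZ_metric B"
  shows "B (bm n u) v = - B u (bm (- n) v)"
proof -
  interpret sq: voa_data scale sq_mode vac sq_conf 1 ..
  have "a \<in> sq.grade 1"
  proof -
    obtain N where N: "\<forall>m>N. Y conf m a = 0" using mode_truncation[of conf a] by blast
    have "sqL0 a = (\<Sum>i\<in>{1..max N 1}. sq_coeff 2 i 1 *s L (i - 1) a)"
      using N by (intro sqL0_eq) auto
    also have "\<dots> = (\<Sum>i\<in>{1::int}. sq_coeff 2 i 1 *s L (i - 1) a)"
      by (intro sum.mono_neutral_right) (auto simp: L_a(2))
    also have "\<dots> = sq_coeff 2 1 1 *s L 0 a" by simp
    also have "sq_coeff 2 1 1 = 1"
    proof -
      have "sq_coeff 2 1 1 = (fps_to_fls (fps_exp 2) * em1 powi (- 2)) $$ (0 + (- 2))"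
        by (simp add: sq_coeff_em1)
      also have "\<dots> = fps_to_fls (fps_exp 2) $$ 0 * (em1 powi (- 2)) $$ (-2)"
        using fls_times_base[of "fps_to_fls (fps_exp (2::complex))" "em1 powi (- 2)"]
        by (simp add: fls_subdegree_fls_to_fps)
      also have "(em1 powi (- 2)) $$ (-2) = 1"
      proof -
        have "(em1 powi (- 2)) = inverse em1 * inverse em1"
          by (simp add: power_int_minus power2_eq_square)
        moreover have "fls_subdegree (inverse em1) = -1"
          using fls_subdegree_power_int[of em1 "-1"] by simp
        ultimately show ?thesis
          using fls_times_base[of "inverse em1" "inverse em1"] inverse_em1_residue by simp
      qed
      finally show ?thesis by simp
    qed
    finally show ?thesis by (simp add: sq.grade_def sq.L_def sqL0_def L_a)
  qed
  moreover have "sq.L 1 a = 0"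
  proof -
    obtain N where N: "\<forall>m>N. Y conf m a = 0" using mode_truncation[of conf a] by blast
    have "sq.L 1 a = (\<Sum>m\<in>{2..N}. sq_coeff 2 m 2 *s Y conf m a)"
      unfolding sq.L_def using N sq_mode_sq_conf[of 2 N a] by simp
    also have "\<dots> = 0"
      using L_a(2)[of "_ - 1"] by (intro sum.neutral) (auto simp: L_def)
    finally show ?thesis .
  qed
  moreover have lin: "Vector_Spaces.linear scale (*) (B x)" for x
    using assms unfolding is_sq_LiZ_metric_def sq.is_LiZ_metric_def by auto
  ultimately have z: "(sq.L 1 ^^ i) a = (if i = 0 then a else 0)" for i
  proof (induction i)
    case (Suc i)
    have "sq.L 1 0 = 0"
    proof -
      have "sq_mode sq_conf 2 0 = 0" by (subst sq_mode_sq_conf[of _ 0]) auto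
      then show ?thesis by (simp add: sq.L_def)
    qed
    then show ?case using Suc by auto
  qed auto
  have B0: "B x 0 = 0" for x
  proof -
    interpret l: Vector_Spaces.linear scale "(*)" "B x" by (rule lin)
    show ?thesis by (rule l.zero)
  qed
  have "B (bm n u) v = (- 1) powi 1 *
     Sum_any (\<lambda>i::nat. B u (sq_mode ((sq.L 1 ^^ i) a) (2 * 1 - n - 2 - int i) v) / fact i)"
    using assms \<open>a \<in> sq.grade 1\<close> unfolding is_sq_LiZ_metric_def sq.is_LiZ_metric_def by blast
  also have "\<dots> = - B u (bm (- n) v)"
    by (subst Sum_any_atMost[of 0]) (auto simp: z B0)
  finally show ?thesis .
qed

end


section \<open>The Li-Zamolodchikov metric and Gaussian pairings\<close>

definition pos_lists :: "nat \<Rightarrow> nat list set" where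
  "pos_lists N = {ns. 0 \<notin> set ns \<and> sum_list ns \<le> N}"

lemma finite_pos_lists [simp]: "finite (pos_lists N)"
proof -
  have "pos_lists N = (\<Union>n\<le>N. {ns. 0 \<notin> set ns \<and> sum_list ns = n})"
    by (auto simp: pos_lists_def)
  then show ?thesis using finite_lists_sum by simp
qed

lemma sum_pos_lists:
  "(\<Sum>ns\<in>pos_lists N. h ns) = h [] + (\<Sum>p=1..N. \<Sum>ns\<in>pos_lists (N - p). h (p # ns) :: complex)"
proof -
  have "pos_lists N = insert [] (\<Union>p\<in>{1..N}. (#) p ` pos_lists (N - p))"
  proof (intro equalityI subsetI)
    fix ns assume "ns \<in> pos_lists N"
    then show "ns \<in> insert [] (\<Union>p\<in>{1..N}. (#) p ` pos_lists (N - p))"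
      by (cases ns) (auto simp: pos_lists_def intro!: bexI[of _ "hd ns"])
  qed (auto simp: pos_lists_def)
  then have "(\<Sum>ns\<in>pos_lists N. h ns) = h [] + (\<Sum>ns\<in>(\<Union>p\<in>{1..N}. (#) p ` pos_lists (N - p)). h ns)"
    by (simp, subst sum.insert) auto
  also have "(\<Sum>ns\<in>(\<Union>p\<in>{1..N}. (#) p ` pos_lists (N - p)). h ns) =
     (\<Sum>p=1..N. \<Sum>ns\<in>pos_lists (N - p). h (p # ns))"
    by (subst sum.UNION_disjoint) (auto simp: sum.reindex intro!: sum.cong)
  finally show ?thesis .
qed

text \<open>The weight of a walk along edges that are alternately labelled \<open>1\<close> and \<open>2\<close>, through
  the listed nodes and then to \<open>k\<close>; it vanishes unless the number of edges is even and positive.\<close>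

fun walk_weight :: "(nat \<Rightarrow> nat \<Rightarrow> complex) \<Rightarrow> (nat \<Rightarrow> nat \<Rightarrow> complex) \<Rightarrow> nat \<Rightarrow> nat list \<Rightarrow> complex" where
  "walk_weight C1 C2 k (l # p # m # ns) =
     C1 l p / of_nat p * (C2 p m / of_nat m) * walk_weight C1 C2 k (m # ns)"
| "walk_weight C1 C2 k [l, p] = C1 l p / of_nat p * C2 p k"
| "walk_weight C1 C2 k [l] = 0"
| "walk_weight C1 C2 k [] = 0"

text \<open>Each use of the recursion peels off two edges: one labelled 1 from l to p, and one
  labelled 2 from p that either ends at k or goes on to m. The degree drops by l + p each time, so
  the unrolling stops.\<close>

lemma walk_recursion_solution:
  fixes R :: "nat \<Rightarrow> nat \<Rightarrow> nat \<Rightarrow> complex"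
  assumes R: "\<And>n k l. k \<ge> 1 \<Longrightarrow> l \<ge> 1 \<Longrightarrow> l \<le> n \<Longrightarrow> R n k l = (\<Sum>p=1..n-l. C1 l p / of_nat p *
       (C2 p k * K (n - l - p) + (\<Sum>m=1..n-l-p. C2 p m / of_nat m * R (n - l - p) k m)))"
    and "k \<ge> 1" "l \<ge> 1" "l \<le> n"
  shows "R n k l = (\<Sum>ns\<in>pos_lists (n - l). walk_weight C1 C2 k (l # ns) * K (n - l - sum_list ns))"
  using assms(2-)
proof (induction n arbitrary: l rule: less_induct)
  case (less n)
  have "(\<Sum>ns\<in>pos_lists (n - l). walk_weight C1 C2 k (l # ns) * K (n - l - sum_list ns)) =
    (\<Sum>p=1..n-l. \<Sum>ns\<in>pos_lists (n - l - p). walk_weight C1 C2 k (l # p # ns) * K (n - l - p - sum_list ns))"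
    by (subst sum_pos_lists) (simp add: diff_diff_add add.assoc)
  also have "\<dots> = (\<Sum>p=1..n-l. walk_weight C1 C2 k [l, p] * K (n - l - p) +
     (\<Sum>m=1..n-l-p. \<Sum>ns\<in>pos_lists (n - l - p - m).
        walk_weight C1 C2 k (l # p # m # ns) * K (n - l - p - m - sum_list ns)))"
    by (intro sum.cong refl, subst sum_pos_lists) (simp add: diff_diff_add add.assoc)
  also have "\<dots> = (\<Sum>p=1..n-l. C1 l p / of_nat p *
       (C2 p k * K (n - l - p) + (\<Sum>m=1..n-l-p. C2 p m / of_nat m * R (n - l - p) k m)))"
  proof (intro sum.cong refl)
    fix p assume p: "p \<in> {1..n-l}"
    have "(\<Sum>m=1..n-l-p. \<Sum>ns\<in>pos_lists (n - l - p - m).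
        walk_weight C1 C2 k (l # p # m # ns) * K (n - l - p - m - sum_list ns)) =
      (\<Sum>m=1..n-l-p. C1 l p / of_nat p * (C2 p m / of_nat m * R (n - l - p) k m))"
    proof (intro sum.cong refl)
      fix m assume m: "m \<in> {1..n-l-p}"
      have "R (n - l - p) k m = (\<Sum>ns\<in>pos_lists (n - l - p - m). walk_weight C1 C2 k (m # ns) * K (n - l - p - m - sum_list ns))"
        using less.prems p m by (intro less.IH) auto
      then show "(\<Sum>ns\<in>pos_lists (n - l - p - m).
        walk_weight C1 C2 k (l # p # m # ns) * K (n - l - p - m - sum_list ns)) =
        C1 l p / of_nat p * (C2 p m / of_nat m * R (n - l - p) k m)"
        by (simp add: sum_distrib_left mult.assoc)
    qed
    then show "walk_weight C1 C2 k [l, p] * K (n - l - p) +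
     (\<Sum>m=1..n-l-p. \<Sum>ns\<in>pos_lists (n - l - p - m).
        walk_weight C1 C2 k (l # p # m # ns) * K (n - l - p - m - sum_list ns)) = 
      C1 l p / of_nat p *
       (C2 p k * K (n - l - p) + (\<Sum>m=1..n-l-p. C2 p m / of_nat m * R (n - l - p) k m))"
      by (simp only: walk_weight.simps distrib_left mult.assoc sum_distrib_left)
  qed
  also have "\<dots> = R n k l"
    using less.prems by (intro R[symmetric]) auto
  finally show ?case ..
qed

text \<open>On the diagonal l = k the walks close up, so their end point is the head of the list of
  nodes; the empty list is harmless because it has weight 0.\<close>

lemma closed_walk_recursion:
  assumes "\<And>n k l. k \<ge> 1 \<Longrightarrow> l \<ge> 1 \<Longrightarrow> l \<le> n \<Longrightarrow> R n k l = (\<Sum>p=1..n-l. C1 l p / of_nat p *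
       (C2 p k * K (n - l - p) + (\<Sum>m=1..n-l-p. C2 p m / of_nat m * R (n - l - p) k m)))"
    and "\<And>n. of_nat n * K n = (\<Sum>k=1..n. R n k k)"
  shows "of_nat n * K n = (\<Sum>ns\<in>pos_lists n. walk_weight C1 C2 (hd ns) ns * K (n - sum_list ns))"
  unfolding assms(2)
  by (subst sum_pos_lists) (auto intro!: sum.cong simp: walk_recursion_solution[OF assms(1)])

context heisenberg_voa
begin

lemma sq_grade_annihilate:
  assumes "v \<in> sq_grade (int n)" "k \<le> n"
  shows "bm (int k) v \<in> sq_grade (int (n - k))"
proof -
  have e: "int n - int k = int (n - k)" using assms(2) by simp
  show ?thesis using sq_grade_bm[OF assms(1), of "int k"] unfolding e .
qed

lemma sq_grade_create:
  assumes "v \<in> sq_grade (int (n - k))" "k \<le> n"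
  shows "bm (- int k) v \<in> sq_grade (int n)"
proof -
  have e: "int (n - k) - (- int k) = int n" using assms(2) by simp
  show ?thesis using sq_grade_bm[OF assms(1), of "- int k"] unfolding e .
qed

lemma sq_grade_bm_zero:
  assumes "v \<in> sq_grade (int n)" "m > n"
  shows "bm (int m) v = 0"
  using sq_grade_bm[OF assms(1), of "int m"] assms(2) sq_grade_negative[of "int n - int m"] by auto

end

section \<open>The metric, dual bases and pairings of functionals\<close>

locale heisenberg_liz = heisenberg_voa scale Y vac conf a
  for scale :: "complex \<Rightarrow> 'v \<Rightarrow> 'v::ab_group_add" (infixr "*s" 75)
    and Y vac conf a +
  fixes B :: "'v \<Rightarrow> 'v \<Rightarrow> complex"
  assumes LiZ: "is_sq_LiZ_metric B"
begin

lemma B_linear: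
  "B x (y + z) = B x y + B x z" "B x (r *s y) = r * B x y"
  "B (x + y) z = B x z + B y z" "B (r *s x) z = r * B x z" "B vac vac = 1"
proof -
  interpret sq: voa_data scale sq_mode vac sq_conf 1 ..
  have l: "Vector_Spaces.linear scale (*) (B x)" "Vector_Spaces.linear scale (*) (\<lambda>x. B x z)" for x z
    using LiZ unfolding is_sq_LiZ_metric_def sq.is_LiZ_metric_def by auto
  show "B x (y + z) = B x y + B x z" "B x (r *s y) = r * B x y"
    using module_hom.add[OF l(1)[unfolded linear_iff_module_hom]]
      module_hom.scale[OF l(1)[unfolded linear_iff_module_hom]] by auto
  show "B (x + y) z = B x z + B y z" "B (r *s x) z = r * B x z"
    using module_hom.add[OF l(2)[unfolded linear_iff_module_hom]]
      module_hom.scale[OF l(2)[unfolded linear_iff_module_hom]] by auto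
  show "B vac vac = 1"
    using LiZ unfolding is_sq_LiZ_metric_def sq.is_LiZ_metric_def by auto
qed

lemma B_zero [simp]: "B x 0 = 0" "B 0 x = 0"
  using B_linear(2)[of x 0 0] B_linear(4)[of 0 0 x] by auto

lemma B_sum: "B x (\<Sum>i\<in>A. f i) = (\<Sum>i\<in>A. B x (f i))" "B (\<Sum>i\<in>A. f i) x = (\<Sum>i\<in>A. B (f i) x)"
  by (induction A rule: infinite_finite_induct, auto simp: B_linear)+

lemma B_diff: "B x (y - z) = B x y - B x z"
  using B_linear(1)[of x y "(-1) *s z"] B_linear(2)[of x "-1" z] by simp

lemmas B_bm = LiZ_bm[OF LiZ]

text \<open>Induction on the degree: invariance carries the hypothesis from v to every a[k] v, which
  is then 0, and the Euler identity gives n v = 0.\<close>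

lemma B_nondegenerate:
  assumes "v \<in> sq_grade (int n)" "\<And>u. u \<in> sq_grade (int n) \<Longrightarrow> B u v = 0"
  shows "v = 0"
  using assms
proof (induction n arbitrary: v rule: less_induct)
  case (less n)
  show ?case
  proof (cases "n = 0")
    case True
    then obtain c where "v = c *s vac" using less.prems(1) by (auto simp: sq_grade_0 span_singleton)
    then show ?thesis using less.prems(2)[of vac] True vac_sq_grade by (simp add: B_linear)
  next
    case False
    have "bm (int k) v = 0" if k: "k \<in> {1..n}" for k
    proof (rule less.IH)
      show "n - k < n" using k by auto
      show "bm (int k) v \<in> sq_grade (int (n - k))"
        using k by (intro sq_grade_annihilate less.prems) auto
      fix u assume "u \<in> sq_grade (int (n - k))"
      then have "bm (- int k) u \<in> sq_grade (int n)"
        using k by (intro sq_grade_create) auto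
      then show "B u (bm (int k) v) = 0"
        using B_bm[of "- int k" u v] less.prems(2) by simp
    qed
    then have "of_nat n *s v = 0" using sum_bm_bm[OF less.prems(1)] by simp
    then show ?thesis using False by simp
  qed
qed

text \<open>Every functional is represented by a vector in each degree. Together with non-degeneracy
  this yields dual bases.\<close>

lemma B_represents:
  assumes "Vector_Spaces.linear scale (*) g"
  shows "\<exists>x\<in>sq_grade (int n). \<forall>v\<in>sq_grade (int n). B v x = g v"
  using assms
proof (induction n arbitrary: g rule: less_induct)
  case (less n)
  interpret g: Vector_Spaces.linear scale "(*)" g by fact
  show ?case
  proof (cases "n = 0")
    case True
    have "B v (g vac *s vac) = g v" if "v \<in> sq_grade 0" for v
      using that by (auto simp: sq_grade_0 span_singleton B_linear g.scale)
    then show ?thesis using True vac_sq_grade subspace_scale[OF subspace_sq_grade]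
      by (intro bexI[of _ "g vac *s vac"]) auto
  next
    case False
    have "\<exists>x\<in>sq_grade (int (n - k)). \<forall>w\<in>sq_grade (int (n - k)). B w x = g (bm (- int k) w)"
      if "k \<in> {1..n}" for k
    proof (rule less.IH)
      show "Vector_Spaces.linear scale (*) (\<lambda>w. g (bm (- int k) w))"
        by unfold_locales (auto simp: bm_linear g.add g.scale)
    qed (use that in auto)
    then obtain x where x: "\<And>k. k \<in> {1..n} \<Longrightarrow> x k \<in> sq_grade (int (n - k))"
      "\<And>k w. k \<in> {1..n} \<Longrightarrow> w \<in> sq_grade (int (n - k)) \<Longrightarrow> B w (x k) = g (bm (- int k) w)"
      by metis
    \<comment> \<open>The formula is forced: by invariance a[k] y must be - x k, and the Euler
      identity recovers y from these vectors.\<close>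
    define y where "y = (- 1 / of_nat n) *s (\<Sum>k=1..n. bm (- int k) (x k))"
    have "bm (- int k) (x k) \<in> sq_grade (int n)" if "k \<in> {1..n}" for k
      using that by (intro sq_grade_create x(1)) auto
    then have "y \<in> sq_grade (int n)"
      unfolding y_def by (intro subspace_scale subspace_sum subspace_sq_grade) auto
    moreover have "B v y = g v" if v: "v \<in> sq_grade (int n)" for v
    proof -
      have bk: "bm (int k) v \<in> sq_grade (int (n - k))" if "k \<in> {1..n}" for k
        using that by (intro sq_grade_annihilate v) auto
      have "B v y = (- 1 / of_nat n) * (\<Sum>k=1..n. B v (bm (- int k) (x k)))"
        by (simp only: y_def B_linear B_sum)
      also have "(\<Sum>k=1..n. B v (bm (- int k) (x k))) = (\<Sum>k=1..n. - g (bm (- int k) (bm (int k) v)))"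
      proof (intro sum.cong refl)
        fix k assume k: "k \<in> {1..n}"
        show "B v (bm (- int k) (x k)) = - g (bm (- int k) (bm (int k) v))"
          using B_bm[of "int k" v "x k"] x(2)[OF k bk[OF k]] by simp
      qed
      also have "\<dots> = - g (of_nat n *s v)"
        unfolding sum_bm_bm[OF v, symmetric] by (simp add: sum_negf g.sum)
      finally show ?thesis using False by (simp add: g.scale)
    qed
    ultimately show ?thesis by auto
  qed
qed

context
  fixes U :: "'v set" and n :: nat
  assumes U: "is_basis_of U (sq_grade (int n))"
begin

lemma U_props: "independent U" "span U = sq_grade (int n)" "finite U"
  using U finite_sq_basis by (auto simp: is_basis_of_def)

lemma B_eq_0_on_basis:
  assumes "\<And>u. u \<in> U \<Longrightarrow> B u w = 0" "v \<in> sq_grade (int n)"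
  shows "B v w = 0"
  using assms(2)[folded U_props(2)]
  by (induction rule: span_induct_alt) (auto simp: B_linear assms(1))

text \<open>Existence comes from representing the coordinate functional of \<open>u\<close>,
  uniqueness from non-degeneracy; so the definite description in \<open>dual_vec\<close> is
  meaningful.\<close>

lemma dual_vec_props:
  assumes u: "u \<in> U"
  shows "dual_vec B U u \<in> sq_grade (int n)"
    "u' \<in> U \<Longrightarrow> B u' (dual_vec B U u) = (if u' = u then 1 else 0)"
proof -
  interpret p: vector_space_pair scale "(*) :: complex \<Rightarrow> complex \<Rightarrow> complex"
    by unfold_locales (auto simp: algebra_simps)
  obtain g where g: "Vector_Spaces.linear scale (*) g" "\<forall>x\<in>U. g x = (if x = u then 1 else 0)"
    using p.linear_independent_extend[OF U_props(1), of "\<lambda>x. if x = u then 1 else 0"] by blast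
  obtain w where w: "w \<in> sq_grade (int n)" "\<forall>v\<in>sq_grade (int n). B v w = g v"
    using B_represents[OF g(1)] by blast
  have UV: "x \<in> sq_grade (int n)" if "x \<in> U" for x
    using that U_props(2) span_base by blast
  have P: "w \<in> span U \<and> (\<forall>u'\<in>U. B u' w = (if u' = u then 1 else 0))"
    using w g(2) UV by (simp add: U_props(2))
  have "w' = w" if w': "w' \<in> span U \<and> (\<forall>u'\<in>U. B u' w' = (if u' = u then 1 else 0))" for w'
  proof -
    have "w' - w = 0"
    proof (rule B_nondegenerate)
      show "w' - w \<in> sq_grade (int n)"
        using w' w(1) by (auto simp: U_props(2) intro: subspace_diff[OF subspace_sq_grade])
      have "B y (w' - w) = 0" if "y \<in> U" for y
        unfolding B_diff bspec[OF conjunct2[OF P] that] bspec[OF conjunct2[OF w'] that] by (rule diff_self)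
      then show "B x (w' - w) = 0" if "x \<in> sq_grade (int n)" for x
        using that by (rule B_eq_0_on_basis)
    qed
    then show ?thesis by simp
  qed
  with P have "dual_vec B U u = w"
    unfolding dual_vec_def by (rule the_equality)
  then show "dual_vec B U u \<in> sq_grade (int n)"
    "u' \<in> U \<Longrightarrow> B u' (dual_vec B U u) = (if u' = u then 1 else 0)"
    using P unfolding U_props(2) by blast+
qed

text \<open>The sum over the basis, read as one vector, is characterised by reproducing
  \<open>f\<close> under the metric. This property no longer mentions the basis and can be combined
  with the mode relations.\<close>

lemma coherent_vector:
  assumes f: "Vector_Spaces.linear scale (*) f" and v: "v \<in> sq_grade (int n)"
  shows "B v (\<Sum>u\<in>U. f u *s dual_vec B U u) = f v"
proof -
  interpret f: Vector_Spaces.linear scale "(*)" f by fact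
  show ?thesis using v[folded U_props(2)]
  proof (induction rule: span_induct_alt)
    case (step c x y)
    have "B x (\<Sum>u\<in>U. f u *s dual_vec B U u) = f x"
      using step.hyps U_props(3) by (simp add: B_sum B_linear dual_vec_props sum.delta if_distrib cong: if_cong)
    then show ?case using step.IH by (simp add: B_linear f.add f.scale)
  qed (simp add: f.zero)
qed

end

text \<open>The one-point functions turn out to be Gaussian functionals in the sense of the two
  hypotheses on \<open>f\<close> and \<open>g\<close>.\<close>

lemma gaussian_pairing_recursion:
  fixes f g :: "'v \<Rightarrow> complex" and U :: "nat \<Rightarrow> 'v set"
  assumes U: "\<And>n. is_basis_of (U n) (sq_grade (int n))"
    and f: "Vector_Spaces.linear scale (*) f" and g: "Vector_Spaces.linear scale (*) g"
    and f_rec: "\<And>k n v. k \<ge> 1 \<Longrightarrow> v \<in> sq_grade (int n) \<Longrightarrow>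
        f (bm (- int k) v) = (\<Sum>l=1..n. C1 k l / of_nat l * f (bm (int l) v))"
    and g_rec: "\<And>k n v. k \<ge> 1 \<Longrightarrow> v \<in> sq_grade (int n) \<Longrightarrow>
        g (bm (- int k) v) = (\<Sum>l=1..n. C2 k l / of_nat l * g (bm (int l) v))"
  defines "K \<equiv> \<lambda>n. \<Sum>u\<in>U n. f u * g (dual_vec B (U n) u)"
  shows "K 0 = f vac * g vac"
    and "of_nat n * K n = (\<Sum>ns\<in>pos_lists n. walk_weight C1 C2 (hd ns) ns * K (n - sum_list ns))"
proof -
  interpret f: Vector_Spaces.linear scale "(*)" f by fact
  interpret g: Vector_Spaces.linear scale "(*)" g by fact
  define x where "x n = (\<Sum>u\<in>U n. f u *s dual_vec B (U n) u)" for n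
  have x_grade: "x n \<in> sq_grade (int n)" for n
    unfolding x_def using dual_vec_props(1)[OF U]
    by (intro subspace_sum subspace_scale subspace_sq_grade) auto
  have x: "B v (x n) = f v" if "v \<in> sq_grade (int n)" for n v
    unfolding x_def using coherent_vector[OF U f that] .
  have K: "K n = g (x n)" for n
    by (simp add: K_def x_def g.sum g.scale)
  \<comment> \<open>Pairing a[l] x with w gives - f (a[-l] w). The recursion for \<open>f\<close>
    replaces a[-l] by annihilation modes a[p], and these return to the other argument as creation
    modes a[-p]; the two signs from invariance cancel.\<close>
  have x_ann: "bm (int l) (x n) = (\<Sum>p=1..n-l. (C1 l p / of_nat p) *s bm (- int p) (x (n - l - p)))"
    if l: "l \<ge> 1" "l \<le> n" for l n
  proof -
    have m: "bm (- int p) (x (n - l - p)) \<in> sq_grade (int (n - l))" if "p \<in> {1..n-l}" for p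
      using that by (intro sq_grade_create x_grade) auto
    have "bm (int l) (x n) - (\<Sum>p=1..n-l. (C1 l p / of_nat p) *s bm (- int p) (x (n - l - p))) = 0"
    proof (rule B_nondegenerate)
      show "bm (int l) (x n) - (\<Sum>p=1..n-l. (C1 l p / of_nat p) *s bm (- int p) (x (n - l - p))) \<in> sq_grade (int (n - l))"
        using l m by (intro subspace_diff subspace_sum subspace_scale subspace_sq_grade sq_grade_annihilate x_grade)
      fix w assume w: "w \<in> sq_grade (int (n - l))"
      have w': "bm (- int l) w \<in> sq_grade (int n)"
        using l by (intro sq_grade_create w) auto
      have "B w (bm (int l) (x n)) = - B (bm (- int l) w) (x n)"
        using B_bm[of "- int l" w] by simp
      also have "\<dots> = - (\<Sum>p=1..n-l. C1 l p / of_nat p * f (bm (int p) w))"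
        using x[OF w'] f_rec[OF l(1) w] by simp
      also have "\<dots> = (\<Sum>p=1..n-l. C1 l p / of_nat p * B w (bm (- int p) (x (n - l - p))))"
        unfolding sum_negf[symmetric]
      proof (intro sum.cong refl)
        fix p assume p: "p \<in> {1..n-l}"
        have pw: "bm (int p) w \<in> sq_grade (int (n - l - p))"
          using p by (intro sq_grade_annihilate w) auto
        show "- (C1 l p / of_nat p * f (bm (int p) w)) = C1 l p / of_nat p * B w (bm (- int p) (x (n - l - p)))"
        proof -
          have "f (bm (int p) w) = - B w (bm (- int p) (x (n - l - p)))"
            unfolding x[OF pw, symmetric] by (rule B_bm)
          then show ?thesis by (simp only: mult_minus_right minus_minus)
        qed
      qed
      finally show "B w (bm (int l) (x n) - (\<Sum>p=1..n-l. (C1 l p / of_nat p) *s bm (- int p) (x (n - l - p)))) = 0"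
        by (simp add: B_diff B_sum B_linear)
    qed
    then show ?thesis by simp
  qed
  define R where "R n k l = g (bm (- int k) (bm (int l) (x n)))" for n k l
  have nK: "of_nat n * K n = (\<Sum>k=1..n. R n k k)" for n
  proof -
    have "(\<Sum>k=1..n. R n k k) = g (\<Sum>k=1..n. bm (- int k) (bm (int k) (x n)))"
      by (simp add: R_def g.sum)
    then show ?thesis by (simp only: sum_bm_bm[OF x_grade] g.scale K)
  qed
  have R: "R n k l = (\<Sum>p=1..n-l. C1 l p / of_nat p *
       (C2 p k * K (n - l - p) + (\<Sum>m=1..n-l-p. C2 p m / of_nat m * R (n - l - p) k m)))"
    if k: "k \<ge> 1" and l: "l \<ge> 1" "l \<le> n" for n k l
  proof -
    have "R n k l = (\<Sum>p=1..n-l. C1 l p / of_nat p * g (bm (- int k) (bm (- int p) (x (n - l - p)))))"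
      unfolding R_def x_ann[OF l] by (simp add: bm_linear g.sum g.scale)
    also have "\<dots> = (\<Sum>p=1..n-l. C1 l p / of_nat p *
       (C2 p k * K (n - l - p) + (\<Sum>m=1..n-l-p. C2 p m / of_nat m * R (n - l - p) k m)))"
    proof (intro sum.cong refl arg_cong2[of _ _ _ _ "(*)"])
      fix p assume p: "p \<in> {1..n-l}"
      define n' where "n' = n - l - p"
      have k': "bm (- int k) (x n') \<in> sq_grade (int (n' + k))"
        by (intro sq_grade_create) (auto intro: x_grade)
      \<comment> \<open>Two creation modes commute, so the recursion for \<open>g\<close> can be
        applied to a[-p]. Moving a[m] past a[-k] then leaves the scalar m when m = k, which cancels
        the denominator and produces the term with \<open>C2 p k\<close>.\<close>
      have "g (bm (- int k) (bm (- int p) (x n'))) = g (bm (- int p) (bm (- int k) (x n')))"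
        using bm_commute[of "- int k" "- int p" "x n'"] k by simp
      also have "\<dots> = (\<Sum>m=1..n'+k. C2 p m / of_nat m * g (bm (int m) (bm (- int k) (x n'))))"
        using p by (intro g_rec k') auto
      also have "\<dots> = (\<Sum>m=1..n'+k. C2 p m / of_nat m * R n' k m +
          (if m = k then C2 p k * K n' else 0))"
        using k bm_commute[of "int _" "- int k" "x n'"]
        by (intro sum.cong) (auto simp: R_def g.add g.scale K distrib_left)
      also have "\<dots> = (\<Sum>m=1..n'+k. C2 p m / of_nat m * R n' k m) + C2 p k * K n'"
        using k by (simp add: sum.distrib sum.delta)
      also have "(\<Sum>m=1..n'+k. C2 p m / of_nat m * R n' k m) = (\<Sum>m=1..n'. C2 p m / of_nat m * R n' k m)"
        by (intro sum.mono_neutral_right) (auto simp: R_def sq_grade_bm_zero[OF x_grade] g.zero)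
      finally show "g (bm (- int k) (bm (- int p) (x (n - l - p)))) =
         C2 p k * K (n - l - p) + (\<Sum>m=1..n-l-p. C2 p m / of_nat m * R (n - l - p) k m)"
        by (simp add: n'_def add.commute)
    qed
    finally show ?thesis .
  qed
  show "of_nat n * K n = (\<Sum>ns\<in>pos_lists n. walk_weight C1 C2 (hd ns) ns * K (n - sum_list ns))"
    by (rule closed_walk_recursion[OF R nK])
  show "K 0 = f vac * g vac"
  proof -
    obtain c where c: "x 0 = c *s vac" using x_grade[of 0] by (auto simp: sq_grade_0 span_singleton)
    have "c = f vac" using x[of vac 0] vac_sq_grade by (simp add: c B_linear)
    then show ?thesis by (simp add: K c g.scale)
  qed
qed

end


section \<open>Zhu recursion for traces\<close>

text \<open>The series q^j / (1 - q^j), which appears when a mode of index j is cycled repeatedly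
  through a trace.\<close>

definition lambert :: "nat \<Rightarrow> complex fps" where
  "lambert j = fps_X ^ j * inverse (1 - fps_X ^ j)"

definition divisor_fps :: "nat \<Rightarrow> complex fps" where
  "divisor_fps p = Abs_fps (\<lambda>n. if n = 0 then 0 else of_nat (divisor_sum p n))"

text \<open>Cyclicity combined with a commutator yields an equation of this shape; it is solved by
  dividing by 1 - q^j.\<close>

lemma lambert_eqI:
  assumes "j \<ge> 1" "F = fps_X ^ j * (F + G)"
  shows "F = lambert j * G"
proof -
  have u: "(1 - fps_X ^ j :: complex fps) $ 0 \<noteq> 0" using assms(1) by simp
  have "F * (1 - fps_X ^ j) = fps_X ^ j * G"
    using assms(2) by (simp add: algebra_simps)
  then have "F * ((1 - fps_X ^ j) * inverse (1 - fps_X ^ j)) = fps_X ^ j * G * inverse (1 - fps_X ^ j)"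
    by (metis mult.assoc)
  moreover have "(1 - fps_X ^ j) * inverse (1 - fps_X ^ j) = (1 :: complex fps)"
    using u by (rule inverse_mult_eq_1')
  ultimately show ?thesis by (simp add: lambert_def mult_ac)
qed

lemma lambert_nth:
  assumes "j \<ge> 1"
  shows "lambert j $ n = (if n > 0 \<and> j dvd n then 1 else 0)"
proof -
  define F where "F = Abs_fps (\<lambda>n. if n > 0 \<and> j dvd n then 1 else 0 :: complex)"
  have "F = fps_X ^ j * (F + 1)"
  proof (rule fps_ext)
    fix n
    show "F $ n = (fps_X ^ j * (F + 1)) $ n"
    proof (cases "n < j")
      case True
      then show ?thesis by (auto simp: F_def fps_X_power_mult_nth dest: dvd_imp_le)
    next
      case False
      then show ?thesis using assms by (auto simp: F_def fps_X_power_mult_nth dvd_minus_self)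
    qed
  qed
  then have "F = lambert j * 1" using assms by (intro lambert_eqI)
  then have "lambert j = F" by simp
  then show ?thesis by (simp add: F_def)
qed

lemma lambert_mult_nth_zero: "j \<ge> 1 \<Longrightarrow> n < j \<Longrightarrow> (lambert j * G) $ n = 0"
  unfolding fps_mult_nth by (intro sum.neutral) (auto simp: lambert_nth dest: dvd_imp_le)

text \<open>Lambert's identity for divisor sums. The sum over j can stop at n because the series of
  index j starts at q^j.\<close>

lemma sum_lambert_mult:
  "(\<Sum>j=1..n. of_nat j ^ p * (lambert j * G) $ n) = (divisor_fps p * G) $ n"
proof -
  have d: "divisor_fps p $ i = (\<Sum>j=1..n. of_nat j ^ p * lambert j $ i)" if "i \<le> n" for i
  proof (cases "i = 0")
    case False
    have d: "1 \<le> x \<and> x \<le> n" if "x dvd i" for x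
      using dvd_imp_le[OF that] dvd_pos_nat[OF _ that] False \<open>i \<le> n\<close> by auto
    have "(\<Sum>j=1..n. of_nat j ^ p * lambert j $ i) = (\<Sum>j\<in>{j. j dvd i}. of_nat j ^ p :: complex)"
      using False
      by (intro sum.mono_neutral_cong_right) (auto simp: lambert_nth dest: d)
    then show ?thesis using False by (simp add: divisor_fps_def divisor_sum_def)
  qed (simp add: divisor_fps_def lambert_nth)
  have "(divisor_fps p * G) $ n = (\<Sum>i=0..n. (\<Sum>j=1..n. of_nat j ^ p * lambert j $ i) * G $ (n - i))"
    unfolding fps_mult_nth by (intro sum.cong) (auto simp: d)
  also have "\<dots> = (\<Sum>j=1..n. of_nat j ^ p * (lambert j * G) $ n)"
    unfolding fps_mult_nth sum_distrib_left sum_distrib_right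
    by (subst sum.swap) (simp add: mult_ac)
  finally show ?thesis ..
qed

definition Eis_fps :: "nat \<Rightarrow> complex fps" where
  "Eis_fps p = (if odd p then 0
     else fps_const (- bernoulli p / fact p) + fps_const (2 / fact (p - 1)) * divisor_fps (p - 1))"

definition C_fps :: "nat \<Rightarrow> nat \<Rightarrow> complex fps" where
  "C_fps k l = fps_const ((- 1) ^ (k + 1) * (fact (k + l - 1) / (fact (k - 1) * fact (l - 1)))) * Eis_fps (k + l)"

context heisenberg_voa
begin

text \<open>The one-point function as a formal series in q, so that the recursions can be proved
  before convergence is known. No negative powers are needed because the graded pieces of negative
  degree are trivial.\<close>

definition trace_fps :: "'v \<Rightarrow> complex fps" where
  "trace_fps v = Abs_fps (\<lambda>n. trace_on (grade (int n)) (zero_mode v))"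

lemma trace_fps_add: "trace_fps (u + v) = trace_fps u + trace_fps v"
  unfolding trace_fps_def
  by (rule fps_ext) (simp add: zero_mode_add_left trace_add grade_zero_mode cong: trace_cong)

lemma trace_fps_scale: "trace_fps (x *s v) = fps_const x * trace_fps v"
  unfolding trace_fps_def
  by (rule fps_ext) (simp add: zero_mode_scale_left trace_scale grade_zero_mode cong: trace_cong)

lemma trace_fps_zero [simp]: "trace_fps 0 = 0"
  using trace_fps_scale[of 0 0] by simp

lemma trace_fps_sum: "trace_fps (\<Sum>i\<in>A. f i) = (\<Sum>i\<in>A. trace_fps (f i))"
  by (induction A rule: infinite_finite_induct) (auto simp: trace_fps_add)

lemma trace_negative: "n < 0 \<Longrightarrow> (\<And>w. w \<in> grade n \<Longrightarrow> f w \<in> grade n) \<Longrightarrow> trace_on (grade n) f = 0"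
proof -
  assume n: "n < 0" and f: "\<And>w. w \<in> grade n \<Longrightarrow> f w \<in> grade n"
  have "trace_on (grade n) f = trace_on (grade n) (\<lambda>_. 0)"
    by (rule trace_cong) (use f grade_negative[OF n] in auto)
  then show ?thesis by (simp only: trace_zero)
qed

section \<open>Cycling a mode through the trace of a homogeneous vector\<close>

context
  fixes v :: 'v and h :: int and M :: nat
  assumes v: "v \<in> grade h" and M: "\<And>m. m > int M \<Longrightarrow> am m v = 0"
begin

text \<open>The two orders of a product of a(j) with the mode of \<open>v\<close> of opposite
  degree: the index h - 1 - j makes the product preserve the grading.\<close>

definition trA :: "int \<Rightarrow> int \<Rightarrow> complex" where
  "trA j n = trace_on (grade n) (\<lambda>w. am j (Y v (h - 1 - j) w))"

definition trD :: "int \<Rightarrow> int \<Rightarrow> complex" where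
  "trD j n = trace_on (grade n) (\<lambda>w. Y v (h - 1 - j) (am j w))"

text \<open>The state whose zero mode is the commutator of a(j) with the complementary mode of
  \<open>v\<close>.\<close>

definition comm_state :: "int \<Rightarrow> 'v" where
  "comm_state j = (\<Sum>i\<le>M. (of_int j gchoose i) *s am (int i) v)"

lemma trA_grade: "w \<in> grade n \<Longrightarrow> am j (Y v (h - 1 - j) w) \<in> grade n"
  using grade_am[of "Y v (h - 1 - j) w" "n + j" j] grade_mode[OF v, of w n "h - 1 - j"]
  by (simp add: algebra_simps)

lemma trD_grade: "w \<in> grade n \<Longrightarrow> Y v (h - 1 - j) (am j w) \<in> grade n"
  using grade_am[of w n j] grade_mode[OF v, of "am j w" "n - j" "h - 1 - j"]
  by (simp add: algebra_simps)

lemma trA_minus_trD: "trA j (int n) - trD j (int n) = trace_fps (comm_state j) $ n"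
proof -
  have "am j (Y v (h - 1 - j) w) - Y v (h - 1 - j) (am j w) = zero_mode (comm_state j) w" for w
  proof -
    have "am j (Y v (h - 1 - j) w) - Y v (h - 1 - j) (am j w) =
       (\<Sum>i\<le>M. (of_int j gchoose i) *s Y (am (int i) v) (j + (h - 1 - j) - int i) w)"
      unfolding mode_commutator by (rule Sum_any_atMost) (simp add: M)
    also have "\<dots> = zero_mode (comm_state j) w"
      unfolding comm_state_def zero_mode_sum_left zero_mode_scale_left
      by (intro sum.cong refl) (simp add: zero_mode_homogeneous[OF grade_am[OF v]] algebra_simps)
    finally show ?thesis .
  qed
  then show ?thesis
    unfolding trA_def trD_def trace_fps_def
    by (simp add: trace_diff[symmetric] trA_grade trD_grade)
qed

lemma trA_eq_trD: "trA j n = trD j (n + j)"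
  unfolding trA_def trD_def
proof (rule trace_cyclic)
  show "am j w \<in> grade n" if "w \<in> grade (n + j)" for w
    using grade_am[OF that, of j] by simp
  show "Y v (h - 1 - j) w \<in> grade (n + j)" if "w \<in> grade n" for w
    using grade_mode[OF v that, of "h - 1 - j"] by (simp add: algebra_simps)
qed (rule linear_mode)+

lemma trA_negative: "n < 0 \<Longrightarrow> trA j n = 0" and trD_negative: "n < 0 \<Longrightarrow> trD j n = 0"
  unfolding trA_def trD_def by (auto intro!: trace_negative trA_grade trD_grade)

text \<open>Cyclicity expresses the trace in degree n by the other order in degree n - j, and the
  commutator restores the first order. The resulting equation F = q^j (F + G) needs j > 0; for
  negative indices the roles of the two orders are exchanged.\<close>

lemma trD_positive: 
  assumes "j \<ge> 1"
  shows "trD (int j) (int n) = (lambert j * trace_fps (comm_state (int j))) $ n"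
proof -
  define F where "F = Abs_fps (\<lambda>n. trD (int j) (int n))"
  have "F = fps_X ^ j * (F + trace_fps (comm_state (int j)))"
  proof (rule fps_ext)
    fix n
    have "trD (int j) (int n) = trA (int j) (int n - int j)" by (simp add: trA_eq_trD)
    also have "\<dots> = (if n < j then 0 else trD (int j) (int (n - j)) + trace_fps (comm_state (int j)) $ (n - j))"
      using trA_minus_trD[of "int j" "n - j"] by (auto simp: trA_negative of_nat_diff not_less algebra_simps)
    finally show "F $ n = (fps_X ^ j * (F + trace_fps (comm_state (int j)))) $ n"
      by (simp add: F_def fps_X_power_mult_nth)
  qed
  then have "F = lambert j * trace_fps (comm_state (int j))" by (rule lambert_eqI[OF assms])
  then show ?thesis by (metis F_def fps_nth_Abs_fps)
qed

lemma trA_negative_index: 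
  assumes "j \<ge> 1"
  shows "trA (- int j) (int n) = - (lambert j * trace_fps (comm_state (- int j))) $ n"
proof -
  define F where "F = Abs_fps (\<lambda>n. trA (- int j) (int n))"
  have "F = fps_X ^ j * (F + (- trace_fps (comm_state (- int j))))"
  proof (rule fps_ext)
    fix n
    have "trA (- int j) (int n) = trD (- int j) (int n - int j)" by (simp add: trA_eq_trD)
    also have "\<dots> = (if n < j then 0 else trA (- int j) (int (n - j)) - trace_fps (comm_state (- int j)) $ (n - j))"
      using trA_minus_trD[of "- int j" "n - j"] by (auto simp: trD_negative of_nat_diff not_less algebra_simps)
    finally show "F $ n = (fps_X ^ j * (F + (- trace_fps (comm_state (- int j))))) $ n"
      by (simp add: F_def fps_X_power_mult_nth)
  qed
  then have "F = lambert j * (- trace_fps (comm_state (- int j)))" by (rule lambert_eqI[OF assms])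
  then have "F $ n = - (lambert j * trace_fps (comm_state (- int j))) $ n" by simp
  then show ?thesis by (simp add: F_def)
qed

text \<open>The iterate formula writes the zero mode of a(-s) v with modes a(-s-i) on the left and
  a(i) on the right of modes of \<open>v\<close>. On degree n only i up to n can contribute, and
  each trace has already been evaluated by cyclicity.\<close>

lemma trace_creation:
  assumes s: "s \<ge> 1"
  shows "trace_fps (am (- int s) v) $ n =
    - (\<Sum>j=1..n. of_nat ((j - 1) choose (s - 1)) * (lambert j * trace_fps (comm_state (- int j))) $ n)
    - (- 1) ^ s * (\<Sum>j=1..n. of_nat ((s + j - 1) choose (s - 1)) * (lambert j * trace_fps (comm_state (int j))) $ n)"
proof -
  define c where "c i = (- 1) ^ i * (of_int (- int s) gchoose i :: complex)" for i
  have c: "c i = of_nat ((s + i - 1) choose (s - 1))" for i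
  proof -
    have "(of_int (- int s) gchoose i :: complex) = (- 1) ^ i * ((of_nat s + of_nat i - 1) gchoose i)"
      using gbinomial_minus[of "of_nat s :: complex" i] by simp
    also have "of_nat s + of_nat i - 1 = (of_nat (s + i - 1) :: complex)"
      using s by (simp add: of_nat_diff)
    also have "(of_nat (s + i - 1) gchoose i :: complex) = of_nat ((s + i - 1) choose i)"
      by (rule binomial_gbinomial[symmetric])
    also have "(s + i - 1) choose i = (s + i - 1) choose (s - 1)"
      using s by (subst binomial_symmetric) auto
    finally show ?thesis unfolding c_def by (simp flip: mult.assoc power_add)
  qed
  have z: "zero_mode (am (- int s) v) w = (\<Sum>i\<le>n. c i *s
      (am (- int (s + i)) (Y v (h - 1 - (- int (s + i))) w) - (- 1) ^ s *s Y v (h - 1 - int i) (am (int i) w)))"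
    if w: "w \<in> grade (int n)" for w
  proof -
    have "zero_mode (am (- int s) v) w = Y (am (- int s) v) (h + int s - 1) w"
      by (subst zero_mode_homogeneous[OF grade_am[OF v]]) simp
    also have "\<dots> = (\<Sum>i\<le>n. ((- 1) ^ i * ((of_int (- int s) :: complex) gchoose i)) *s
         (am (- int s - int i) (Y v (h + int s - 1 + int i) w)
          - (- 1) powi (- int s) *s Y v (h + int s - 1 + (- int s) - int i) (am (int i) w)))"
      unfolding mode_iterate
    proof (rule Sum_any_atMost)
      fix i assume i: "i > n"
      have "am (int i) w = 0"
        using grade_am[OF w, of "int i"] grade_negative[of "int n - int i"] i by auto
      moreover have "Y v (h + int s - 1 + int i) w = 0"
        using grade_mode[OF v w, of "h + int s - 1 + int i"] grade_negative[of "int n - int s - int i"] i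
        by (auto simp: algebra_simps)
      ultimately show "((- 1) ^ i * ((of_int (- int s) :: complex) gchoose i)) *s
         (am (- int s - int i) (Y v (h + int s - 1 + int i) w)
          - (- 1) powi (- int s) *s Y v (h + int s - 1 + (- int s) - int i) (am (int i) w)) = 0"
        by simp
    qed
    also have "(- 1) powi (- int s) = (- 1 :: complex) ^ s"
      by (cases "even s") (auto simp: power_int_minus)
    moreover have "- int s - int i = - int (s + i)" "h + int s - 1 + int i = h - 1 - (- int (s + i))"
      "h + int s - 1 + (- int s) - int i = h - 1 - int i" for i by auto
    ultimately show ?thesis by (simp only: c_def)
  qed
  \<comment> \<open>The term i = 0 must drop out because cyclicity gives no information about it; it
    does so since a(0) = 0.\<close>
  have D0: "trD 0 m = 0" for m
    by (simp add: trD_def)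
  have "trace_fps (am (- int s) v) $ n =
     (\<Sum>i\<le>n. c i * (trA (- int (s + i)) (int n) - (- 1) ^ s * trD (int i) (int n)))"
  proof -
    have "trace_fps (am (- int s) v) $ n = trace_on (grade (int n)) (\<lambda>w. \<Sum>i\<le>n. c i *s
      (am (- int (s + i)) (Y v (h - 1 - (- int (s + i))) w) - (- 1) ^ s *s Y v (h - 1 - int i) (am (int i) w)))"
      unfolding trace_fps_def fps_nth_Abs_fps by (rule trace_cong) (rule z)
    also have "\<dots> = (\<Sum>i\<le>n. c i * (trA (- int (s + i)) (int n) - (- 1) ^ s * trD (int i) (int n)))"
      unfolding trA_def trD_def
      by (subst trace_sum, intro subspace_scale subspace_diff subspace_grade trA_grade trD_grade, assumption+,
          intro sum.cong refl,
          subst trace_scale, intro subspace_scale subspace_diff subspace_grade trA_grade trD_grade, assumption+,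
          subst trace_diff, intro trA_grade, assumption, intro subspace_scale subspace_grade trD_grade, assumption,
          subst trace_scale, intro trD_grade, assumption, rule refl)
    finally show ?thesis .
  qed
  also have "\<dots> = (\<Sum>i\<le>n. c i * trA (- int (s + i)) (int n)) - (- 1) ^ s * (\<Sum>i\<le>n. c i * trD (int i) (int n))"
    by (simp add: right_diff_distrib sum_subtractf sum_distrib_left mult_ac)
  also have "(\<Sum>i\<le>n. c i * trD (int i) (int n)) = (\<Sum>j=1..n. c j * trD (int j) (int n))"
    by (intro sum.mono_neutral_right) (auto simp: D0 not_le)
  also have "\<dots> = (\<Sum>j=1..n. of_nat ((s + j - 1) choose (s - 1)) * (lambert j * trace_fps (comm_state (int j))) $ n)"
    by (intro sum.cong) (auto simp: c trD_positive)
  also have "(\<Sum>i\<le>n. c i * trA (- int (s + i)) (int n)) =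
     - (\<Sum>j=1..n. of_nat ((j - 1) choose (s - 1)) * (lambert j * trace_fps (comm_state (- int j))) $ n)"
  proof -
    let ?g = "\<lambda>j. of_nat ((j - 1) choose (s - 1)) * (lambert j * trace_fps (comm_state (- int j))) $ n"
    have "(\<Sum>i\<le>n. c i * trA (- int (s + i)) (int n)) = (\<Sum>i\<le>n. - ?g (s + i))"
      using s by (intro sum.cong refl) (simp add: c trA_negative_index del: of_nat_add)
    also have "\<dots> = (\<Sum>j\<in>{s..s+n}. - ?g j)"
      by (rule sum.reindex_bij_witness[where i = "\<lambda>j. j - s" and j = "\<lambda>i. s + i"]) auto
    \<comment> \<open>The range of j = s + i becomes 1..n: the binomial coefficient vanishes for j <
      s, and the Lambert series of index j starts at q^j.\<close>
    also have "\<dots> = (\<Sum>j\<in>{1..s+n}. - ?g j)"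
      using s by (intro sum.mono_neutral_left) (auto simp: binomial_eq_0)
    also have "\<dots> = (\<Sum>j\<in>{1..n}. - ?g j)"
      by (intro sum.mono_neutral_right) (auto simp: lambert_mult_nth_zero)
    finally show ?thesis by (simp add: sum_negf)
  qed
  finally show ?thesis .
qed

lemma am_eq_bm_nat: "am (int i) v = (\<Sum>l\<le>M. ((em1 ^ i) $$ int l) *s bm (int l) v)"
proof -
  have "am (int i) v = (\<Sum>l\<in>{int i..int M}. ((em1 powi int i) $$ l) *s bm l v)"
    by (rule am_eq_bm) (rule M)
  also have "\<dots> = (\<Sum>l\<in>{i..M}. ((em1 ^ i) $$ int l) *s bm (int l) v)"
    by (rule sum.reindex_bij_witness[where i = int and j = nat]) auto
  also have "\<dots> = (\<Sum>l\<le>M. ((em1 ^ i) $$ int l) *s bm (int l) v)"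
    using em1_powi_nth_below[of "int _" "int i"]
    by (intro sum.mono_neutral_left) (auto simp: not_le)
  finally show ?thesis .
qed

text \<open>In square bracket modes the binomial coefficients become the coefficients j^l / l! of
  exp (j z). These powers of j are what later sums up to divisor functions.\<close>

lemma comm_state_eq_bm: "comm_state j = (\<Sum>l\<le>M. (of_int j ^ l / fact l) *s bm (int l) v)"
proof -
  have "comm_state j = (\<Sum>l\<le>M. \<Sum>i\<le>M. ((of_int j gchoose i) * (em1 ^ i) $$ int l) *s bm (int l) v)"
    unfolding comm_state_def am_eq_bm_nat scale_sum_right by (subst sum.swap) simp
  also have "\<dots> = (\<Sum>l\<le>M. (\<Sum>i\<le>M. (of_int j gchoose i) * (em1 ^ i) $$ int l) *s bm (int l) v)"
    by (simp add: scale_sum_left)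
  also have "\<dots> = (\<Sum>l\<le>M. (of_int j ^ l / fact l) *s bm (int l) v)"
    by (intro sum.cong refl) (subst sum_gchoose_em1, auto)
  finally show ?thesis .
qed

lemma trace_fps_comm_state_nth:
  "(G * trace_fps (comm_state j)) $ n = (\<Sum>l\<le>M. of_int j ^ l / fact l * (G * trace_fps (bm (int l) v)) $ n)"
proof -
  have "G * trace_fps (comm_state j) = (\<Sum>l\<le>M. fps_const (of_int j ^ l / fact l) * (G * trace_fps (bm (int l) v)))"
    by (simp add: comm_state_eq_bm trace_fps_sum trace_fps_scale sum_distrib_left mult_ac)
  then show ?thesis by (simp add: fps_sum_nth)
qed

text \<open>The expansion of a[-k] in ordinary modes has two parts. The modes a(m) with m at least 0
  yield the Bernoulli constants of the Eisenstein series, the creation modes a(-s) yield the divisor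
  sums.\<close>

lemma trace_bm_homogeneous:
  assumes k: "k \<ge> 1"
  shows "trace_fps (bm (- int k) v) = (\<Sum>l=1..M. fps_const (1 / of_nat l) * C_fps k l * trace_fps (bm (int l) v))"
proof (rule fps_ext)
  fix n
  let ?T = "\<lambda>l. trace_fps (bm (int l) v)"
  define t where "t s = tc (- int s) (- int k)" for s
  have t: "t s = (fls_ex * em1 ^ (s - 1)) $$ int (k - 1)" if "s \<ge> 1" for s
  proof -
    have "- (- int s) - 1 = int (s - 1)" "- (- int k) - 1 = int (k - 1)" using that k by auto
    then show ?thesis unfolding t_def sq_coeff_1 by (simp only: power_int_of_nat)
  qed
  have split: "bm (- int k) v = (\<Sum>m\<le>M. tc (int m) (- int k) *s am (int m) v) + (\<Sum>s=1..k. t s *s am (- int s) v)"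
  proof -
    have "bm (- int k) v = (\<Sum>m\<in>{- int k..int M}. tc m (- int k) *s am m v)"
      by (rule bm_eq) (rule M)
    also have "{- int k..int M} = int ` {..M} \<union> (\<lambda>s. - int s) ` {1..k}"
    proof (intro equalityI subsetI)
      fix m assume m: "m \<in> {- int k..int M}"
      show "m \<in> int ` {..M} \<union> (\<lambda>s. - int s) ` {1..k}"
      proof (cases "m \<ge> 0")
        case True
        then show ?thesis using m by (intro UnI1 image_eqI[of _ _ "nat m"]) auto
      next
        case False
        then show ?thesis using m by (intro UnI2 image_eqI[of _ _ "nat (- m)"]) auto
      qed
    qed auto
    also have "(\<Sum>m\<in>\<dots>. tc m (- int k) *s am m v) = (\<Sum>m\<in>int ` {..M}. tc m (- int k) *s am m v) + (\<Sum>m\<in>(\<lambda>s. - int s) ` {1..k}. tc m (- int k) *s am m v)"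
      by (rule sum.union_disjoint) auto
    finally show ?thesis by (simp add: sum.reindex inj_on_def t_def)
  qed
  have first: "trace_fps (\<Sum>m\<le>M. tc (int m) (- int k) *s am (int m) v) $ n =
    (\<Sum>l=1..M. (if odd (k + l) then 0
     else (- 1) ^ l * (fact (k + l - 1) / (fact (k - 1) * fact l)) * (bernoulli (k + l) / fact (k + l))) * ?T l $ n)"
  proof -
    have "(\<Sum>m\<le>M. tc (int m) (- int k) *s am (int m) v) =
       (\<Sum>l\<le>M. (\<Sum>m\<le>M. tc (int m) (- int k) * (em1 ^ m) $$ int l) *s bm (int l) v)"
      unfolding am_eq_bm_nat scale_sum_right scale_sum_left by (subst sum.swap) simp
    also have "\<dots> = (\<Sum>l=1..M. (\<Sum>m\<le>M. tc (int m) (- int k) * (em1 ^ m) $$ int l) *s bm (int l) v)"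
      by (intro sum.mono_neutral_right) (auto simp: not_le)
    also have "\<dots> = (\<Sum>l=1..M. (if odd (k + l) then 0
     else (- 1) ^ l * (fact (k + l - 1) / (fact (k - 1) * fact l)) * (bernoulli (k + l) / fact (k + l))) *s bm (int l) v)"
    proof (intro sum.cong refl arg_cong2[of _ _ _ _ scale])
      fix l assume l: "l \<in> {1..M}"
      have "(\<Sum>m\<le>M. tc (int m) (- int k) * (em1 ^ m) $$ int l) =
         (\<Sum>m\<le>l. (fls_ex * em1 powi (- int m - 1)) $$ (int k - 1) * (em1 ^ m) $$ int l)"
        unfolding sq_coeff_1 using l em1_powi_nth_below[of "int l" "int _"]
        by (intro sum.mono_neutral_cong_right) (auto simp: not_le)
      then show "(\<Sum>m\<le>M. tc (int m) (- int k) * (em1 ^ m) $$ int l) = (if odd (k + l) then 0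
     else (- 1) ^ l * (fact (k + l - 1) / (fact (k - 1) * fact l)) * (bernoulli (k + l) / fact (k + l)))"
        using sum_em1_bernoulli[OF k, of l] l by simp
    qed
    finally show ?thesis by (simp add: trace_fps_sum trace_fps_scale fps_sum_nth)
  qed
  \<comment> \<open>Summed against the coefficients of a[-k], the binomials form a coefficient of
    exp z (1 + (exp z - 1))^(j - 1) = exp (j z).\<close>
  have chs: "(\<Sum>s=1..k. t s * (of_int (j - 1) gchoose (s - 1))) = of_int j ^ (k - 1) / fact (k - 1)" for j
  proof -
    have "(\<Sum>s=1..k. t s * (of_int (j - 1) gchoose (s - 1))) =
      (\<Sum>i\<le>k-1. (of_int (j - 1) gchoose i) * (fls_ex * em1 ^ i) $$ int (k - 1))"
      using k by (intro sum.reindex_bij_witness[where i = Suc and j = "\<lambda>s. s - 1"]) (auto simp: t)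
    then show ?thesis by (simp add: sum_gchoose_ex_em1 del: of_int_diff)
  qed
  have second: "trace_fps (\<Sum>s=1..k. t s *s am (- int s) v) $ n =
     (\<Sum>l=1..M. (if odd (k + l) then 0 else (- 1) ^ (k + 1) * 2 / (fact l * fact (k - 1))) * (divisor_fps (k + l - 1) * ?T l) $ n)"
  proof -
    let ?L = "\<lambda>j i. (lambert j * trace_fps (comm_state i)) $ n"
    have "trace_fps (\<Sum>s=1..k. t s *s am (- int s) v) $ n = (\<Sum>s=1..k. t s *
      (- (\<Sum>j=1..n. of_nat ((j - 1) choose (s - 1)) * ?L j (- int j))
       - (- 1) ^ s * (\<Sum>j=1..n. of_nat ((s + j - 1) choose (s - 1)) * ?L j (int j))))"
      unfolding trace_fps_sum trace_fps_scale fps_sum_nth fps_mult_left_const_nth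
      by (intro sum.cong refl) (simp add: trace_creation)
    also have "\<dots> = (\<Sum>s=1..k. \<Sum>j=1..n. t s * (of_int (- int j - 1) gchoose (s - 1)) * ?L j (int j)
       - t s * (of_int (int j - 1) gchoose (s - 1)) * ?L j (- int j))"
    proof (intro sum.cong refl)
      fix s assume s: "s \<in> {1..k}"
      \<comment> \<open>Both families of binomials are values of one generalised binomial
        coefficient, at j - 1 and at - j - 1, so that \<open>chs\<close> applies to j and to -
        j.\<close>
      have 1: "(of_int (int j - 1) gchoose (s - 1) :: complex) = of_nat ((j - 1) choose (s - 1))" if "j \<ge> 1" for j
        using that by (simp add: binomial_gbinomial of_nat_diff)
      have 2: "(of_int (- int j - 1) gchoose (s - 1) :: complex) = - ((- 1) ^ s * of_nat ((s + j - 1) choose (s - 1)))" for j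
      proof -
        have "(of_int (- int j - 1) gchoose (s - 1) :: complex) = (- of_nat (j + 1)) gchoose (s - 1)"
          by (rule arg_cong2[of _ _ _ _ "(gchoose)"]) auto
        also have "\<dots> = (- 1) ^ (s - 1) * ((of_nat (j + 1) + of_nat (s - 1) - 1) gchoose (s - 1))"
          by (rule gbinomial_minus)
        also have "of_nat (j + 1) + of_nat (s - 1) - 1 = (of_nat (s + j - 1) :: complex)"
          using s by (simp add: of_nat_diff)
        also have "(- 1 :: complex) ^ (s - 1) = - ((- 1) ^ s)"
          using s by (cases s) auto
        finally show ?thesis by (simp add: binomial_gbinomial)
      qed
      have "(\<Sum>j=1..n. t s * (of_int (- int j - 1) gchoose (s - 1)) * ?L j (int j)
         - t s * (of_int (int j - 1) gchoose (s - 1)) * ?L j (- int j)) =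
        (\<Sum>j=1..n. t s * (- ((- 1) ^ s * of_nat ((s + j - 1) choose (s - 1)))) * ?L j (int j)
         - t s * of_nat ((j - 1) choose (s - 1)) * ?L j (- int j))"
        by (intro sum.cong refl) (subst 1, simp, subst 2, simp)
      then show "t s * (- (\<Sum>j=1..n. of_nat ((j - 1) choose (s - 1)) * ?L j (- int j))
       - (- 1) ^ s * (\<Sum>j=1..n. of_nat ((s + j - 1) choose (s - 1)) * ?L j (int j))) =
       (\<Sum>j=1..n. t s * (of_int (- int j - 1) gchoose (s - 1)) * ?L j (int j)
         - t s * (of_int (int j - 1) gchoose (s - 1)) * ?L j (- int j))"
        by (simp add: sum_subtractf sum_distrib_left sum_negf right_diff_distrib mult_ac)
    qed
    also have "\<dots> = (\<Sum>j=1..n. (\<Sum>s=1..k. t s * (of_int (- int j - 1) gchoose (s - 1))) * ?L j (int j)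
       - (\<Sum>s=1..k. t s * (of_int (int j - 1) gchoose (s - 1))) * ?L j (- int j))"
      by (subst sum.swap) (simp only: sum_subtractf sum_distrib_right)
    \<comment> \<open>The contributions of j and - j combine to (-1)^(k-1) - (-1)^l, which vanishes
      for odd k + l; this is the vanishing of the odd Eisenstein series.\<close>
    also have "\<dots> = (\<Sum>j=1..n. \<Sum>l\<le>M. (((- 1) ^ (k - 1) - (- 1) ^ l) / (fact l * fact (k - 1))) *
        (of_nat j ^ (k - 1 + l) * (lambert j * ?T l) $ n))"
      unfolding chs trace_fps_comm_state_nth sum_distrib_left sum_subtractf[symmetric]
    proof (intro sum.cong refl)
      fix j l
      have e: "of_int (- int j) ^ p = (- 1) ^ p * of_nat j ^ p" "of_int (int j) ^ p = (of_nat j ^ p :: complex)" for p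
        by (simp_all add: power_minus[of "of_nat j"])
      show "of_int (- int j) ^ (k - 1) / fact (k - 1) * (of_int (int j) ^ l / fact l * (lambert j * ?T l) $ n) -
         of_int (int j) ^ (k - 1) / fact (k - 1) * (of_int (- int j) ^ l / fact l * (lambert j * ?T l) $ n) =
         (((- 1) ^ (k - 1) - (- 1) ^ l) / (fact l * fact (k - 1))) *
        (of_nat j ^ (k - 1 + l) * (lambert j * ?T l) $ n)"
        unfolding e by (simp add: field_simps power_add)
    qed
    also have "\<dots> = (\<Sum>l\<le>M. (((- 1) ^ (k - 1) - (- 1) ^ l) / (fact l * fact (k - 1))) *
        (divisor_fps (k - 1 + l) * ?T l) $ n)"
      unfolding sum_lambert_mult[symmetric] sum_distrib_left by (rule sum.swap)
    also have "\<dots> = (\<Sum>l=1..M. (((- 1) ^ (k - 1) - (- 1) ^ l) / (fact l * fact (k - 1))) *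
        (divisor_fps (k - 1 + l) * ?T l) $ n)"
      by (intro sum.mono_neutral_right) (auto simp: not_le)
    also have "\<dots> = (\<Sum>l=1..M. (if odd (k + l) then 0 else (- 1) ^ (k + 1) * 2 / (fact l * fact (k - 1))) * (divisor_fps (k + l - 1) * ?T l) $ n)"
    proof (intro sum.cong refl)
      fix l assume "l \<in> {1..M}"
      have "((- 1) ^ (k - 1) - (- 1) ^ l :: complex) = (if odd (k + l) then 0 else (- 1) ^ (k + 1) * 2)"
        using k by (cases "even k"; cases "even l") auto
      moreover have "k - 1 + l = k + l - 1" using k by simp
      ultimately show "(((- 1) ^ (k - 1) - (- 1) ^ l) / (fact l * fact (k - 1))) * (divisor_fps (k - 1 + l) * ?T l) $ n =
         (if odd (k + l) then 0 else (- 1) ^ (k + 1) * 2 / (fact l * fact (k - 1))) * (divisor_fps (k + l - 1) * ?T l) $ n"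
        by simp
    qed
    finally show ?thesis .
  qed
  have "trace_fps (bm (- int k) v) $ n =
     trace_fps (\<Sum>m\<le>M. tc (int m) (- int k) *s am (int m) v) $ n + trace_fps (\<Sum>s=1..k. t s *s am (- int s) v) $ n"
    unfolding split trace_fps_add by simp
  also have "\<dots> = (\<Sum>l=1..M. (fps_const (1 / of_nat l) * C_fps k l * ?T l) $ n)"
    unfolding first second sum.distrib[symmetric]
  proof (intro sum.cong refl)
    fix l assume l: "l \<in> {1..M}"
    show "(if odd (k + l) then 0
     else (- 1) ^ l * (fact (k + l - 1) / (fact (k - 1) * fact l)) * (bernoulli (k + l) / fact (k + l))) * ?T l $ n +
     (if odd (k + l) then 0 else (- 1) ^ (k + 1) * 2 / (fact l * fact (k - 1))) * (divisor_fps (k + l - 1) * ?T l) $ n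
     = (fps_const (1 / of_nat l) * C_fps k l * ?T l) $ n"
    proof (cases "odd (k + l)")
      case False
      have fl: "(fact l :: complex) = of_nat l * fact (l - 1)" using l by (intro fact_reduce) auto
      have sg: "(- 1 :: complex) ^ l = - ((- 1) ^ (k + 1))" using False by (cases "even k") auto
      define x :: complex where "x = (- 1) ^ (k + 1)"
      define G where "G = fact (k + l - 1) / (fact (k - 1) * fact l :: complex)"
      have e: "fps_const (1 / of_nat l) * C_fps k l * ?T l =
         fps_const (x * G * (- bernoulli (k + l) / fact (k + l))) * ?T l +
         fps_const (x * G * (2 / fact (k + l - 1))) * (divisor_fps (k + l - 1) * ?T l)"
      proof -
        have "fps_const (1 / of_nat l) * fps_const (x * (fact (k + l - 1) / (fact (k - 1) * fact (l - 1)))) = fps_const (x * G)"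
          using l by (simp add: G_def fl field_simps)
        then have "fps_const (1 / of_nat l) * C_fps k l = fps_const (x * G) * Eis_fps (k + l)"
          unfolding C_fps_def x_def by (simp only: mult.assoc[symmetric])
        also have "\<dots> = fps_const (x * G * (- bernoulli (k + l) / fact (k + l))) +
           fps_const (x * G * (2 / fact (k + l - 1))) * divisor_fps (k + l - 1)"
        proof -
          have "Eis_fps (k + l) = fps_const (- bernoulli (k + l) / fact (k + l)) + fps_const (2 / fact (k + l - 1)) * divisor_fps (k + l - 1)"
            using False by (simp add: Eis_fps_def)
          then show ?thesis by (simp only: distrib_left fps_const_mult flip: mult.assoc)
        qed
        finally show ?thesis by (simp only: distrib_right mult.assoc)
      qed
      have "(- 1) ^ l * (fact (k + l - 1) / (fact (k - 1) * fact l)) * (bernoulli (k + l) / fact (k + l)) =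
          x * G * (- bernoulli (k + l) / fact (k + l))"
        unfolding sg x_def[symmetric] G_def[symmetric] by simp
      moreover have "(- 1) ^ (k + 1) * 2 / (fact l * fact (k - 1)) = x * G * (2 / fact (k + l - 1))"
        unfolding x_def[symmetric] by (simp add: G_def)
      ultimately show ?thesis
        using False unfolding e by (simp only: if_False fps_add_nth fps_mult_left_const_nth)
    qed (simp add: C_fps_def Eis_fps_def)
  qed
  finally show "trace_fps (bm (- int k) v) $ n = (\<Sum>l=1..M. fps_const (1 / of_nat l) * C_fps k l * ?T l) $ n"
    by (simp add: fps_sum_nth)
qed

end

text \<open>The formula is available for vectors homogeneous for L(0), whereas it is wanted for
  those homogeneous for L[0]. Linear extension needs a common upper limit of summation, hence the
  formulation with all large \<open>M\<close>.\<close>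

lemma trace_bm_eventually:
  assumes k: "k \<ge> 1"
  shows "\<exists>M0. \<forall>M\<ge>M0. trace_fps (bm (- int k) v) = (\<Sum>l=1..M. fps_const (1 / of_nat l) * C_fps k l * trace_fps (bm (int l) v))"
proof -
  have "v \<in> span (\<Union>n. grade n)" using graded by simp
  then show ?thesis
  proof (induction v rule: span_induct_alt)
    case (step c x y)
    then obtain h where h: "x \<in> grade h" by auto
    obtain N where N: "\<forall>m>N. am m x = 0" using mode_truncation[of a x] by blast
    obtain M0 where M0: "\<forall>M\<ge>M0. trace_fps (bm (- int k) y) = (\<Sum>l=1..M. fps_const (1 / of_nat l) * C_fps k l * trace_fps (bm (int l) y))"
      using step.IH by blast
    show ?case
    proof (intro exI allI impI)
      fix M assume M: "M \<ge> max M0 (nat N)"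
      have x: "trace_fps (bm (- int k) x) = (\<Sum>l=1..M. fps_const (1 / of_nat l) * C_fps k l * trace_fps (bm (int l) x))"
        using N M by (intro trace_bm_homogeneous[OF h _ k]) auto
      have "trace_fps (bm (- int k) y) = (\<Sum>l=1..M. fps_const (1 / of_nat l) * C_fps k l * trace_fps (bm (int l) y))"
        using M0 M by auto
      then show "trace_fps (bm (- int k) (c *s x + y)) = (\<Sum>l=1..M. fps_const (1 / of_nat l) * C_fps k l * trace_fps (bm (int l) (c *s x + y)))"
        using x by (simp add: bm_linear trace_fps_add trace_fps_scale distrib_left sum.distrib sum_distrib_left mult_ac)
    qed
  qed auto
qed

text \<open>On square bracket degree n the modes a[l] with l > n vanish, which fixes the upper
  limit.\<close>

lemma trace_bm:
  assumes "k \<ge> 1" "v \<in> sq_grade (int n)"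
  shows "trace_fps (bm (- int k) v) = (\<Sum>l=1..n. fps_const (1 / of_nat l) * C_fps k l * trace_fps (bm (int l) v))"
proof -
  obtain M0 where M0: "\<forall>M\<ge>M0. trace_fps (bm (- int k) v) = (\<Sum>l=1..M. fps_const (1 / of_nat l) * C_fps k l * trace_fps (bm (int l) v))"
    using trace_bm_eventually[OF assms(1)] by blast
  define M where "M = max M0 n"
  have "trace_fps (bm (- int k) v) = (\<Sum>l=1..M. fps_const (1 / of_nat l) * C_fps k l * trace_fps (bm (int l) v))"
    using M0 by (simp add: M_def)
  also have "\<dots> = (\<Sum>l=1..n. fps_const (1 / of_nat l) * C_fps k l * trace_fps (bm (int l) v))"
    by (intro sum.mono_neutral_right) (auto simp: M_def sq_grade_bm_zero[OF assms(2)])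
  finally show ?thesis .
qed

text \<open>The zero mode of a(-1) a = 2 conf is 2 L(0), which acts on degree n as 2 n, while the
  trace formula for a creation mode gives divisor sums. This is Euler's recursion for the partition
  numbers; it supplies the convergence of the vacuum trace.\<close>

lemma trace_vac_recursion:
  "of_nat n * trace_fps vac $ n = (divisor_fps 1 * trace_fps vac) $ n"
proof -
  have a1: "am m a = (if m = 1 then vac else 0)" if "m \<ge> 0" for m
    using am_commute[of m "-1" vac] that by (auto simp: creation)
  have M: "\<And>m. m > int 1 \<Longrightarrow> am m a = 0" using a1 by auto
  have comm_state: "comm_state a 1 j = of_int j *s vac" for j
    by (subst comm_state_def[where v = a and M = 1, OF a_weight M]) (simp_all add: a1)
  have L: "(G * trace_fps (of_int j *s vac)) $ n = of_int j * (G * trace_fps vac) $ n" for G j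
    unfolding trace_fps_scale mult.left_commute[of G] by (rule fps_mult_left_const_nth)
  have LC: "(G * trace_fps (comm_state a 1 j)) $ n = of_int j * (G * trace_fps vac) $ n" for G j
    by (simp only: comm_state L)
  have "trace_fps (am (- 1) a) $ n = 2 * (\<Sum>j=1..n. of_nat j * (lambert j * trace_fps vac) $ n)"
    using trace_creation[where v = a and M = 1 and s = 1 and n = n, OF a_weight M]
    by (simp add: LC[unfolded One_nat_def] sum_negf)
  also have "(\<Sum>j=1..n. of_nat j * (lambert j * trace_fps vac) $ n) = (divisor_fps 1 * trace_fps vac) $ n"
    using sum_lambert_mult[where p = 1 and n = n and G = "trace_fps vac"] by simp
  finally have 1: "trace_fps (am (- 1) a) $ n = 2 * (divisor_fps 1 * trace_fps vac) $ n" .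
  have "am (- 1) a = 2 *s conf"
    by (simp add: conf_eq creation)
  then have "trace_fps (am (- 1) a) $ n = 2 * trace_fps conf $ n"
    by (simp add: trace_fps_scale)
  also have "trace_fps conf $ n = of_nat n * trace_fps vac $ n"
  proof -
    have "zero_mode conf w = of_nat n *s zero_mode vac w" if "w \<in> grade (int n)" for w
      using that by (simp add: zero_mode_homogeneous[OF conf_weight] zero_mode_homogeneous[OF vac_weight]
          vacuum grade_def L_def)
    then have "trace_fps conf $ n = trace_on (grade (int n)) (\<lambda>w. of_nat n *s zero_mode vac w)"
      unfolding trace_fps_def fps_nth_Abs_fps by (intro trace_cong)
    also have "\<dots> = of_nat n * trace_fps vac $ n"
      by (simp add: trace_scale grade_zero_mode trace_fps_def)
    finally show ?thesis .
  qed
  finally show ?thesis using 1 by simp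
qed

end


section \<open>Convergence of one-point functions\<close>

lemma fps_conv_radius_ge_1I:
  fixes f :: "complex fps"
  assumes "\<And>r. 0 < r \<Longrightarrow> r < 1 \<Longrightarrow> \<exists>C. \<forall>n. norm (f $ n) * r ^ n \<le> C"
  shows "fps_conv_radius f \<ge> 1"
  unfolding fps_conv_radius_def
proof (rule conv_radius_geI_ex')
  fix r :: real assume r: "0 < r" "ereal r < 1"
  define s where "s = (r + 1) / 2"
  have s: "r < s" "s < 1" "0 < s" using r by (auto simp: s_def)
  obtain C where C: "\<forall>n. norm (f $ n) * s ^ n \<le> C" using assms[of s] s by auto
  show "summable (\<lambda>n. f $ n * of_real r ^ n)"
  proof (rule summable_comparison_test')
    show "summable (\<lambda>n. C * (r / s) ^ n)"
      using s r by (intro summable_mult summable_geometric) auto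
    fix n :: nat
    have "norm (f $ n * of_real r ^ n) = norm (f $ n) * s ^ n * (r / s) ^ n"
      using s r by (simp add: norm_mult norm_power power_divide)
    also have "\<dots> \<le> C * (r / s) ^ n"
      using C s r by (intro mult_right_mono) auto
    finally show "norm (f $ n * of_real r ^ n) \<le> C * (r / s) ^ n" .
  qed
qed

lemma fps_conv_radius_mult_ge_1:
  fixes f g :: "complex fps"
  shows "fps_conv_radius f \<ge> 1 \<Longrightarrow> fps_conv_radius g \<ge> 1 \<Longrightarrow> fps_conv_radius (f * g) \<ge> 1"
  using fps_conv_radius_mult[of f g] by (meson min.boundedI order_trans)

lemma fps_conv_radius_add_ge_1:
  fixes f g :: "complex fps"
  shows "fps_conv_radius f \<ge> 1 \<Longrightarrow> fps_conv_radius g \<ge> 1 \<Longrightarrow> fps_conv_radius (f + g) \<ge> 1"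
  using fps_conv_radius_add[of f g] by (meson min.boundedI order_trans)

lemma fps_conv_radius_sum_ge_1:
  fixes f :: "'a \<Rightarrow> complex fps"
  shows "(\<And>i. i \<in> A \<Longrightarrow> fps_conv_radius (f i) \<ge> 1) \<Longrightarrow> fps_conv_radius (\<Sum>i\<in>A. f i) \<ge> 1"
  by (induction A rule: infinite_finite_induct) (auto intro: fps_conv_radius_add_ge_1)

lemma fps_conv_radius_const_ge_1 [simp]: "fps_conv_radius (fps_const (c :: complex)) \<ge> 1"
  by simp

lemma norm_less_conv_radius:
  fixes f :: "complex fps"
  assumes "fps_conv_radius f \<ge> 1" "norm q < 1"
  shows "ereal (norm q) < fps_conv_radius f"
proof -
  have "ereal (norm q) < 1" using assms(2) by (simp add: one_ereal_def)
  then show ?thesis using assms(1) by (rule less_le_trans)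
qed

lemma eval_fps_add_1:
  fixes f g :: "complex fps"
  assumes "fps_conv_radius f \<ge> 1" "fps_conv_radius g \<ge> 1" "norm q < 1"
  shows "eval_fps (f + g) q = eval_fps f q + eval_fps g q"
  using assms by (intro eval_fps_add norm_less_conv_radius)

lemma eval_fps_sum:
  fixes f :: "'a \<Rightarrow> complex fps"
  assumes "\<And>i. i \<in> A \<Longrightarrow> fps_conv_radius (f i) \<ge> 1" "norm q < 1"
  shows "eval_fps (\<Sum>i\<in>A. f i) q = (\<Sum>i\<in>A. eval_fps (f i) q)"
  using assms(1)
proof (induction A rule: infinite_finite_induct)
  case (insert x F)
  have "1 \<le> fps_conv_radius (f x)" "1 \<le> fps_conv_radius (\<Sum>i\<in>F. f i)"
    using insert by (auto intro: fps_conv_radius_sum_ge_1)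
  then show ?case using insert assms(2) by (simp add: eval_fps_add_1)
qed auto

lemma eval_fps_mult_1:
  fixes f g :: "complex fps"
  assumes "fps_conv_radius f \<ge> 1" "fps_conv_radius g \<ge> 1" "norm q < 1"
  shows "eval_fps (f * g) q = eval_fps f q * eval_fps g q"
  using assms by (intro eval_fps_mult norm_less_conv_radius)

lemma eval_fps_const_mult:
  fixes f :: "complex fps"
  assumes "fps_conv_radius f \<ge> 1" "norm q < 1"
  shows "eval_fps (fps_const c * f) q = c * eval_fps f q"
  using eval_fps_mult_1[OF fps_conv_radius_const_ge_1[of c] assms] by simp

lemma divisor_sum_le: "n > 0 \<Longrightarrow> divisor_sum p n \<le> n ^ (p + 1)"
proof -
  assume n: "n > 0"
  have fin: "{d. d dvd n} \<subseteq> {1..n}" using n by (auto simp: Suc_le_eq intro: dvd_pos_nat dvd_imp_le)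
  have "divisor_sum p n \<le> (\<Sum>d\<in>{1..n}. n ^ p)"
    unfolding divisor_sum_def using fin
    by (intro order_trans[OF sum_mono2[OF _ fin]] sum_mono power_mono) auto
  then show ?thesis by simp
qed

lemma conv_radius_divisor_fps: "fps_conv_radius (divisor_fps p) \<ge> 1"
proof (rule fps_conv_radius_ge_1I)
  fix r :: real assume r: "0 < r" "r < 1"
  \<comment> \<open>With s the root of r of order p + 1, the bound n^(p+1) r^n is the power (n
    s^n)^(p+1) of a bounded sequence.\<close>
  define s where "s = root (p + 1) r"
  have s: "0 < s" "s < 1" "s ^ (p + 1) = r" using r by (auto simp: s_def simp del: power_Suc)
  have "(\<lambda>n. real n * s ^ n) \<longlonglongrightarrow> 0" using powser_times_n_limit_0[of s] s by simp
  then have "Bseq (\<lambda>n. real n * s ^ n)" by (intro convergent_imp_Bseq) (auto simp: convergent_def)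
  then obtain C where C: "C > 0" "\<forall>n. norm (real n * s ^ n) \<le> C" by (auto simp: Bseq_def)
  have "norm (divisor_fps p $ n) * r ^ n \<le> C ^ (p + 1)" for n
  proof (cases "n = 0")
    case False
    have "norm (divisor_fps p $ n) * r ^ n \<le> real (n ^ (p + 1)) * r ^ n"
      using False divisor_sum_le[of n p] r
      by (intro mult_right_mono) (auto simp: divisor_fps_def simp flip: of_nat_power simp del: power_Suc)
    also have "\<dots> = (real n * s ^ n) ^ (p + 1)"
      by (simp only: s(3)[symmetric] power_mult_distrib of_nat_power flip: power_mult) (simp add: mult.commute)
    also have "\<dots> \<le> C ^ (p + 1)"
      using C(2)[rule_format, of n] s by (intro power_mono) (auto simp: abs_mult)
    finally show ?thesis .
  qed (use C in \<open>simp add: divisor_fps_def\<close>)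
  then show "\<exists>C. \<forall>n. norm (divisor_fps p $ n) * r ^ n \<le> C" by blast
qed

lemma conv_radius_Eis_fps: "fps_conv_radius (Eis_fps p) \<ge> 1"
  unfolding Eis_fps_def
  by (auto intro!: fps_conv_radius_add_ge_1 fps_conv_radius_mult_ge_1 conv_radius_divisor_fps)

lemma conv_radius_C_fps: "fps_conv_radius (C_fps k l) \<ge> 1"
  unfolding C_fps_def
  by (auto intro!: fps_conv_radius_mult_ge_1 conv_radius_Eis_fps)

lemma norm_nome_less_1:
  assumes "Im \<tau> > 0"
  shows "norm (exp (2 * of_real pi * \<i> * \<tau>)) < 1"
  using assms by (simp add: norm_exp_eq_Re)

lemma eval_Eis_fps:
  assumes "Im \<tau> > 0"
  shows "eval_fps (Eis_fps p) (exp (2 * of_real pi * \<i> * \<tau>)) = Eis p \<tau>"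
proof (cases "odd p")
  case False
  define q where "q = exp (2 * of_real pi * \<i> * \<tau>)"
  have q: "norm q < 1" unfolding q_def by (rule norm_nome_less_1[OF assms])
  have "ereal (norm q) < fps_conv_radius (divisor_fps (p - 1))"
    by (rule norm_less_conv_radius[OF conv_radius_divisor_fps q])
  then have "summable (\<lambda>n. divisor_fps (p - 1) $ n * q ^ n)" by (rule summable_fps)
  from suminf_split_head[OF this]
  have "eval_fps (divisor_fps (p - 1)) q = suminf (\<lambda>n. of_nat (divisor_sum (p - 1) (Suc n)) * q ^ Suc n)"
    by (simp add: eval_fps_def divisor_fps_def)
  moreover have "eval_fps (Eis_fps p) q = - bernoulli p / fact p + 2 / fact (p - 1) * eval_fps (divisor_fps (p - 1)) q"
    using False q fps_conv_radius_mult_ge_1[OF fps_conv_radius_const_ge_1 conv_radius_divisor_fps]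
    by (simp add: Eis_fps_def eval_fps_add_1 eval_fps_const_mult conv_radius_divisor_fps)
  ultimately show ?thesis using False by (simp add: Eis_def q_def)
qed (simp add: Eis_fps_def Eis_def)

lemma eval_C_fps:
  assumes "Im \<tau> > 0"
  shows "eval_fps (C_fps k l) (exp (2 * of_real pi * \<i> * \<tau>)) = C_fun k l \<tau>"
  unfolding C_fps_def C_fun_def
  by (simp only: eval_fps_const_mult[OF conv_radius_Eis_fps norm_nome_less_1[OF assms]] eval_Eis_fps[OF assms])

context heisenberg_voa
begin

text \<open>With weights r^n the recursion bounds n d(n) by \<open>S\<close> times the maximum of
  the earlier terms, where \<open>S\<close> is the sum of the weighted divisor series. For n at
  least \<open>S\<close> no new maximum arises. The divisor series has no constant term, so only
  earlier terms enter.\<close>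

lemma conv_radius_trace_vac: "fps_conv_radius (trace_fps vac) \<ge> 1"
proof (rule fps_conv_radius_ge_1I)
  fix r :: real assume r: "0 < r" "r < 1"
  define d where "d n = norm (trace_fps vac $ n) * r ^ n" for n
  define w where "w i = norm (divisor_fps 1 $ i) * r ^ i" for i
  have "ereal (norm (of_real r :: complex)) < fps_conv_radius (divisor_fps 1)"
    using r by (intro norm_less_conv_radius conv_radius_divisor_fps) auto
  from norm_summable_fps[OF this] have w: "summable w"
    using r by (simp add: w_def[abs_def] norm_mult norm_power)
  have w0: "w i \<ge> 0" "w 0 = 0" for i using r by (auto simp: w_def divisor_fps_def)
  define S where "S = suminf w"
  obtain N where N: "S \<le> real N" using real_arch_simple by blast
  define C where "C = (\<Sum>n\<le>N. d n)"
  have d0: "d n \<ge> 0" for n using r by (simp add: d_def)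
  have "d n \<le> C" for n
  proof (induction n rule: less_induct)
    case (less n)
    show ?case
    proof (cases "n \<le> N")
      case True
      then show ?thesis unfolding C_def using d0 by (intro member_le_sum) auto
    next
      case False
      have C0: "C \<ge> 0" unfolding C_def by (intro sum_nonneg d0)
      have "real n * d n = norm (of_nat n * trace_fps vac $ n) * r ^ n"
        by (simp add: d_def norm_mult)
      also have "\<dots> = norm (\<Sum>i=0..n. divisor_fps 1 $ i * trace_fps vac $ (n - i)) * r ^ n"
        unfolding trace_vac_recursion fps_mult_nth ..
      also have "\<dots> \<le> (\<Sum>i=0..n. norm (divisor_fps 1 $ i * trace_fps vac $ (n - i))) * r ^ n"
        using r by (intro mult_right_mono norm_sum) auto
      also have "\<dots> = (\<Sum>i=0..n. w i * d (n - i))"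
        unfolding sum_distrib_right
        by (intro sum.cong) (auto simp: w_def d_def norm_mult simp flip: power_add)
      also have "\<dots> \<le> (\<Sum>i=0..n. w i * C)"
      proof (intro sum_mono)
        fix i assume "i \<in> {0..n}"
        show "w i * d (n - i) \<le> w i * C"
        proof (cases "i = 0")
          case False
          then show ?thesis using \<open>\<not> n \<le> N\<close> w0 by (intro mult_left_mono less.IH) auto
        qed (simp add: w0)
      qed
      also have "\<dots> = (\<Sum>i=0..n. w i) * C" by (simp add: sum_distrib_right)
      also have "\<dots> \<le> S * C"
        unfolding S_def using w w0 C0 by (intro mult_right_mono sum_le_suminf) auto
      also have "\<dots> \<le> real n * C" using N False C0 by (intro mult_right_mono) auto
      finally show ?thesis using False by simp
    qed
  qed
  then show "\<exists>C. \<forall>n. norm (trace_fps vac $ n) * r ^ n \<le> C"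
    unfolding d_def by blast
qed

text \<open>The Euler identity and Zhu's recursion express the trace of a vector of degree n through
  traces of vectors of degree n - k - l, multiplied by Eisenstein series, which converge on the unit
  disc.\<close>

lemma conv_radius_trace_sq_grade:
  "v \<in> sq_grade (int n) \<Longrightarrow> fps_conv_radius (trace_fps v) \<ge> 1"
proof (induction n arbitrary: v rule: less_induct)
  case (less n)
  show ?case
  proof (cases "n = 0")
    case True
    then obtain c where "v = c *s vac" using less.prems(1) by (auto simp: sq_grade_0 span_singleton)
    then show ?thesis
      by (auto simp: trace_fps_scale intro!: fps_conv_radius_mult_ge_1 conv_radius_trace_vac)
  next
    case False
    have "of_nat n *s v = (\<Sum>k=1..n. bm (- int k) (bm (int k) v))"
      using sum_bm_bm[OF less.prems] by simp
    then have "(1 / of_nat n) *s (of_nat n *s v) = (1 / of_nat n) *s (\<Sum>k=1..n. bm (- int k) (bm (int k) v))"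
      by (rule arg_cong)
    then have v: "v = (1 / of_nat n) *s (\<Sum>k=1..n. bm (- int k) (bm (int k) v))"
      using False by simp
    have "fps_conv_radius (trace_fps (bm (- int k) (bm (int k) v))) \<ge> 1" if k: "k \<in> {1..n}" for k
    proof -
      have kv: "bm (int k) v \<in> sq_grade (int (n - k))"
        using k by (intro sq_grade_annihilate less.prems) auto
      have "fps_conv_radius (trace_fps (bm (int l) (bm (int k) v))) \<ge> 1" if l: "l \<in> {1..n-k}" for l
      proof (rule less.IH)
        show "n - k - l < n" using k by auto
        show "bm (int l) (bm (int k) v) \<in> sq_grade (int (n - k - l))"
          using l by (intro sq_grade_annihilate kv) auto
      qed
      then show ?thesis
        using k by (subst trace_bm[OF _ kv]) (auto intro!: fps_conv_radius_sum_ge_1 fps_conv_radius_mult_ge_1 conv_radius_C_fps)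
    qed
    then have "fps_conv_radius (fps_const (1 / of_nat n) * (\<Sum>k=1..n. trace_fps (bm (- int k) (bm (int k) v)))) \<ge> 1"
      by (intro fps_conv_radius_mult_ge_1 fps_conv_radius_sum_ge_1) auto
    moreover have "trace_fps v = fps_const (1 / of_nat n) * (\<Sum>k=1..n. trace_fps (bm (- int k) (bm (int k) v)))"
      by (subst v) (simp only: trace_fps_scale trace_fps_sum)
    ultimately show ?thesis by (simp only:)
  qed
qed

lemma conv_radius_trace: "fps_conv_radius (trace_fps v) \<ge> 1"
proof -
  have "v \<in> span (\<Union>n. sq_grade (int n))" using span_sq_grade by simp
  then show ?thesis
    by (induction v rule: span_induct_alt)
       (auto simp: trace_fps_add trace_fps_scale intro!: fps_conv_radius_add_ge_1 fps_conv_radius_mult_ge_1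
         conv_radius_trace_sq_grade)
qed

context
  fixes \<tau> :: complex
  assumes \<tau>: "Im \<tau> > 0"
begin

text \<open>The one-point function is an unordered sum over all integers, so absolute convergence
  inside the unit disc is used; negative degrees contribute 0.\<close>

lemma one_point_eq_eval: "one_point v \<tau> = eval_fps (trace_fps v) (exp (2 * of_real pi * \<i> * \<tau>))"
proof -
  define q where "q = exp (2 * of_real pi * \<i> * \<tau>)"
  have q: "ereal (norm q) < fps_conv_radius (trace_fps v)"
    unfolding q_def by (rule norm_less_conv_radius[OF conv_radius_trace norm_nome_less_1[OF \<tau>]])
  have "((\<lambda>n. trace_fps v $ n * q ^ n) has_sum eval_fps (trace_fps v) q) UNIV"
    using norm_summable_fps[OF q] sums_eval_fps[OF q] by (rule norm_summable_imp_has_sum)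
  then have "(((\<lambda>n. trace_on (grade n) (zero_mode v) * q powi n) \<circ> int) has_sum eval_fps (trace_fps v) q) UNIV"
    by (simp add: o_def trace_fps_def)
  then have "((\<lambda>n. trace_on (grade n) (zero_mode v) * q powi n) has_sum eval_fps (trace_fps v) q) (range int)"
    by (subst has_sum_reindex) auto
  then have "((\<lambda>n. trace_on (grade n) (zero_mode v) * q powi n) has_sum eval_fps (trace_fps v) q) UNIV"
  proof (rule has_sum_cong_neutral[THEN iffD1, rotated -1])
    fix n :: int assume "n \<in> UNIV - range int"
    then have "n < 0" by (metis DiffD2 nonneg_int_cases not_le rangeI)
    then show "trace_on (grade n) (zero_mode v) * q powi n = 0"
      by (simp add: trace_negative grade_zero_mode)
  qed auto
  then show ?thesis unfolding one_point_def q_def by (rule infsumI)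
qed

lemma linear_one_point: "Vector_Spaces.linear scale (*) (\<lambda>v. one_point v \<tau>)"
proof -
  define q where "q = exp (2 * of_real pi * \<i> * \<tau>)"
  have q: "norm q < 1" unfolding q_def by (rule norm_nome_less_1[OF \<tau>])
  show ?thesis
    unfolding one_point_eq_eval q_def[symmetric]
    by unfold_locales
       (simp_all only: trace_fps_add trace_fps_scale eval_fps_add_1[OF conv_radius_trace conv_radius_trace q]
         eval_fps_const_mult[OF conv_radius_trace q] distrib_left distrib_right mult.assoc mult_1)
qed

lemma one_point_recursion:
  assumes "k \<ge> 1" "v \<in> sq_grade (int n)"
  shows "one_point (bm (- int k) v) \<tau> = (\<Sum>l=1..n. C_fun k l \<tau> / of_nat l * one_point (bm (int l) v) \<tau>)"
proof -
  let ?q = "exp (2 * of_real pi * \<i> * \<tau>)"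
  have q: "norm ?q < 1" by (rule norm_nome_less_1[OF \<tau>])
  have 1: "fps_conv_radius (fps_const (1 / of_nat l) * C_fps k l * trace_fps (bm (int l) v)) \<ge> 1" for l
    by (intro fps_conv_radius_mult_ge_1 conv_radius_C_fps conv_radius_trace fps_conv_radius_const_ge_1)
  have 2: "fps_conv_radius (fps_const (1 / of_nat l) * C_fps k l) \<ge> 1" for l
    by (intro fps_conv_radius_mult_ge_1 conv_radius_C_fps fps_conv_radius_const_ge_1)
  show ?thesis
    unfolding one_point_eq_eval trace_bm[OF assms] eval_fps_sum[OF 1 q]
    by (intro sum.cong refl)
       (simp add: eval_fps_mult_1[OF 2 conv_radius_trace q] eval_fps_mult_1[OF _ conv_radius_C_fps q] eval_C_fps[OF \<tau>])
qed

lemma one_point_vac: "one_point vac \<tau> = partition_fun \<tau>"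
proof -
  have "trace_on (grade n) (zero_mode vac) = trace_on (grade n) (\<lambda>w. w)" for n
    by (rule trace_cong) (simp add: zero_mode_homogeneous[OF vac_weight] vacuum)
  then show ?thesis by (simp add: one_point_def partition_fun_def)
qed

end

end


section \<open>Chequered cycles and their primitive roots\<close>

definition cyc_prod :: "('a \<Rightarrow> 'a \<Rightarrow> 'b) \<Rightarrow> 'a list \<Rightarrow> 'b::comm_monoid_mult" where
  "cyc_prod F xs = (\<Prod>i<length xs. F (xs ! i) (xs ! (Suc i mod length xs)))"

lemma bij_betw_shift_mod: "bij_betw (\<lambda>i. (r + i) mod n) {..<n} {..<n::nat}"
proof -
  have inj: "inj_on (\<lambda>i. (r + i) mod n) {..<n}"
  proof (rule inj_onI)
    fix i j assume ij: "i \<in> {..<n}" "j \<in> {..<n}" "(r + i) mod n = (r + j) mod n"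
    have "i = j" if "i \<le> j" "j < n" "(r + j) mod n = (r + i) mod n" for i j
    proof -
      have "n dvd (r + j) - (r + i)" using that by (subst mod_eq_dvd_iff_nat[symmetric]) auto
      then show ?thesis using that by (auto dest: dvd_imp_le)
    qed
    then show "i = j" using ij by (metis lessThan_iff nat_le_linear)
  qed
  have "(\<lambda>i. (r + i) mod n) ` {..<n} \<subseteq> {..<n}" by auto
  then have "(\<lambda>i. (r + i) mod n) ` {..<n} = {..<n}"
    using inj by (intro endo_inj_surj) auto
  then show ?thesis using inj by (simp add: bij_betw_def)
qed

lemma cyc_prod_rotate: "cyc_prod F (rotate r xs) = cyc_prod F xs"
proof (cases "xs = []")
  case False
  define n where "n = length xs"
  have "cyc_prod F (rotate r xs) = (\<Prod>i<n. F (xs ! ((r + i) mod n)) (xs ! (Suc ((r + i) mod n) mod n)))"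
    unfolding cyc_prod_def
  proof (intro prod.cong)
    fix i assume i: "i \<in> {..<n}"
    have "(r + Suc i mod n) mod n = Suc ((r + i) mod n) mod n" by (simp add: mod_simps)
    moreover have "Suc i mod n < n" using i by simp
    ultimately show "F (rotate r xs ! i) (rotate r xs ! (Suc i mod length (rotate r xs))) =
       F (xs ! ((r + i) mod n)) (xs ! (Suc ((r + i) mod n) mod n))"
      using i by (simp add: nth_rotate n_def)
  qed (simp add: n_def)
  also have "\<dots> = cyc_prod F xs"
    unfolding cyc_prod_def n_def[symmetric]
    by (rule prod.reindex_bij_betw[OF bij_betw_shift_mod, of "\<lambda>i. F (xs ! i) (xs ! (Suc i mod n))"])
  finally show ?thesis .
qed (simp add: cyc_prod_def)

lemma prod_mod_lessThan: "(\<Prod>i<r * L. f (i mod L)) = (\<Prod>i<L. f i) ^ (r::nat)"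
proof (induction r)
  case (Suc r)
  have "(\<Prod>i<Suc r * L. f (i mod L)) = (\<Prod>i<r * L. f (i mod L)) * (\<Prod>i\<in>{r * L..<r * L + L}. f (i mod L))"
  proof -
    have "{..<Suc r * L} = {..<r * L} \<union> {r * L..<r * L + L}" by auto
    moreover have "{..<r * L} \<inter> {r * L..<r * L + L} = {}" by auto
    ultimately show ?thesis by (simp only: prod.union_disjoint finite_lessThan finite_atLeastLessThan)
  qed
  also have "(\<Prod>i\<in>{r * L..<r * L + L}. f (i mod L)) = (\<Prod>i<L. f i)"
    by (rule prod.reindex_bij_witness[where i = "\<lambda>i. r * L + i" and j = "\<lambda>i. i - r * L"])
       (auto simp: le_iff_add)
  finally show ?case unfolding Suc by (simp only: power_Suc mult.commute)
qed simp

section \<open>Powers and primitive roots of lists under rotation\<close>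

abbreviation lpow :: "nat \<Rightarrow> 'a list \<Rightarrow> 'a list" where
  "lpow r ys \<equiv> concat (replicate r ys)"

lemma length_lpow: "length (lpow r ys) = r * length ys"
  by (induction r) auto

lemma nth_lpow: "i < r * length ys \<Longrightarrow> lpow r ys ! i = ys ! (i mod length ys)"
  by (induction r arbitrary: i) (auto simp: nth_append le_mod_geq not_less length_lpow)

lemma cyc_prod_lpow: "cyc_prod F (lpow r ys) = cyc_prod F ys ^ r"
proof -
  let ?L = "length ys"
  have "cyc_prod F (lpow r ys) = (\<Prod>i<r * ?L. F (ys ! (i mod ?L)) (ys ! (Suc (i mod ?L) mod ?L)))"
    unfolding cyc_prod_def
  proof (intro prod.cong)
    fix i assume i: "i \<in> {..<r * ?L}"
    then have "Suc i mod (r * ?L) < r * ?L" by (intro mod_less_divisor) (cases "r * ?L", auto)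
    moreover have "Suc i mod (r * ?L) mod ?L = Suc (i mod ?L) mod ?L"
      by (simp add: mod_mod_cancel mod_simps)
    ultimately show "F (lpow r ys ! i) (lpow r ys ! (Suc i mod length (lpow r ys))) =
        F (ys ! (i mod ?L)) (ys ! (Suc (i mod ?L) mod ?L))"
      using i by (simp add: length_lpow nth_lpow)
  qed (simp add: length_lpow)
  also have "\<dots> = cyc_prod F ys ^ r"
    unfolding cyc_prod_def by (rule prod_mod_lessThan[of "\<lambda>i. F (ys ! i) (ys ! (Suc i mod ?L))"])
  finally show ?thesis .
qed

lemma rotate_eq_iff_nth:
  "rotate p xs = xs \<longleftrightarrow> (\<forall>i<length xs. xs ! ((p + i) mod length xs) = xs ! i)"
  by (auto simp: list_eq_iff_nth_eq nth_rotate)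

definition root_len :: "'a list \<Rightarrow> nat" where
  "root_len xs = (LEAST p. p > 0 \<and> rotate p xs = xs)"

lemma root_len_props:
  assumes "xs \<noteq> []"
  shows "root_len xs > 0" "rotate (root_len xs) xs = xs"
proof -
  have "length xs > 0 \<and> rotate (length xs) xs = xs" using assms by simp
  then have "root_len xs > 0 \<and> rotate (root_len xs) xs = xs"
    unfolding root_len_def by (rule LeastI)
  then show "root_len xs > 0" "rotate (root_len xs) xs = xs" by auto
qed

lemma rotate_mult: "rotate p xs = xs \<Longrightarrow> rotate (q * p) xs = xs"
  by (induction q) (auto simp: rotate_add simp flip: rotate_rotate)

text \<open>Otherwise the remainder of p modulo the minimal period would be a smaller positive
  period.\<close>

lemma root_len_dvd:
  assumes "xs \<noteq> []" "rotate p xs = xs"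
  shows "root_len xs dvd p"
proof (rule ccontr)
  let ?r = "root_len xs"
  assume "\<not> ?r dvd p"
  then have m: "p mod ?r > 0" by (simp add: dvd_eq_mod_eq_0)
  have "p = p mod ?r + p div ?r * ?r" by (simp add: mult.commute)
  then have "rotate p xs = rotate (p mod ?r) (rotate (p div ?r * ?r) xs)"
    by (metis rotate_rotate)
  also have "\<dots> = rotate (p mod ?r) xs"
    using rotate_mult[OF root_len_props(2)[OF assms(1)]] by simp
  finally have "rotate (p mod ?r) xs = xs" using assms(2) by simp
  then have "?r \<le> p mod ?r" unfolding root_len_def using m[unfolded root_len_def] by (intro Least_le) auto
  then show False using mod_less_divisor[OF root_len_props(1)[OF assms(1)], of p] by simp
qed

lemma root_len_dvd_length: "xs \<noteq> [] \<Longrightarrow> root_len xs dvd length xs"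
  by (rule root_len_dvd) auto

lemma rotationless_root_len: "rotationless xs \<Longrightarrow> xs \<noteq> [] \<Longrightarrow> root_len xs = length xs"
  using root_len_props[of xs] dvd_imp_le[OF root_len_dvd_length[of xs]]
  unfolding rotationless_def by (metis length_greater_0_conv order_le_less)

lemma rotate_lpow_iff:
  assumes "r > 0" "ys \<noteq> []"
  shows "rotate p (lpow r ys) = lpow r ys \<longleftrightarrow> rotate p ys = ys"
proof -
  let ?L = "length ys"
  have L: "?L > 0" using assms by simp
  have eq: "lpow r ys ! ((p + i) mod (r * ?L)) = ys ! ((p + i mod ?L) mod ?L)" for i
  proof -
    have "(p + i) mod (r * ?L) < r * ?L" using L assms by (intro mod_less_divisor) auto
    then show ?thesis by (simp add: nth_lpow mod_mod_cancel mod_simps)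
  qed
  show ?thesis
    unfolding rotate_eq_iff_nth length_lpow eq
  proof (intro iffI allI impI)
    fix i assume *: "\<forall>i<r * ?L. ys ! ((p + i mod ?L) mod ?L) = lpow r ys ! i" and i: "i < ?L"
    have "i < r * ?L" using i assms(1) by (metis One_nat_def Suc_leI less_le_trans mult_le_mono1 nat_mult_1)
    then show "ys ! ((p + i) mod ?L) = ys ! i" using * i by (auto simp: nth_lpow)
  next
    fix i assume *: "\<forall>i<?L. ys ! ((p + i) mod ?L) = ys ! i" and i: "i < r * ?L"
    then show "ys ! ((p + i mod ?L) mod ?L) = lpow r ys ! i" using L by (simp add: nth_lpow)
  qed
qed

lemma root_len_lpow: "r > 0 \<Longrightarrow> ys \<noteq> [] \<Longrightarrow> root_len (lpow r ys) = root_len ys"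
  unfolding root_len_def by (simp add: rotate_lpow_iff)

text \<open>The minimal period divides the length, so the list is a power of its initial segment. A
  rotation fixing this segment would also fix the whole list and contradict minimality.\<close>

lemma lpow_root:
  assumes "xs \<noteq> []"
  defines "ys \<equiv> take (root_len xs) xs"
  shows "lpow (length xs div root_len xs) ys = xs" "rotationless ys" "length ys = root_len xs"
proof -
  let ?p = "root_len xs" and ?n = "length xs"
  have p: "?p > 0" "rotate ?p xs = xs" "?p dvd ?n"
    using root_len_props root_len_dvd_length assms(1) by auto
  have pn: "?p \<le> ?n" using p(3) assms(1) by (intro dvd_imp_le) auto
  show len: "length ys = ?p" using pn by (simp add: ys_def)
  have per: "xs ! (i mod ?p) = xs ! i" if "i < ?n" for i
    using that
  proof (induction i rule: less_induct)
    case (less i)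
    show ?case
    proof (cases "i < ?p")
      case False
      have "xs ! (i - ?p) = xs ! ((?p + (i - ?p)) mod ?n)"
        using p(2) less.prems unfolding rotate_eq_iff_nth by auto
      also have "\<dots> = xs ! i" using False less.prems by simp
      finally have "xs ! (i - ?p) = xs ! i" .
      moreover have "xs ! ((i - ?p) mod ?p) = xs ! (i - ?p)" using less p False by auto
      ultimately show ?thesis using False by (simp add: le_mod_geq)
    qed simp
  qed
  show eq: "lpow (?n div ?p) ys = xs"
  proof (rule nth_equalityI)
    show "length (lpow (?n div ?p) ys) = length xs" using p len by (simp add: length_lpow)
    fix i assume "i < length (lpow (?n div ?p) ys)"
    then have i: "i < ?n" "i < ?n div ?p * length ys" using p len by (auto simp: length_lpow)
    then show "lpow (?n div ?p) ys ! i = xs ! i"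
      using per[OF i(1)] p by (simp add: nth_lpow len) (simp add: ys_def)
  qed
  show "rotationless ys"
    unfolding rotationless_def
  proof (intro allI impI notI)
    fix r assume r: "0 < r \<and> r < length ys" "rotate r ys = ys"
    have "?n div ?p > 0" using pn p by (simp add: div_greater_zero_iff)
    then have "rotate r xs = xs"
      using r rotate_lpow_iff[of "?n div ?p" ys r] eq by fastforce
    then have "?p dvd r" by (rule root_len_dvd[OF assms(1)])
    then show False using r len by (auto dest: dvd_imp_le)
  qed
qed

definition node_sum :: "(nat \<times> nat) list \<Rightarrow> nat" where
  "node_sum xs = sum_list (map fst xs)"

lemma node_sum_lpow: "node_sum (lpow r ys) = r * node_sum ys"
  by (induction r) (auto simp: node_sum_def)

lemma node_sum_rotate: "node_sum (rotate r ys) = node_sum ys"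
proof (induction r)
  case (Suc r)
  have "node_sum (rotate1 xs) = node_sum xs" for xs by (cases xs) (auto simp: node_sum_def)
  then show ?case using Suc by simp
qed simp

lemma chequered_nonempty: "chequered_cycle xs \<Longrightarrow> xs \<noteq> []"
  by (auto simp: chequered_cycle_def)

lemma chequered_node_sum_pos:
  assumes "chequered_cycle xs"
  shows "node_sum xs > 0"
proof -
  have "xs \<noteq> []" using assms by (rule chequered_nonempty)
  then have "hd xs \<in> set xs" by simp
  then have "fst (hd xs) > 0" "fst (hd xs) \<in> set (map fst xs)"
    using assms unfolding chequered_cycle_def by (auto simp: case_prod_beta)
  then show ?thesis unfolding node_sum_def using member_le_sum_list by fastforce
qed

lemma chequered_length_le: "chequered_cycle xs \<Longrightarrow> length xs \<le> node_sum xs"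
proof -
  assume "chequered_cycle xs"
  then have "\<forall>x\<in>set xs. fst x > 0" by (auto simp: chequered_cycle_def)
  then show ?thesis by (induction xs) (auto simp: node_sum_def)
qed

lemma finite_chequered: "finite {xs. chequered_cycle xs \<and> node_sum xs \<le> m}"
proof (rule finite_subset)
  show "finite {xs. set xs \<subseteq> {..m} \<times> {1,2} \<and> length xs \<le> m}"
    by (rule finite_lists_length_le) auto
  show "{xs. chequered_cycle xs \<and> node_sum xs \<le> m} \<subseteq> {xs. set xs \<subseteq> {..m} \<times> {1,2} \<and> length xs \<le> m}"
  proof
    fix xs :: "(nat \<times> nat) list" assume "xs \<in> {xs. chequered_cycle xs \<and> node_sum xs \<le> m}"
    then have xs: "chequered_cycle xs" "node_sum xs \<le> m" by auto
    have "x \<in> {..m} \<times> {1,2}" if x: "x \<in> set xs" for x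
    proof -
      have "fst x \<in> set (map fst xs)" using x by simp
      then have "fst x \<le> m" using member_le_sum_list[of "fst x" "map fst xs"] xs(2) by (simp add: node_sum_def)
      moreover have "snd x \<in> {1,2}" using x xs(1) by (auto simp: chequered_cycle_def)
      ultimately show ?thesis by (cases x) simp
    qed
    then show "xs \<in> {xs. set xs \<subseteq> {..m} \<times> {1,2} \<and> length xs \<le> m}"
      using chequered_length_le[OF xs(1)] xs(2) by auto
  qed
qed

lemma rotate_back: "rotate (length xs - r mod length xs) (rotate r xs) = xs"
proof (cases "xs = []")
  case False
  then have "r mod length xs < length xs" by simp
  then have "rotate ((length xs - r mod length xs) + r mod length xs) xs = xs" by simp
  then show ?thesis by (metis rotate_rotate rotate_conv_mod)
qed simp

lemma chequered_rotate:
  assumes "chequered_cycle xs"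
  shows "chequered_cycle (rotate r xs)"
proof -
  let ?n = "length xs"
  have n: "?n > 0" using chequered_nonempty[OF assms] by simp
  have alt: "snd (xs ! i) \<noteq> snd (xs ! (Suc i mod ?n))" if "i < ?n" for i
    using assms that by (auto simp: chequered_cycle_def)
  have "snd (rotate r xs ! i) \<noteq> snd (rotate r xs ! (Suc i mod ?n))" if "i < ?n" for i
  proof -
    have "(r + Suc i mod ?n) mod ?n = Suc ((r + i) mod ?n) mod ?n" by (simp add: mod_simps)
    then show ?thesis using alt[of "(r + i) mod ?n"] that n by (simp add: nth_rotate)
  qed
  then show ?thesis using assms by (auto simp: chequered_cycle_def)
qed

lemma alternating_labels:
  fixes ys :: "(nat \<times> nat) list"
  assumes lab: "\<forall>(k, e)\<in>set ys. k > 0 \<and> e \<in> {1, 2}"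
    and alt: "\<forall>i<length ys. snd (ys ! i) \<noteq> snd (ys ! (Suc i mod length ys))"
    and "i < length ys"
  shows "snd (ys ! i) = (if even i then snd (ys ! 0) else 3 - snd (ys ! 0))"
  using assms(3)
proof (induction i)
  case (Suc i)
  have l: "snd (ys ! i) = 1 \<or> snd (ys ! i) = 2" if "i < length ys" for i
    using lab nth_mem[OF that] by (cases "ys ! i") auto
  have "snd (ys ! i) \<noteq> snd (ys ! Suc i)" using alt Suc.prems by (metis Suc_lessD mod_less)
  then show ?case using Suc l[of "Suc i"] l[of i] l[of 0] by auto
qed simp

text \<open>Since the edge labels alternate, a period of a chequered cycle is even.\<close>

lemma chequered_lpow_iff:
  assumes "r > 0"
  shows "chequered_cycle (lpow r ys) \<longleftrightarrow> chequered_cycle ys"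
proof (cases "ys = []")
  case True
  then show ?thesis by (simp add: chequered_cycle_def)
next
  case False
  let ?L = "length ys"
  have L: "?L > 0" using False by simp
  have set: "set (lpow r ys) = set ys" using assms by (auto simp: set_replicate_conv_if)
  have rL: "i < r * ?L" if "i < ?L" for i
    using that assms by (metis One_nat_def Suc_leI less_le_trans mult_le_mono1 nat_mult_1)
  have alt: "(\<forall>i<r * ?L. snd (lpow r ys ! i) \<noteq> snd (lpow r ys ! (Suc i mod (r * ?L)))) \<longleftrightarrow>
     (\<forall>i<?L. snd (ys ! i) \<noteq> snd (ys ! (Suc i mod ?L)))"
  proof -
    have e: "lpow r ys ! (Suc i mod (r * ?L)) = ys ! (Suc (i mod ?L) mod ?L)" for i
    proof -
      have "Suc i mod (r * ?L) < r * ?L" using L assms by (intro mod_less_divisor) auto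
      then show ?thesis by (simp add: nth_lpow mod_mod_cancel mod_simps)
    qed
    show ?thesis unfolding e
    proof (intro iffI allI impI)
      fix i assume *: "\<forall>i<r * ?L. snd (lpow r ys ! i) \<noteq> snd (ys ! (Suc (i mod ?L) mod ?L))" and i: "i < ?L"
      then show "snd (ys ! i) \<noteq> snd (ys ! (Suc i mod ?L))" using rL[OF i] by (auto simp: nth_lpow)
    next
      fix i assume *: "\<forall>i<?L. snd (ys ! i) \<noteq> snd (ys ! (Suc i mod ?L))" and i: "i < r * ?L"
      have "i mod ?L < ?L" using L by simp
      then show "snd (lpow r ys ! i) \<noteq> snd (ys ! (Suc (i mod ?L) mod ?L))" using * i by (simp add: nth_lpow)
    qed
  qed
  have ev: "\<exists>n\<ge>1. ?L = 2 * n"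
    if lab: "\<forall>(k, e)\<in>set ys. k > 0 \<and> e \<in> {1, 2}" and a: "\<forall>i<?L. snd (ys ! i) \<noteq> snd (ys ! (Suc i mod ?L))"
  proof -
    note p = alternating_labels[OF lab a]
    have "snd (ys ! (?L - 1)) \<noteq> snd (ys ! (Suc (?L - 1) mod ?L))" using a L by (meson diff_less zero_less_one)
    then have "odd (?L - 1)" using p[of "?L - 1"] L by (auto split: if_splits)
    then have "even ?L" using L by simp
    then obtain n where "?L = 2 * n" by (elim evenE)
    then show ?thesis using L by (intro exI[of _ n]) auto
  qed
  have ev2: "\<exists>n\<ge>1. r * ?L = 2 * n" if len: "\<exists>n\<ge>1. ?L = 2 * n"
  proof -
    from len obtain n where "n \<ge> 1" "?L = 2 * n" by blast
    then show ?thesis using assms by (intro exI[of _ "r * n"]) auto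
  qed
  show ?thesis
    unfolding chequered_cycle_def set length_lpow alt
    by (rule iffI; elim conjE; intro conjI; (assumption | (rule ev; assumption) | (rule ev2; assumption)))
qed

definition primitive_cycles :: "(nat \<times> nat) list set" where
  "primitive_cycles = {xs. chequered_cycle xs \<and> rotationless xs}"

text \<open>Node sums are multiplied by the exponent when a list is raised to a power, so the
  exponent is determined by the total m and need not be recorded. Lists with a marked starting node
  are counted here; passing to classes comes later.\<close>

lemma bij_betw_primitive:
  assumes m: "m > 0"
  shows "bij_betw (\<lambda>ys. lpow (m div node_sum ys) ys) {ys \<in> primitive_cycles. node_sum ys dvd m}
    {xs. chequered_cycle xs \<and> node_sum xs = m}"
proof (rule bij_betwI[where g = "\<lambda>xs. take (root_len xs) xs"])
  show "(\<lambda>ys. lpow (m div node_sum ys) ys) \<in> {ys \<in> primitive_cycles. node_sum ys dvd m} \<rightarrow> {xs. chequered_cycle xs \<and> node_sum xs = m}"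
  proof safe
    fix ys assume ys: "ys \<in> primitive_cycles" "node_sum ys dvd m"
    then have "m div node_sum ys > 0" using m by (metis dvd_div_eq_0_iff gr0I less_irrefl)
    then show "chequered_cycle (lpow (m div node_sum ys) ys)"
      using ys by (simp add: chequered_lpow_iff primitive_cycles_def)
    show "node_sum (lpow (m div node_sum ys) ys) = m" using ys by (simp add: node_sum_lpow)
  qed
  show "(\<lambda>xs. take (root_len xs) xs) \<in> {xs. chequered_cycle xs \<and> node_sum xs = m} \<rightarrow> {ys \<in> primitive_cycles. node_sum ys dvd m}"
  proof safe
    fix xs assume xs: "chequered_cycle xs" "m = node_sum xs"
    let ?ys = "take (root_len xs) xs" and ?r = "length xs div root_len xs"
    have ne: "xs \<noteq> []" by (rule chequered_nonempty[OF xs(1)])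
    note r = lpow_root[OF ne]
    have r0: "?r > 0" using r(1) ne by (cases "?r = 0") auto
    have "chequered_cycle ?ys" using chequered_lpow_iff[OF r0, of ?ys] r(1) xs(1) by simp
    then show "?ys \<in> primitive_cycles" using r(2) by (simp add: primitive_cycles_def)
    show "node_sum ?ys dvd node_sum xs"
      using node_sum_lpow[of ?r ?ys] r(1) by simp
  qed
  fix ys assume "ys \<in> {ys \<in> primitive_cycles. node_sum ys dvd m}"
  then have ys: "chequered_cycle ys" "rotationless ys" "node_sum ys dvd m" by (auto simp: primitive_cycles_def)
  have ne: "ys \<noteq> []" by (rule chequered_nonempty[OF ys(1)])
  have r: "m div node_sum ys > 0" using m ys by (metis dvd_div_eq_0_iff gr0I less_irrefl)
  have "root_len (lpow (m div node_sum ys) ys) = length ys"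
    using r ne ys by (simp add: root_len_lpow rotationless_root_len)
  then show "take (root_len (lpow (m div node_sum ys) ys)) (lpow (m div node_sum ys) ys) = ys"
    using r by (cases "m div node_sum ys") auto
next
  fix xs assume "xs \<in> {xs. chequered_cycle xs \<and> node_sum xs = m}"
  then have xs: "chequered_cycle xs" "node_sum xs = m" by auto
  let ?ys = "take (root_len xs) xs" and ?r = "length xs div root_len xs"
  have ne: "xs \<noteq> []" by (rule chequered_nonempty[OF xs(1)])
  note r = lpow_root[OF ne]
  have "m = ?r * node_sum ?ys" using node_sum_lpow[of ?r ?ys] r(1) xs(2) by simp
  moreover have "node_sum ?ys > 0" using calculation m by (cases "node_sum ?ys") auto
  ultimately have "m div node_sum ?ys = ?r" by (metis nonzero_mult_div_cancel_right less_numeral_extra(3))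
  then show "lpow (m div node_sum ?ys) ?ys = xs" using r(1) by simp
qed

section \<open>Isomorphism classes of rotationless cycles\<close>

lemma equiv_cycle_iso: "equiv {xs. chequered_cycle xs} cycle_iso"
proof (rule equivI)
  show "cycle_iso \<subseteq> {xs. chequered_cycle xs} \<times> {xs. chequered_cycle xs}" by (auto simp: cycle_iso_def)
  show "refl_on {xs. chequered_cycle xs} cycle_iso"
    by (auto simp: refl_on_def cycle_iso_def intro: exI[of _ 0])
  show "sym cycle_iso"
  proof (rule symI)
    fix xs ys assume "(xs, ys) \<in> cycle_iso"
    then obtain r where r: "chequered_cycle xs" "chequered_cycle ys" "ys = rotate r xs" by (auto simp: cycle_iso_def)
    have "xs = rotate (length xs - r mod length xs) ys"
      unfolding r(3) by (rule rotate_back[symmetric])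
    then show "(ys, xs) \<in> cycle_iso" using r(1,2) unfolding cycle_iso_def by blast
  qed
  show "trans cycle_iso"
    by (rule transI) (auto simp: cycle_iso_def rotate_rotate)
qed

text \<open>All rotations of a rotationless list are distinct, so its class has exactly as many
  elements as the cycle has nodes.\<close>

lemma class_of_primitive:
  assumes "ys \<in> primitive_cycles"
  shows "cycle_iso `` {ys} = (\<lambda>r. rotate r ys) ` {..<length ys}"
    "inj_on (\<lambda>r. rotate r ys) {..<length ys}"
    "cycle_iso `` {ys} \<subseteq> primitive_cycles"
proof -
  have ys: "chequered_cycle ys" "rotationless ys" using assms by (auto simp: primitive_cycles_def)
  have ne: "ys \<noteq> []" by (rule chequered_nonempty[OF ys(1)])
  show 1: "cycle_iso `` {ys} = (\<lambda>r. rotate r ys) ` {..<length ys}"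
  proof (intro equalityI subsetI)
    fix zs assume "zs \<in> cycle_iso `` {ys}"
    then obtain r where "zs = rotate r ys" by (auto simp: cycle_iso_def)
    then have "zs = rotate (r mod length ys) ys" by (metis rotate_conv_mod)
    then show "zs \<in> (\<lambda>r. rotate r ys) ` {..<length ys}" using ne by auto
  qed (use ys in \<open>auto simp: cycle_iso_def chequered_rotate\<close>)
  have nr: "rotate r (rotate s ys) = rotate s ys \<longleftrightarrow> rotate r ys = ys" for r s
  proof
    assume "rotate r (rotate s ys) = rotate s ys"
    then have "rotate s (rotate r ys) = rotate s ys" by (simp add: rotate_rotate add.commute)
    then show "rotate r ys = ys" by (metis rotate_back length_rotate)
  next
    assume "rotate r ys = ys"
    then show "rotate r (rotate s ys) = rotate s ys" by (metis rotate_rotate add.commute)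
  qed
  have "r = s" if "r \<le> s" "s < length ys" "rotate r ys = rotate s ys" for r s
  proof (rule ccontr)
    assume "r \<noteq> s"
    have "rotate (s - r) (rotate r ys) = rotate (s - r + r) ys" by (simp only: rotate_rotate)
    also have "\<dots> = rotate r ys" using that by simp
    finally have "rotate (s - r) (rotate r ys) = rotate r ys" .
    then have "rotate (s - r) ys = ys" by (simp add: nr)
    then show False using ys(2) that \<open>r \<noteq> s\<close> unfolding rotationless_def
      by (metis diff_is_0_eq le_antisym less_imp_diff_less neq0_conv)
  qed
  then show "inj_on (\<lambda>r. rotate r ys) {..<length ys}"
    by (intro inj_onI) (metis lessThan_iff nat_le_linear)
  show "cycle_iso `` {ys} \<subseteq> primitive_cycles"
    unfolding 1 using ys by (auto simp: primitive_cycles_def chequered_rotate rotationless_def nr)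
qed

lemma rotationless_classes_eq: "rotationless_classes = primitive_cycles // cycle_iso"
  by (simp add: rotationless_classes_def primitive_cycles_def)

text \<open>This is the power of \<epsilon> in the weight of the class: every node lies on two edges
  and receives half of its label from each.\<close>

definition class_degree :: "(nat \<times> nat) list set \<Rightarrow> nat" where
  "class_degree N = the_elem (node_sum ` N)"

definition class_prod :: "((nat \<times> nat) \<Rightarrow> (nat \<times> nat) \<Rightarrow> 'b) \<Rightarrow> (nat \<times> nat) list set \<Rightarrow> 'b::comm_monoid_mult" where
  "class_prod F N = the_elem (cyc_prod F ` N)"

text \<open>The sum of the first labels over a class is the degree because each node comes first in
  exactly one rotation. It supplies the factor that differentiation in \<epsilon> produces.\<close>

lemma class_props:
  assumes "N \<in> rotationless_classes"
  shows "N \<subseteq> primitive_cycles" "finite N" "N \<noteq> {}"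
    "ys \<in> N \<Longrightarrow> N = cycle_iso `` {ys}"
    "ys \<in> N \<Longrightarrow> node_sum ys = class_degree N" "ys \<in> N \<Longrightarrow> cyc_prod F ys = class_prod F N"
    "(\<Sum>ys\<in>N. fst (hd ys)) = class_degree N" "class_degree N > 0"
proof -
  obtain zs where zs: "zs \<in> primitive_cycles" "N = cycle_iso `` {zs}"
    using assms unfolding rotationless_classes_eq by (auto elim: quotientE)
  note c = class_of_primitive[OF zs(1), folded zs(2)]
  have zch: "chequered_cycle zs" using zs by (auto simp: primitive_cycles_def)
  have ne: "zs \<noteq> []" by (rule chequered_nonempty[OF zch])
  show "N \<subseteq> primitive_cycles" "finite N" "N \<noteq> {}" using c ne by auto
  show "N = cycle_iso `` {ys}" if "ys \<in> N"
    using that zs equiv_class_eq[OF equiv_cycle_iso] by auto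
  have zN: "zs \<in> N" unfolding c(1) by (rule image_eqI[of _ _ 0]) (use ne in auto)
  have n: "node_sum ` N = {node_sum zs}"
  proof
    show "node_sum ` N \<subseteq> {node_sum zs}" unfolding c(1) by (auto simp: node_sum_rotate)
  qed (use zN in blast)
  have p: "cyc_prod F ` N = {cyc_prod F zs}"
  proof
    show "cyc_prod F ` N \<subseteq> {cyc_prod F zs}" unfolding c(1) by (auto simp: cyc_prod_rotate)
  qed (use zN in blast)
  have d: "class_degree N = node_sum zs" by (simp add: class_degree_def n)
  show "node_sum ys = class_degree N" if "ys \<in> N"
  proof -
    have "node_sum ys \<in> node_sum ` N" using that by blast
    then show ?thesis using n by (simp add: d)
  qed
  show "cyc_prod F ys = class_prod F N" if "ys \<in> N"
  proof -
    have "cyc_prod F ys \<in> cyc_prod F ` N" using that by blast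
    then show ?thesis using p by (simp add: class_prod_def)
  qed
  have "(\<Sum>ys\<in>N. fst (hd ys)) = (\<Sum>r<length zs. fst (hd (rotate r zs)))"
    unfolding c(1) by (rule sum.reindex_cong[OF c(2) refl refl])
  also have "\<dots> = (\<Sum>r<length zs. fst (zs ! r))"
    using ne by (intro sum.cong) (auto simp: hd_rotate_conv_nth)
  also have "\<dots> = node_sum zs"
    by (simp add: node_sum_def sum_list_sum_nth atLeast0LessThan)
  finally show "(\<Sum>ys\<in>N. fst (hd ys)) = class_degree N" by (simp add: d)
  show "class_degree N > 0" using chequered_node_sum_pos[OF zch] by (simp add: d)
qed

lemma Union_rotationless_classes: "\<Union> rotationless_classes = primitive_cycles"
proof
  show "\<Union> rotationless_classes \<subseteq> primitive_cycles" using class_props(1) by blast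
  show "primitive_cycles \<subseteq> \<Union> rotationless_classes"
  proof
    fix ys assume ys: "ys \<in> primitive_cycles"
    then have "ys \<in> cycle_iso `` {ys}" by (auto simp: cycle_iso_def primitive_cycles_def intro: exI[of _ 0])
    moreover have "cycle_iso `` {ys} \<in> rotationless_classes"
      using ys unfolding rotationless_classes_eq by (rule quotientI)
    ultimately show "ys \<in> \<Union> rotationless_classes" by blast
  qed
qed

lemma rotationless_classes_disjoint:
  assumes "N \<in> rotationless_classes" "N' \<in> rotationless_classes" "N \<noteq> N'"
  shows "N \<inter> N' = {}"
  using class_props(4)[OF assms(1)] class_props(4)[OF assms(2)] assms(3) by blast

lemma finite_rotationless_classes: "finite {N \<in> rotationless_classes. class_degree N \<le> m}"
proof (rule finite_subset)
  show "finite ((\<lambda>ys. cycle_iso `` {ys}) ` {xs. chequered_cycle xs \<and> node_sum xs \<le> m})"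
    using finite_chequered by blast
  show "{N \<in> rotationless_classes. class_degree N \<le> m} \<subseteq> (\<lambda>ys. cycle_iso `` {ys}) ` {xs. chequered_cycle xs \<and> node_sum xs \<le> m}"
  proof safe
    fix N assume N: "N \<in> rotationless_classes" "class_degree N \<le> m"
    obtain ys where ys: "ys \<in> N" using class_props(3)[OF N(1)] by blast
    have "ys \<in> {xs. chequered_cycle xs \<and> node_sum xs \<le> m}"
      using class_props(1)[OF N(1)] class_props(5)[OF N(1) ys] ys N(2) by (auto simp: primitive_cycles_def)
    then show "N \<in> (\<lambda>ys. cycle_iso `` {ys}) ` {xs. chequered_cycle xs \<and> node_sum xs \<le> m}"
      using class_props(4)[OF N(1) ys] by blast
  qed
qed

text \<open>Cycles are replaced by their primitive roots and these are grouped into classes. The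
  right-hand side is a coefficient of the logarithmic derivative of a product over classes, up to
  sign and exponent.\<close>

lemma sum_chequered_eq_sum_classes:
  fixes F :: "(nat \<times> nat) \<Rightarrow> (nat \<times> nat) \<Rightarrow> complex"
  assumes m: "m > 0"
  shows "(\<Sum>xs | chequered_cycle xs \<and> node_sum xs = m. of_nat (fst (hd xs)) * cyc_prod F xs) =
    (\<Sum>N | N \<in> rotationless_classes \<and> class_degree N dvd m. of_nat (class_degree N) * class_prod F N ^ (m div class_degree N))"
proof -
  have fin: "finite {N. N \<in> rotationless_classes \<and> class_degree N dvd m}"
    by (rule finite_subset[OF _ finite_rotationless_classes[of m]]) (use m in \<open>auto dest: dvd_imp_le\<close>)
  have "(\<Sum>xs | chequered_cycle xs \<and> node_sum xs = m. of_nat (fst (hd xs)) * cyc_prod F xs) =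
    (\<Sum>ys\<in>{ys \<in> primitive_cycles. node_sum ys dvd m}. of_nat (fst (hd (lpow (m div node_sum ys) ys))) * cyc_prod F (lpow (m div node_sum ys) ys))"
    by (rule sum.reindex_bij_betw[OF bij_betw_primitive[OF m], symmetric])
  also have "\<dots> = (\<Sum>ys\<in>{ys \<in> primitive_cycles. node_sum ys dvd m}. of_nat (fst (hd ys)) * cyc_prod F ys ^ (m div node_sum ys))"
  proof (intro sum.cong refl)
    fix ys assume "ys \<in> {ys \<in> primitive_cycles. node_sum ys dvd m}"
    then have "m div node_sum ys > 0" "ys \<noteq> []" using m
      by (auto simp: primitive_cycles_def div_greater_zero_iff chequered_node_sum_pos dest: chequered_nonempty dvd_imp_le)
    then have "hd (lpow (m div node_sum ys) ys) = hd ys" by (cases "m div node_sum ys") auto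
    then show "of_nat (fst (hd (lpow (m div node_sum ys) ys))) * cyc_prod F (lpow (m div node_sum ys) ys) =
      of_nat (fst (hd ys)) * cyc_prod F ys ^ (m div node_sum ys)"
      by (simp add: cyc_prod_lpow)
  qed
  also have "{ys \<in> primitive_cycles. node_sum ys dvd m} = \<Union> {N. N \<in> rotationless_classes \<and> class_degree N dvd m}"
  proof (intro equalityI subsetI)
    fix ys assume "ys \<in> {ys \<in> primitive_cycles. node_sum ys dvd m}"
    then obtain N where "ys \<in> N" "N \<in> rotationless_classes" "node_sum ys dvd m"
      unfolding Union_rotationless_classes[symmetric] by blast
    then show "ys \<in> \<Union> {N. N \<in> rotationless_classes \<and> class_degree N dvd m}"
      using class_props(5)[of N ys] by auto
  next
    fix ys assume "ys \<in> \<Union> {N. N \<in> rotationless_classes \<and> class_degree N dvd m}"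
    then obtain N where N: "ys \<in> N" "N \<in> rotationless_classes" "class_degree N dvd m" by blast
    then have "ys \<in> primitive_cycles" using Union_rotationless_classes by blast
    then show "ys \<in> {ys \<in> primitive_cycles. node_sum ys dvd m}"
      using N class_props(5)[of N ys] by auto
  qed
  also have "(\<Sum>ys\<in>\<dots>. of_nat (fst (hd ys)) * cyc_prod F ys ^ (m div node_sum ys)) =
     (\<Sum>N | N \<in> rotationless_classes \<and> class_degree N dvd m. \<Sum>ys\<in>N. of_nat (fst (hd ys)) * cyc_prod F ys ^ (m div node_sum ys))"
    by (subst sum.Union_disjoint) (use rotationless_classes_disjoint in \<open>auto simp: class_props(2)\<close>)
  also have "\<dots> = (\<Sum>N | N \<in> rotationless_classes \<and> class_degree N dvd m. of_nat (class_degree N) * class_prod F N ^ (m div class_degree N))"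
  proof (intro sum.cong refl)
    fix N assume "N \<in> {N. N \<in> rotationless_classes \<and> class_degree N dvd m}"
    then have N: "N \<in> rotationless_classes" by simp
    have "(\<Sum>ys\<in>N. of_nat (fst (hd ys)) * cyc_prod F ys ^ (m div node_sum ys)) =
      (\<Sum>ys\<in>N. of_nat (fst (hd ys)) * class_prod F N ^ (m div class_degree N))"
      by (intro sum.cong refl) (simp add: class_props(5)[OF N] class_props(6)[OF N])
    also have "\<dots> = of_nat (\<Sum>ys\<in>N. fst (hd ys)) * class_prod F N ^ (m div class_degree N)"
      by (simp add: sum_distrib_right)
    finally show "(\<Sum>ys\<in>N. of_nat (fst (hd ys)) * cyc_prod F ys ^ (m div node_sum ys)) =
      of_nat (class_degree N) * class_prod F N ^ (m div class_degree N)"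
      by (simp only: class_props(7)[OF N])
  qed
  finally show ?thesis .
qed


section \<open>Closed walks and infinite products\<close>

text \<open>The symmetric denominator, the square root of k l, is replaced by the label of the
  initial node; around a closed cycle the two normalisations have the same product.\<close>

definition edge_coeff :: "(nat \<Rightarrow> nat \<Rightarrow> complex) \<Rightarrow> (nat \<Rightarrow> nat \<Rightarrow> complex) \<Rightarrow> nat \<times> nat \<Rightarrow> nat \<times> nat \<Rightarrow> complex" where
  "edge_coeff C1 C2 x y = (if snd x = 1 then C1 (fst x) (fst y) else C2 (fst x) (fst y)) / of_nat (fst x)"

abbreviation edge_C :: "complex \<Rightarrow> complex \<Rightarrow> nat \<times> nat \<Rightarrow> nat \<times> nat \<Rightarrow> complex" where
  "edge_C \<tau>1 \<tau>2 \<equiv> edge_coeff (\<lambda>k l. C_fun k l \<tau>1) (\<lambda>k l. C_fun k l \<tau>2)"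

text \<open>A chequered cycle is determined by its node labels and the label e of its first edge; 3
  - e exchanges 1 and 2.\<close>

definition alternate :: "nat \<Rightarrow> nat list \<Rightarrow> (nat \<times> nat) list" where
  "alternate e ns = map (\<lambda>i. (ns ! i, if even i then e else 3 - e)) [0..<length ns]"

definition even_lists :: "nat \<Rightarrow> nat list set" where
  "even_lists m = {ns. 0 \<notin> set ns \<and> sum_list ns = m \<and> even (length ns) \<and> ns \<noteq> []}"

lemma length_alternate [simp]: "length (alternate e ns) = length ns"
  by (simp add: alternate_def)

lemma alternate_nth: "i < length ns \<Longrightarrow> alternate e ns ! i = (ns ! i, if even i then e else 3 - e)"
  by (simp add: alternate_def)

lemma map_fst_alternate [simp]: "map fst (alternate e ns) = ns"
  by (simp add: alternate_def o_def map_nth)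

lemma alternate_eq_Nil_iff [simp]: "alternate e ns = [] \<longleftrightarrow> ns = []"
  by (simp add: alternate_def)

lemma hd_alternate: "ns \<noteq> [] \<Longrightarrow> hd (alternate e ns) = (hd ns, e)"
  by (simp add: hd_conv_nth alternate_nth)

lemma chequered_alternate:
  assumes "ns \<in> even_lists m" "e \<in> {1, 2}"
  shows "chequered_cycle (alternate e ns)"
proof -
  have ns: "0 \<notin> set ns" "even (length ns)" "ns \<noteq> []" using assms by (auto simp: even_lists_def)
  let ?n = "length ns"
  obtain k where k: "?n = 2 * k" using ns(2) by (elim evenE)
  have "snd (alternate e ns ! i) \<noteq> snd (alternate e ns ! (Suc i mod ?n))" if "i < ?n" for i
  proof -
    have "even (Suc i mod ?n) \<longleftrightarrow> odd i"
    proof (cases "Suc i = ?n")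
      case True
      have "even (Suc i)" unfolding True by (rule ns(2))
      then have "odd i" by simp
      then show ?thesis using True by simp
    next
      case False
      then have "Suc i < ?n" using that by simp
      then show ?thesis by simp
    qed
    moreover have "Suc i mod ?n < ?n" using that by (intro mod_less_divisor) linarith
    ultimately show ?thesis using that assms(2) by (auto simp: alternate_nth)
  qed
  moreover have "\<forall>x\<in>set (alternate e ns). case x of (k, e') \<Rightarrow> k > 0 \<and> e' \<in> {1, 2}"
  proof
    fix x assume "x \<in> set (alternate e ns)"
    then obtain i where "i < ?n" "x = alternate e ns ! i" by (metis in_set_conv_nth length_alternate)
    then show "case x of (k, e') \<Rightarrow> k > 0 \<and> e' \<in> {1, 2}"
      using ns(1) assms(2) nth_mem[of i ns] by (cases "ns ! i = 0") (auto simp: alternate_nth)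
  qed
  moreover have "k \<ge> 1" using k ns(3) by (cases k) auto
  ultimately show ?thesis using k by (auto simp: chequered_cycle_def)
qed

lemma bij_betw_alternate:
  assumes e: "e \<in> {1, 2}"
  shows "bij_betw (alternate e) (even_lists m) {xs. chequered_cycle xs \<and> node_sum xs = m \<and> snd (hd xs) = e}"
proof (rule bij_betwI[where g = "map fst"])
  show "alternate e \<in> even_lists m \<rightarrow> {xs. chequered_cycle xs \<and> node_sum xs = m \<and> snd (hd xs) = e}"
    using chequered_alternate[OF _ e] by (auto simp: node_sum_def even_lists_def hd_alternate)
  show "map fst \<in> {xs. chequered_cycle xs \<and> node_sum xs = m \<and> snd (hd xs) = e} \<rightarrow> even_lists m"
  proof
    fix xs assume "xs \<in> {xs. chequered_cycle xs \<and> node_sum xs = m \<and> snd (hd xs) = e}"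
    then have xs: "chequered_cycle xs" "node_sum xs = m" by auto
    have "0 \<notin> set (map fst xs)" using xs(1) by (fastforce simp: chequered_cycle_def)
    moreover have "even (length xs)" using xs(1) by (auto simp: chequered_cycle_def)
    ultimately show "map fst xs \<in> even_lists m"
      using chequered_nonempty[OF xs(1)] xs(2) by (simp add: even_lists_def node_sum_def)
  qed
  show "map fst (alternate e ns) = ns" for ns by simp
  fix xs assume "xs \<in> {xs. chequered_cycle xs \<and> node_sum xs = m \<and> snd (hd xs) = e}"
  then have xs: "chequered_cycle xs" "snd (hd xs) = e" by auto
  then have "snd (xs ! 0) = e" using chequered_nonempty[OF xs(1)] by (simp add: hd_conv_nth)
  then have "snd (xs ! i) = (if even i then e else 3 - e)" if "i < length xs" for i
    using alternating_labels[of xs i] that xs(1) by (auto simp: chequered_cycle_def)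
  then show "alternate e (map fst xs) = xs"
    by (intro nth_equalityI) (auto simp: alternate_nth intro: prod_eqI)
qed

text \<open>A walk weight divides by the label of every node except the first, so the factor
  \<open>hd ns\<close> compensates for the uniform denominators in the product. It matches the
  factor in the sum over cycles.\<close>

lemma walk_weight_even:
  assumes "even (length ns)" "ns \<noteq> []" "0 \<notin> set ns"
  shows "walk_weight C1 C2 k ns = of_nat (hd ns) *
    (\<Prod>i<length ns. (if even i then C1 else C2) (ns ! i) ((ns @ [k]) ! Suc i) / of_nat (ns ! i))"
  using assms
proof (induction C1 C2 k ns rule: walk_weight.induct)
  case (1 C1 C2 k l p m ns)
  have "(\<Prod>i<length (l # p # m # ns). (if even i then C1 else C2) ((l # p # m # ns) ! i) ((l # p # m # ns @ [k]) ! Suc i) / of_nat ((l # p # m # ns) ! i)) =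
    C1 l p / of_nat l * (C2 p m / of_nat p * (\<Prod>i<length (m # ns). (if even i then C1 else C2) ((m # ns) ! i) ((m # ns @ [k]) ! Suc i) / of_nat ((m # ns) ! i)))"
    by (simp only: length_Cons prod.lessThan_Suc_shift) simp
  then show ?case using 1 by simp
next
  case (2 C1 C2 k l p)
  then show ?case by (simp add: numeral_2_eq_2)
qed auto

lemma walk_weight_odd: "odd (length ns) \<Longrightarrow> walk_weight C1 C2 k ns = 0"
  by (induction C1 C2 k ns rule: walk_weight.induct) auto

lemma walk_weight_eq_cyc_prod:
  assumes "ns \<in> even_lists m"
  shows "walk_weight C1 C2 (hd ns) ns = of_nat (hd ns) * cyc_prod (edge_coeff C1 C2) (alternate 1 ns)"
proof -
  have ns: "0 \<notin> set ns" "even (length ns)" "ns \<noteq> []" using assms by (auto simp: even_lists_def)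
  have "(if even i then C1 else C2) (ns ! i) ((ns @ [hd ns]) ! Suc i) / of_nat (ns ! i) =
     edge_coeff C1 C2 (alternate 1 ns ! i) (alternate 1 ns ! (Suc i mod length ns))" if i: "i < length ns" for i
  proof -
    have "Suc i mod length ns < length ns" using i by (intro mod_less_divisor) linarith
    moreover have "(ns @ [hd ns]) ! Suc i = ns ! (Suc i mod length ns)"
    proof (cases "Suc i = length ns")
      case True
      then show ?thesis using ns(3) by (simp add: nth_append hd_conv_nth)
    qed (use i in \<open>simp add: nth_append\<close>)
    ultimately show ?thesis using i by (auto simp: edge_coeff_def alternate_nth)
  qed
  then show ?thesis
    unfolding walk_weight_even[OF ns(2,3,1)] cyc_prod_def length_alternate
    by (intro arg_cong2[of _ _ _ _ "(*)"] prod.cong) auto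
qed

text \<open>Traversing a cycle in the opposite direction, from the same node, exchanges the two possible
  labels of the first edge.\<close>

lemma cyc_prod_reverse:
  assumes ns: "ns \<in> even_lists m"
    and C1: "\<And>k l. k > 0 \<Longrightarrow> l > 0 \<Longrightarrow> C1 k l = C1 l k" and C2: "\<And>k l. k > 0 \<Longrightarrow> l > 0 \<Longrightarrow> C2 k l = C2 l k"
  shows "cyc_prod (edge_coeff C1 C2) (alternate 2 (hd ns # rev (tl ns))) = cyc_prod (edge_coeff C1 C2) (alternate 1 ns)"
proof -
  have nsp: "0 \<notin> set ns" "even (length ns)" "ns \<noteq> []" using ns by (auto simp: even_lists_def)
  define n where "n = length ns"
  define ns' where "ns' = hd ns # rev (tl ns)"
  have n: "n > 0" "length ns' = n" "even n" using nsp by (auto simp: n_def ns'_def)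
  have ns': "ns' ! i = ns ! ((n - i) mod n)" if "i < n" for i
  proof (cases i)
    case 0
    then show ?thesis using nsp(3) by (simp add: ns'_def hd_conv_nth n_def)
  next
    case (Suc j)
    have "ns' ! i = tl ns ! (n - 1 - Suc j)"
      using that Suc by (simp add: ns'_def rev_nth n_def)
    also have "\<dots> = ns ! (n - i)"
      using that Suc nsp(3) by (subst nth_tl) (auto simp: n_def Suc_diff_Suc)
    finally show ?thesis using that Suc by simp
  qed
  have pos: "ns ! i > 0" if "i < n" for i
    using nsp(1) nth_mem[of i ns] that by (metis n_def gr0I)
  have prods: "(\<Prod>i<n. of_nat (ns' ! i)) = (\<Prod>i<n. of_nat (ns ! i) :: complex)"
  proof -
    have "(\<Prod>i<n. of_nat (ns' ! i) :: complex) = of_nat (prod_list ns')"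
      by (simp add: prod.list_conv_set_nth n atLeast0LessThan)
    also have "prod_list ns' = hd ns * prod_list (tl ns)" by (simp add: ns'_def prod_list.rev)
    also have "\<dots> = prod_list ns" using nsp(3) by (cases ns) auto
    also have "of_nat (prod_list ns) = (\<Prod>i<n. of_nat (ns ! i) :: complex)"
      by (simp add: prod.list_conv_set_nth n_def atLeast0LessThan)
    finally show ?thesis .
  qed
  have cp: "cyc_prod (edge_coeff C1 C2) (alternate e ks) =
     (\<Prod>i<n. (if (if even i then e else 3 - e) = 1 then C1 else C2) (ks ! i) (ks ! (Suc i mod n))) / (\<Prod>i<n. of_nat (ks ! i))"
    if "length ks = n" for e ks
    unfolding cyc_prod_def length_alternate that prod_dividef[symmetric]
    using that by (intro prod.cong) (auto simp: alternate_nth edge_coeff_def)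
  have "(\<Prod>i<n. (if (if even i then 2 else 3 - 2) = (1::nat) then C1 else C2) (ns' ! i) (ns' ! (Suc i mod n))) =
    (\<Prod>i<n. (if (if even i then 1 else 3 - 1) = (1::nat) then C1 else C2) (ns ! i) (ns ! (Suc i mod n)))"
  proof (rule prod.reindex_bij_witness[where i = "\<lambda>j. n - 1 - j" and j = "\<lambda>i. n - 1 - i"])
    fix i assume i: "i \<in> {..<n}"
    \<comment> \<open>Reversal sends edge i to edge n - 1 - i. As n is even, these positions have
      opposite parity, which undoes the exchange of the labels; symmetry of the matrices takes care
      of the reversed direction.\<close>
    define j where "j = n - 1 - i"
    have ij: "i = n - 1 - j" "j < n" using i by (auto simp: j_def)
    have "i + j = n - 1" using i by (simp add: j_def)
    then have "odd (i + j)" using n by simp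
    then have par: "even j \<longleftrightarrow> odd i" by auto
    have a: "ns' ! i = ns ! (Suc j mod n)"
      using ns'[of i] i by (simp add: j_def Suc_diff_Suc)
    have b: "ns' ! (Suc i mod n) = ns ! j"
    proof (cases "Suc i = n")
      case True
      then show ?thesis using ns'[of 0] n by (simp add: j_def)
    next
      case False
      then have "Suc i < n" using i by simp
      then show ?thesis using ns'[of "Suc i"] by (simp add: j_def)
    qed
    have "Suc j mod n < n" using n by simp
    then show "(if (if even (n - 1 - i) then 1 else 3 - 1) = (1::nat) then C1 else C2) (ns ! (n - 1 - i)) (ns ! (Suc (n - 1 - i) mod n)) =
       (if (if even i then 2 else 3 - 2) = (1::nat) then C1 else C2) (ns' ! i) (ns' ! (Suc i mod n))"
      unfolding a b j_def[symmetric] using par pos ij C1 C2 by auto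
  qed auto
  then show ?thesis
    unfolding ns'_def[symmetric] cp[OF n(2)] cp[OF n_def[symmetric]] prods by simp
qed

section \<open>Sums over closed walks compared with sums over chequered cycles\<close>

definition walk_sum :: "(nat \<Rightarrow> nat \<Rightarrow> complex) \<Rightarrow> (nat \<Rightarrow> nat \<Rightarrow> complex) \<Rightarrow> nat \<Rightarrow> complex" where
  "walk_sum C1 C2 m = (\<Sum>ns | 0 \<notin> set ns \<and> sum_list ns = m. walk_weight C1 C2 (hd ns) ns)"

lemma walk_sum_eq_cyc_prod:
  "walk_sum C1 C2 m = (\<Sum>ns\<in>even_lists m. of_nat (hd ns) * cyc_prod (edge_coeff C1 C2) (alternate 1 ns))"
proof -
  have "walk_sum C1 C2 m = (\<Sum>ns\<in>even_lists m. walk_weight C1 C2 (hd ns) ns)"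
    unfolding walk_sum_def
  proof (rule sum.mono_neutral_right)
    show "finite {ns. 0 \<notin> set ns \<and> sum_list ns = m}"
      by (rule finite_lists_sum)
    have "walk_weight C1 C2 (hd ns) ns = 0" if "odd (length ns) \<or> ns = []" for ns
      using that walk_weight_odd by auto
    then show "\<forall>ns\<in>{ns. 0 \<notin> set ns \<and> sum_list ns = m} - even_lists m. walk_weight C1 C2 (hd ns) ns = 0"
      by (auto simp: even_lists_def)
  qed (auto simp: even_lists_def)
  then show ?thesis by (simp add: walk_weight_eq_cyc_prod)
qed

text \<open>The first edge of a chequered cycle may be labelled 1 or 2, whereas walks start with
  label 1. Reversal from the same node identifies the two halves, hence the factor 2.\<close>

lemma sum_chequered_eq_walk_sum:
  assumes C: "\<And>k l. k > 0 \<Longrightarrow> l > 0 \<Longrightarrow> C1 k l = C1 l k" "\<And>k l. k > 0 \<Longrightarrow> l > 0 \<Longrightarrow> C2 k l = C2 l k"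
  shows "(\<Sum>xs | chequered_cycle xs \<and> node_sum xs = m. of_nat (fst (hd xs)) * cyc_prod (edge_coeff C1 C2) xs) =
    2 * walk_sum C1 C2 m"
proof -
  let ?h = "\<lambda>xs. of_nat (fst (hd xs)) * cyc_prod (edge_coeff C1 C2) xs"
  let ?A = "\<lambda>e. {xs. chequered_cycle xs \<and> node_sum xs = m \<and> snd (hd xs) = e}"
  have "snd (hd xs) \<in> {1, 2}" if "chequered_cycle xs" for xs
    using that hd_in_set[OF chequered_nonempty[OF that]] by (auto simp: chequered_cycle_def)
  then have split: "{xs. chequered_cycle xs \<and> node_sum xs = m} = ?A 1 \<union> ?A 2" by auto
  have fin: "finite (?A e)" for e
    by (rule finite_subset[OF _ finite_chequered[of m]]) auto
  have s: "sum ?h (?A e) = (\<Sum>ns\<in>even_lists m. of_nat (hd ns) * cyc_prod (edge_coeff C1 C2) (alternate e ns))"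
    if "e \<in> {1, 2}" for e
  proof -
    have "sum ?h (?A e) = (\<Sum>ns\<in>even_lists m. ?h (alternate e ns))"
      by (rule sum.reindex_bij_betw[OF bij_betw_alternate[OF that], symmetric])
    also have "\<dots> = (\<Sum>ns\<in>even_lists m. of_nat (hd ns) * cyc_prod (edge_coeff C1 C2) (alternate e ns))"
      by (intro sum.cong) (auto simp: hd_alternate even_lists_def)
    finally show ?thesis .
  qed
  have rev: "hd ns # rev (tl ns) \<in> even_lists m" "hd (hd ns # rev (tl ns)) # rev (tl (hd ns # rev (tl ns))) = ns"
    if "ns \<in> even_lists m" for ns
    using that by (cases ns; auto simp: even_lists_def sum_list.rev)+
  have "sum ?h (?A 2) = (\<Sum>ns\<in>even_lists m. of_nat (hd ns) * cyc_prod (edge_coeff C1 C2) (alternate 2 ns))"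
    by (rule s) simp
  also have "\<dots> = (\<Sum>ns\<in>even_lists m. of_nat (hd ns) * cyc_prod (edge_coeff C1 C2) (alternate 1 ns))"
  proof (rule sum.reindex_bij_witness[where i = "\<lambda>ns. hd ns # rev (tl ns)" and j = "\<lambda>ns. hd ns # rev (tl ns)"])
    fix ns assume ns: "ns \<in> even_lists m"
    show "of_nat (hd (hd ns # rev (tl ns))) * cyc_prod (edge_coeff C1 C2) (alternate 1 (hd ns # rev (tl ns))) =
      of_nat (hd ns) * cyc_prod (edge_coeff C1 C2) (alternate 2 ns)"
      using cyc_prod_reverse[OF rev(1)[OF ns] C] unfolding rev(2)[OF ns] by simp
  qed (use rev in blast)+
  also have "\<dots> = walk_sum C1 C2 m" by (rule walk_sum_eq_cyc_prod[symmetric])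
  finally have 2: "sum ?h (?A 2) = walk_sum C1 C2 m" .
  have 1: "sum ?h (?A 1) = walk_sum C1 C2 m"
    using s[of 1] by (simp add: walk_sum_eq_cyc_prod)
  have "sum ?h (?A 1 \<union> ?A 2) = sum ?h (?A 1) + sum ?h (?A 2)"
    by (rule sum.union_disjoint) (auto simp: fin)
  then show ?thesis unfolding split 1 2 by simp
qed

lemma C_fun_symmetric: "k > 0 \<Longrightarrow> l > 0 \<Longrightarrow> C_fun k l \<tau> = C_fun l k \<tau>"
proof (cases "even (k + l)")
  case True
  then have "(- 1 :: complex) ^ (k + 1) = (- 1) ^ (l + 1)" by (cases "even k") auto
  then show ?thesis by (simp add: C_fun_def add.commute mult.commute)
qed (simp_all add: C_fun_def Eis_def)

lemma fps_const_prod: "(\<Prod>i\<in>A. fps_const (f i)) = fps_const (\<Prod>i\<in>A. f i :: complex)"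
  by (induction A rule: infinite_finite_induct) auto

text \<open>Each node belongs to two edges, so the square roots of its label multiply to the label
  itself and its label enters the exponent of the variable twice.\<close>

lemma cycle_weight_eq:
  "cycle_weight \<tau>1 \<tau>2 xs = fps_const (cyc_prod (edge_C \<tau>1 \<tau>2) xs) * fps_X ^ (2 * node_sum xs)"
proof -
  define n where "n = length xs"
  define k where "k i = fst (xs ! i)" for i
  define C where "C i = C_fun (k i) (k (Suc i mod n)) (if snd (xs ! i) = 1 then \<tau>1 else \<tau>2)" for i
  have shift: "(\<Prod>i<n. g (Suc i mod n)) = (\<Prod>i<n. g i)" for g :: "nat \<Rightarrow> real"
    using prod.reindex_bij_betw[OF bij_betw_shift_mod[of 1 n], of g] by simp
  have shift': "(\<Sum>i<n. g (Suc i mod n)) = (\<Sum>i<n. g i)" for g :: "nat \<Rightarrow> nat"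
    using sum.reindex_bij_betw[OF bij_betw_shift_mod[of 1 n], of g] by simp
  have "(\<Prod>i<n. sqrt (real (k i * k (Suc i mod n)))) = (\<Prod>i<n. sqrt (real (k i))) * (\<Prod>i<n. sqrt (real (k (Suc i mod n))))"
    by (simp add: real_sqrt_mult prod.distrib)
  also have "(\<Prod>i<n. sqrt (real (k (Suc i mod n)))) = (\<Prod>i<n. sqrt (real (k i)))"
    by (rule shift)
  also have "(\<Prod>i<n. sqrt (real (k i))) * (\<Prod>i<n. sqrt (real (k i))) = (\<Prod>i<n. real (k i))"
    unfolding prod.distrib[symmetric] by simp
  finally have sq: "(\<Prod>i<n. sqrt (real (k i * k (Suc i mod n)))) = (\<Prod>i<n. real (k i))" .
  have "(\<Prod>i<n. C i / of_real (sqrt (real (k i * k (Suc i mod n))))) = (\<Prod>i<n. C i) / of_real (\<Prod>i<n. sqrt (real (k i * k (Suc i mod n))))"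
    by (simp only: prod_dividef of_real_prod)
  also have "\<dots> = (\<Prod>i<n. C i / of_nat (k i))"
    unfolding sq by (simp add: prod_dividef)
  also have "\<dots> = cyc_prod (edge_C \<tau>1 \<tau>2) xs"
    unfolding cyc_prod_def n_def[symmetric] by (intro prod.cong) (auto simp: edge_coeff_def C_def k_def)
  finally have c: "(\<Prod>i<n. C i / of_real (sqrt (real (k i * k (Suc i mod n))))) = cyc_prod (edge_C \<tau>1 \<tau>2) xs" .
  have "(\<Sum>i<n. k i + k (Suc i mod n)) = 2 * node_sum xs"
    unfolding sum.distrib shift'[of k] node_sum_def
    by (simp add: sum_list_sum_nth n_def k_def atLeast0LessThan)
  moreover have "cycle_weight \<tau>1 \<tau>2 xs = (\<Prod>i<n. fps_const (C i / of_real (sqrt (real (k i * k (Suc i mod n))))) * fps_X ^ (k i + k (Suc i mod n)))"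
    unfolding cycle_weight_def A_mat_def n_def[symmetric] by (simp add: C_def k_def)
  ultimately show ?thesis
    by (simp only: prod.distrib fps_const_prod c flip: power_sum)
qed

lemma class_weight_eq:
  assumes "N \<in> rotationless_classes"
  shows "class_weight \<tau>1 \<tau>2 N = fps_const (class_prod (edge_C \<tau>1 \<tau>2) N) * fps_X ^ (2 * class_degree N)"
proof -
  have "cycle_weight \<tau>1 \<tau>2 xs = fps_const (class_prod (edge_C \<tau>1 \<tau>2) N) * fps_X ^ (2 * class_degree N)"
    if "xs \<in> N" for xs
    unfolding cycle_weight_eq class_props(5)[OF assms that] class_props(6)[OF assms that] ..
  then have "cycle_weight \<tau>1 \<tau>2 ` N = {fps_const (class_prod (edge_C \<tau>1 \<tau>2) N) * fps_X ^ (2 * class_degree N)}"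
    using class_props(3)[OF assms] by (simp add: image_constant_conv cong: image_cong)
  then show ?thesis by (simp add: class_weight_def)
qed

text \<open>The geometric series c X^d / (1 - c X^d).\<close>

definition power_sum_fps :: "complex \<Rightarrow> nat \<Rightarrow> complex fps" where
  "power_sum_fps c d = Abs_fps (\<lambda>i. if i > 0 \<and> d dvd i then c ^ (i div d) else 0)"

lemma power_sum_fps:
  assumes "d \<ge> 1"
  shows "(1 - fps_const c * fps_X ^ d) * (1 + power_sum_fps c d) = 1"
proof -
  have "power_sum_fps c d = fps_const c * (fps_X ^ d * (1 + power_sum_fps c d))"
  proof (rule fps_ext)
    fix i
    show "power_sum_fps c d $ i = (fps_const c * (fps_X ^ d * (1 + power_sum_fps c d))) $ i"
    proof (cases "i < d")
      case True
      then show ?thesis by (auto simp: power_sum_fps_def fps_X_power_mult_nth dest: dvd_imp_le)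
    next
      case False
      then obtain j where "i = d + j" by (metis le_iff_add not_less)
      then show ?thesis using assms by (auto simp: power_sum_fps_def fps_X_power_mult_nth)
    qed
  qed
  then show ?thesis by (simp add: algebra_simps)
qed

lemma one_minus_power_deriv:
  assumes "w $ 0 = 0"
  shows "(1 - w) * fps_deriv (one_minus_power w s) = - (fps_const s * fps_deriv w * one_minus_power w s)"
proof -
  have w: "(- w) $ 0 = 0" using assms by simp
  have b: "(1 + fps_X) * fps_deriv (fps_binomial s) = fps_const s * fps_binomial s"
  proof -
    have "fps_deriv (fps_binomial s) = fps_const s * fps_binomial s / (1 + fps_X)" by (rule fps_binomial_deriv)
    then show ?thesis by (simp add: fps_divide_unit mult.left_commute inverse_mult_eq_1')
  qed
  have "(1 - w) * (fps_deriv (fps_binomial s) oo - w) = ((1 + fps_X) * fps_deriv (fps_binomial s)) oo - w"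
    using w by (simp add: fps_compose_mult_distrib fps_compose_add_distrib)
  also have "\<dots> = fps_const s * one_minus_power w s"
    unfolding b one_minus_power_def using w by (simp add: fps_compose_mult_distrib)
  finally have *: "(1 - w) * (fps_deriv (fps_binomial s) oo - w) = fps_const s * one_minus_power w s" .
  have "(1 - w) * fps_deriv (one_minus_power w s) = ((1 - w) * (fps_deriv (fps_binomial s) oo - w)) * (- fps_deriv w)"
    unfolding one_minus_power_def by (simp only: fps_compose_deriv[OF w] mult.assoc fps_deriv_neg)
  then show ?thesis unfolding * by (simp add: mult_ac)
qed

text \<open>The logarithmic derivative of (1 - c X^d)^s, multiplied by X, is - s d times the
  geometric series. The equation is kept free of division by \<open>f\<close>.\<close>

lemma one_minus_power_monomial:
  fixes c s :: complex
  assumes d: "d \<ge> 1"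
  defines "f \<equiv> one_minus_power (fps_const c * fps_X ^ d) s"
  shows "f $ 0 = 1" "fps_X * fps_deriv f = - (fps_const (s * of_nat d) * power_sum_fps c d * f)"
proof -
  let ?w = "fps_const c * fps_X ^ d" and ?g = "power_sum_fps c d"
  have w: "?w $ 0 = 0" using d by simp
  show "f $ 0 = 1" by (simp add: f_def one_minus_power_def)
  have "fps_X * fps_deriv ?w = fps_const (of_nat d) * ?w"
  proof (rule fps_ext)
    fix i
    show "(fps_X * fps_deriv ?w) $ i = (fps_const (of_nat d) * ?w) $ i"
      by (cases i) auto
  qed
  then have wd: "fps_X * ((1 - ?w) * fps_deriv f) = - (fps_const (s * of_nat d) * ?w * f)"
    unfolding f_def one_minus_power_deriv[OF w] by (simp add: mult_ac flip: fps_const_mult) (metis mult.assoc mult.commute)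
  have g: "?w * (1 + ?g) = ?g" using power_sum_fps[OF d, of c] by (simp add: algebra_simps)
  have "fps_X * fps_deriv f = ((1 - ?w) * (1 + ?g)) * (fps_X * fps_deriv f)"
    by (simp only: power_sum_fps[OF d] mult_1)
  also have "\<dots> = (1 + ?g) * (fps_X * ((1 - ?w) * fps_deriv f))" by (simp only: mult_ac)
  also have "\<dots> = - (fps_const (s * of_nat d) * (?w * (1 + ?g)) * f)"
    unfolding wd by (simp only: mult_ac mult_minus_right)
  finally show "fps_X * fps_deriv f = - (fps_const (s * of_nat d) * ?g * f)" unfolding g .
qed

text \<open>The differential equation itself forces a factor of degree d to agree with 1 below order
  d, so every coefficient of the partial products stabilises. Logarithmic derivatives add up, and
  only finitely many of them reach a given coefficient.\<close>

lemma fps_product_exists: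
  fixes f h :: "'i \<Rightarrow> complex fps" and d :: "'i \<Rightarrow> nat"
  assumes fin: "\<And>n. finite {N \<in> I. d N \<le> n}"
    and f0: "\<And>N. N \<in> I \<Longrightarrow> f N $ 0 = 1"
    and ode: "\<And>N. N \<in> I \<Longrightarrow> fps_X * fps_deriv (f N) = - (h N * f N)"
    and h: "\<And>N i. N \<in> I \<Longrightarrow> i < d N \<Longrightarrow> h N $ i = 0"
  defines "V \<equiv> Abs_fps (\<lambda>i. \<Sum>N | N \<in> I \<and> d N \<le> i. h N $ i)"
  shows "\<exists>P. has_fps_prod f I P \<and> P $ 0 = 1 \<and> fps_X * fps_deriv P = - (V * P)"
proof -
  have f_low: "f N $ i = (if i = 0 then 1 else 0)" if "N \<in> I" "i < d N" for N i
  proof (cases "i = 0")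
    case False
    have "of_nat i * f N $ i = (fps_X * fps_deriv (f N)) $ i"
      using False by (cases i) simp_all
    also have "\<dots> = - ((h N * f N) $ i)" by (simp add: ode[OF that(1)])
    also have "(h N * f N) $ i = 0"
      unfolding fps_mult_nth using h[OF that(1)] that(2) by (intro sum.neutral) auto
    finally show ?thesis using False by simp
  qed (simp add: f0[OF that(1)])
  have prod_low: "(\<Prod>N\<in>F. f N) $ i = (if i = 0 then 1 else 0)"
    if "finite F" "F \<subseteq> {N \<in> I. d N > n}" "i \<le> n" for F i n
    using that
  proof (induction F arbitrary: i rule: finite_induct)
    case (insert N F)
    have "(\<Prod>N\<in>insert N F. f N) $ i = (\<Sum>j=0..i. f N $ j * (\<Prod>N\<in>F. f N) $ (i - j))"
      using insert.hyps by (simp add: fps_mult_nth)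
    also have "\<dots> = (\<Sum>j=0..i. if j = 0 then (\<Prod>N\<in>F. f N) $ i else 0)"
      using insert.prems f_low[of N] by (intro sum.cong) auto
    also have "\<dots> = (\<Prod>N\<in>F. f N) $ i" by simp
    finally show ?case using insert.IH[of i] insert.prems by auto
  qed simp
  define F where "F n = {N \<in> I. d N \<le> n}" for n
  have stable: "(\<Prod>N\<in>G. f N) $ i = (\<Prod>N\<in>F n. f N) $ i"
    if "finite G" "F n \<subseteq> G" "G \<subseteq> I" "i \<le> n" for G i n
  proof -
    have sub: "G - F n \<subseteq> {N \<in> I. d N > n}" using that(3) by (auto simp: F_def)
    have "(\<Prod>N\<in>G. f N) = (\<Prod>N\<in>F n. f N) * (\<Prod>N\<in>G - F n. f N)"
      using that by (simp add: prod.subset_diff mult.commute)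
    also have "\<dots> $ i = (\<Sum>j=0..i. (\<Prod>N\<in>F n. f N) $ j * (if i - j = 0 then 1 else 0))"
      unfolding fps_mult_nth using that(1,4)
      by (intro sum.cong refl arg_cong2[of _ _ _ _ "(*)"] prod_low[OF _ sub]) auto
    also have "\<dots> = (\<Sum>j=0..i. if j = i then (\<Prod>N\<in>F n. f N) $ j else 0)"
      by (intro sum.cong) auto
    finally show ?thesis by simp
  qed
  \<comment> \<open>Once all factors of degree at most n are included, the coefficient at n no
    longer changes, so the limit is read off diagonally.\<close>
  define P where "P = Abs_fps (\<lambda>n. (\<Prod>N\<in>F n. f N) $ n)"
  have P_nth: "P $ i = (\<Prod>N\<in>F n. f N) $ i" if "i \<le> n" for i n
    unfolding P_def fps_nth_Abs_fps
    by (rule stable[symmetric]) (use fin that in \<open>auto simp: F_def\<close>)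
  have "has_fps_prod f I P"
    unfolding has_fps_prod_def
  proof (rule tendsto_fpsI)
    fix n
    have "(\<Prod>N\<in>G. f N) $ n = P $ n" if "finite G" "F n \<subseteq> G" "G \<subseteq> I" for G
      using stable[OF that, of n] P_nth[of n n] by simp
    then show "\<forall>\<^sub>F G in finite_subsets_at_top I. (\<Prod>N\<in>G. f N) $ n = P $ n"
      unfolding eventually_finite_subsets_at_top
      using fin[of n] by (intro exI[of _ "F n"]) (auto simp: F_def)
  qed
  moreover have "P $ 0 = 1"
  proof -
    have "(\<Prod>N\<in>G. f N) $ 0 = 1" if "G \<subseteq> I" for G
      using that by (induction G rule: infinite_finite_induct) (auto simp: f0)
    then show ?thesis by (auto simp: P_def F_def)
  qed
  moreover have "fps_X * fps_deriv P = - (V * P)"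
  proof (rule fps_ext)
    fix n
    have logder: "fps_X * fps_deriv (\<Prod>N\<in>G. f N) = - ((\<Sum>N\<in>G. h N) * (\<Prod>N\<in>G. f N))"
      if "finite G" "G \<subseteq> I" for G
      using that
    proof (induction G rule: finite_induct)
      case (insert N G)
      have "fps_X * fps_deriv (f N * (\<Prod>N\<in>G. f N)) =
        (fps_X * fps_deriv (f N)) * (\<Prod>N\<in>G. f N) + f N * (fps_X * fps_deriv (\<Prod>N\<in>G. f N))"
        by (simp add: algebra_simps)
      also have "\<dots> = - ((h N + (\<Sum>N\<in>G. h N)) * (f N * (\<Prod>N\<in>G. f N)))"
        using insert by (simp add: ode algebra_simps)
      finally show ?case using insert.hyps by simp
    qed simp
    have xd: "(fps_X * fps_deriv A) $ n = of_nat n * A $ n" for A :: "complex fps"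
      by (cases n) simp_all
    have "(fps_X * fps_deriv P) $ n = (fps_X * fps_deriv (\<Prod>N\<in>F n. f N)) $ n"
      unfolding xd by (simp add: P_nth[of n n])
    also have "\<dots> = - (\<Sum>i=0..n. (\<Sum>N\<in>F n. h N) $ i * (\<Prod>N\<in>F n. f N) $ (n - i))"
      by (subst logder) (use fin in \<open>auto simp: F_def fps_mult_nth\<close>)
    also have "\<dots> = - (\<Sum>i=0..n. V $ i * P $ (n - i))"
    proof -
      have "(\<Sum>N\<in>F n. h N) $ i = V $ i" if "i \<le> n" for i
        unfolding V_def F_def fps_sum_nth fps_nth_Abs_fps
        using fin[of n] that h by (intro sum.mono_neutral_right) (auto simp: not_le)
      then show ?thesis by (simp add: P_nth[of _ n])
    qed
    finally show "(fps_X * fps_deriv P) $ n = (- (V * P)) $ n"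
      by (simp add: fps_mult_nth)
  qed
  ultimately show ?thesis by blast
qed

text \<open>The exponent 1/2 cancels the factor 2 in the order of the class weight, so a class
  contributes its degree times a geometric series. At X^(2m) only classes whose degree divides m
  remain, and their sum is twice the walk sum.\<close>

lemma cycle_product:
  assumes "w = walk_sum (\<lambda>k l. C_fun k l \<tau>1) (\<lambda>k l. C_fun k l \<tau>2)"
  shows "\<exists>P. has_fps_prod (\<lambda>N. one_minus_power (class_weight \<tau>1 \<tau>2 N) (1 / 2)) rotationless_classes P \<and>
    P $ 0 = 1 \<and> fps_X * fps_deriv P = - (fps_const 2 * (Abs_fps w oo fps_X ^ 2) * P)"
proof -
  define E where "E = edge_C \<tau>1 \<tau>2"
  define h where "h N = fps_const (of_nat (class_degree N)) * power_sum_fps (class_prod E N) (2 * class_degree N)" for N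
  have "\<exists>P. has_fps_prod (\<lambda>N. one_minus_power (class_weight \<tau>1 \<tau>2 N) (1 / 2)) rotationless_classes P \<and>
    P $ 0 = 1 \<and> fps_X * fps_deriv P =
      - (Abs_fps (\<lambda>i. \<Sum>N | N \<in> rotationless_classes \<and> 2 * class_degree N \<le> i. h N $ i) * P)"
  proof (rule fps_product_exists)
    show "finite {N \<in> rotationless_classes. 2 * class_degree N \<le> n}" for n
      by (rule finite_subset[OF _ finite_rotationless_classes[of n]]) auto
    fix N assume N: "N \<in> rotationless_classes"
    have d: "2 * class_degree N \<ge> 1" using class_props(8)[OF N] by simp
    note cw = class_weight_eq[OF N, of \<tau>1 \<tau>2, folded E_def]
    show "one_minus_power (class_weight \<tau>1 \<tau>2 N) (1 / 2) $ 0 = 1"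
      unfolding cw by (rule one_minus_power_monomial(1)[OF d])
    show "fps_X * fps_deriv (one_minus_power (class_weight \<tau>1 \<tau>2 N) (1 / 2)) =
       - (h N * one_minus_power (class_weight \<tau>1 \<tau>2 N) (1 / 2))"
      unfolding cw one_minus_power_monomial(2)[OF d] h_def by simp
    show "h N $ i = 0" if "i < 2 * class_degree N" for i
      using that by (auto simp: h_def power_sum_fps_def dest: dvd_imp_le)
  qed
  moreover have "Abs_fps (\<lambda>i. \<Sum>N | N \<in> rotationless_classes \<and> 2 * class_degree N \<le> i. h N $ i) =
     fps_const 2 * (Abs_fps w oo fps_X ^ 2)"
  proof (rule fps_ext)
    fix i
    have w0: "w 0 = 0"
    proof -
      have "even_lists 0 = {}"
      proof (rule ccontr)
        assume "even_lists 0 \<noteq> {}"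
        then obtain ns where "ns \<in> even_lists 0" by blast
        then show False by (cases ns) (auto simp: even_lists_def)
      qed
      then show ?thesis by (simp add: assms walk_sum_eq_cyc_prod)
    qed
    have "(\<Sum>N | N \<in> rotationless_classes \<and> 2 * class_degree N \<le> i. h N $ i) = (if even i then 2 * w (i div 2) else 0)"
    proof (cases "even i \<and> i > 0")
      case True
      then obtain m where m: "i = 2 * m" "m > 0" by (auto elim!: evenE)
      have "(\<Sum>N | N \<in> rotationless_classes \<and> 2 * class_degree N \<le> i. h N $ i) =
        (\<Sum>N | N \<in> rotationless_classes \<and> class_degree N dvd m. of_nat (class_degree N) * class_prod E N ^ (m div class_degree N))"
      proof (rule sum.mono_neutral_cong_right)
        show "finite {N \<in> rotationless_classes. 2 * class_degree N \<le> i}"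
          by (rule finite_subset[OF _ finite_rotationless_classes[of i]]) auto
      qed (use m in \<open>auto simp: h_def power_sum_fps_def dest: dvd_imp_le\<close>)
      also have "\<dots> = 2 * w m"
        unfolding sum_chequered_eq_sum_classes[OF m(2), symmetric] E_def assms
        by (rule sum_chequered_eq_walk_sum) (auto intro: C_fun_symmetric)
      finally show ?thesis using m by simp
    next
      case False
      have "h N $ i = 0" for N
      proof (cases "i > 0")
        case True
        then have "\<not> 2 * class_degree N dvd i" using False dvd_mult_left by blast
        then show ?thesis by (simp add: h_def power_sum_fps_def)
      qed (simp add: h_def power_sum_fps_def)
      then show ?thesis using False w0 by auto
    qed
    moreover have "(Abs_fps w oo fps_X ^ 2) $ i = (if even i then w (i div 2) else 0)"
      by (subst fps_nth_compose_X_power) simp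
    ultimately show "Abs_fps (\<lambda>i. \<Sum>N | N \<in> rotationless_classes \<and> 2 * class_degree N \<le> i. h N $ i) $ i =
      (fps_const 2 * (Abs_fps w oo fps_X ^ 2)) $ i" by simp
  qed
  ultimately show ?thesis by simp
qed

section \<open>The differential equation in \<epsilon> and the comparison with the product\<close>

lemma walk_recursion_ode:
  assumes "\<And>n. of_nat n * K n = (\<Sum>ns\<in>pos_lists n. walk_weight C1 C2 (hd ns) ns * K (n - sum_list ns))"
  shows "fps_X * fps_deriv (Abs_fps K) = Abs_fps (walk_sum C1 C2) * Abs_fps K"
proof (rule fps_ext)
  fix n
  have "(fps_X * fps_deriv (Abs_fps K)) $ n = of_nat n * K n" by (cases n) simp_all
  also have "\<dots> = (\<Sum>ns\<in>pos_lists n. walk_weight C1 C2 (hd ns) ns * K (n - sum_list ns))" by (rule assms)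
  also have "\<dots> = (\<Sum>s\<in>{0..n}. \<Sum>ns\<in>{ns \<in> pos_lists n. sum_list ns = s}. walk_weight C1 C2 (hd ns) ns * K (n - sum_list ns))"
    by (rule sum.group[symmetric], simp, simp) (auto simp: pos_lists_def)
  also have "\<dots> = (\<Sum>s\<in>{0..n}. walk_sum C1 C2 s * K (n - s))"
    unfolding walk_sum_def sum_distrib_right
    by (intro sum.cong refl) (auto simp: pos_lists_def)
  finally show "(fps_X * fps_deriv (Abs_fps K)) $ n = (Abs_fps (walk_sum C1 C2) * Abs_fps K) $ n"
    by (simp add: fps_mult_nth)
qed

context heisenberg_liz
begin

lemma genus_two_partition_fun_product:
  assumes U: "\<And>n. is_basis_of (U n) (sq_grade (int n))"
    and "Im \<tau>1 > 0" and "Im \<tau>2 > 0"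
  shows "\<exists>P. has_fps_prod (\<lambda>N. one_minus_power (class_weight \<tau>1 \<tau>2 N) (1 / 2)) rotationless_classes P \<and>
    fps_compose (genus_two_partition_fun B U \<tau>1 \<tau>2) (fps_X ^ 2) =
      fps_const (partition_fun \<tau>1 * partition_fun \<tau>2) / P"
proof -
  define w where "w = walk_sum (\<lambda>k l. C_fun k l \<tau>1) (\<lambda>k l. C_fun k l \<tau>2)"
  define K where "K n = (\<Sum>u\<in>U n. one_point u \<tau>1 * one_point (dual_vec B (U n) u) \<tau>2)" for n
  define Z where "Z = partition_fun \<tau>1 * partition_fun \<tau>2"
  note rec = gaussian_pairing_recursion[where U = U, OF U linear_one_point[OF assms(2)] linear_one_point[OF assms(3)]
      one_point_recursion[OF assms(2)] one_point_recursion[OF assms(3)], folded K_def]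
  have K0: "K 0 = Z" using rec(1) by (simp add: one_point_vac Z_def assms(2,3))
  have K: "fps_X * fps_deriv (Abs_fps K) = Abs_fps w * Abs_fps K"
    unfolding w_def by (rule walk_recursion_ode[OF rec(2)])
  \<comment> \<open>The variable stands for the square root of \<epsilon>; the substitution doubles
    the logarithmic derivative, in accordance with the factor 2 in
    \<open>cycle_product\<close>.\<close>
  define G where "G = Abs_fps K oo fps_X ^ 2"
  have G: "fps_X * fps_deriv G = fps_const 2 * (Abs_fps w oo fps_X ^ 2) * G"
  proof -
    have X: "(fps_X ^ 2 :: complex fps) $ 0 = 0" by simp
    have "fps_deriv (fps_X ^ 2 :: complex fps) = fps_const 2 * fps_X"
      by (simp add: fps_deriv_power numeral_fps_const)
    then have "fps_X * fps_deriv G = fps_const 2 * ((fps_deriv (Abs_fps K) oo fps_X ^ 2) * (fps_X ^ 2))"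
      unfolding G_def fps_compose_deriv[OF X] by (simp add: power2_eq_square mult_ac)
    also have "(fps_deriv (Abs_fps K) oo fps_X ^ 2) * (fps_X ^ 2) = (fps_X * fps_deriv (Abs_fps K)) oo fps_X ^ 2"
      by (simp add: fps_compose_mult_distrib[OF X] mult.commute)
    also have "\<dots> = (Abs_fps w oo fps_X ^ 2) * G"
      unfolding K G_def by (rule fps_compose_mult_distrib[OF X])
    finally show ?thesis by (simp only: mult.assoc)
  qed
  obtain P where P: "has_fps_prod (\<lambda>N. one_minus_power (class_weight \<tau>1 \<tau>2 N) (1 / 2)) rotationless_classes P"
    "P $ 0 = 1" "fps_X * fps_deriv P = - (fps_const 2 * (Abs_fps w oo fps_X ^ 2) * P)"
    using cycle_product[OF w_def] by blast
  \<comment> \<open>The logarithmic derivatives of \<open>G\<close> and \<open>P\<close> are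
    opposite, so the product is constant. Its value is read off at \<epsilon> = 0, where only the
    vacuum contributes.\<close>
  have "fps_X * fps_deriv (G * P) = (fps_X * fps_deriv G) * P + G * (fps_X * fps_deriv P)"
    by (simp add: algebra_simps)
  also have "\<dots> = 0" unfolding G P(3) by (simp add: mult_ac)
  finally have "fps_deriv (G * P) = 0" by simp
  then have "G * P = fps_const ((G * P) $ 0)" by (rule fps_deriv_eq_0_iff[THEN iffD1])
  also have "(G * P) $ 0 = Z" by (simp add: P(2) G_def K0)
  finally have "G = fps_const Z / P"
    using P(2) by (metis fps_divide_times_eq fps_nonzeroI nonzero_mult_div_cancel_right zero_neq_one)
  moreover have "genus_two_partition_fun B U \<tau>1 \<tau>2 = Abs_fps K"
    by (simp add: genus_two_partition_fun_def K_def[abs_def])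
  ultimately show ?thesis using P(1) unfolding G_def Z_def by metis
qed

end

theorem theorem6p6:
  fixes scale :: "complex \<Rightarrow> 'v \<Rightarrow> 'v::ab_group_add"
    and Y :: "'v \<Rightarrow> int \<Rightarrow> 'v \<Rightarrow> 'v"
    and vac conf a :: 'v
    and B :: "'v \<Rightarrow> 'v \<Rightarrow> complex"
    and U :: "nat \<Rightarrow> 'v set"
    and \<tau>1 \<tau>2 :: complex
  assumes M: "heisenberg_voa scale Y vac conf a"
    and B: "voa_data.is_sq_LiZ_metric scale Y vac conf 1 B"
    and U: "\<And>n. voa_data.is_basis_of scale (U n) (voa_data.sq_grade scale Y vac conf 1 (int n))"
    and "Im \<tau>1 > 0" and "Im \<tau>2 > 0"
  shows "\<exists>P. has_fps_prod (\<lambda>N. one_minus_power (class_weight \<tau>1 \<tau>2 N) (1 / 2)) rotationless_classes P \<and>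
    fps_compose (voa_data.genus_two_partition_fun scale Y conf B U \<tau>1 \<tau>2) (fps_X ^ 2) =
      fps_const (voa_data.partition_fun scale Y conf \<tau>1 * voa_data.partition_fun scale Y conf \<tau>2) / P"
proof -
  interpret heisenberg_liz scale Y vac conf a B
    using M B by (simp add: heisenberg_liz_def heisenberg_liz_axioms_def)
  show ?thesis using U assms(4,5) by (rule genus_two_partition_fun_product)
qed

end
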